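(* For any $\alpha$ with $1\le\alpha<8/\sqrt2$, there is a constant $M_\alpha$ such that for all integers $n\ge3$ and $d\ge3$ with $nd$ even and $d\le n^{1/2}/\log n$, $$\mathbb E_{\mathcal P_{n,d}}\left[f_n^2\right]\le\frac{d}{d-2}+M_\alpha\frac{d^{\frac32(1+1/\alpha)}}{\sqrt n},\qquad\text{where } f_n=\frac{H_n}{\mathbb E_{\mathcal P_{n,d}}H_n}.$$
   Context: Configuration model $\mathcal P_{n,d}$ ($nd$ even): $nd$ prevertices are partitioned into $n$ bins of size $d$, and $\mathcal P_{n,d}$ is the uniform law on perfect matchings ("pairings") of the $nd$ prevertices. The projection of a pairing is the $d$-regular pseudograph on $n$ vertices obtained by identifying all prevertices in each bin and keeping every pair as an edge. For a pairing $P$, $H_n(P)$ is the number of Hamiltonian cycles in its projection (collections of $n$ pairs of $P$ projecting to a cycle through all $n$ vertices). *)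

theory Defs
  imports "HOL-Probability.Probability"
begin

text \<open>A prevertex is a pair \<open>(i, j)\<close> with \<open>i < n\<close> and \<open>j < d\<close>; it is the \<open>j\<close>-th of the \<open>d\<close>
  prevertices in the bin of vertex \<open>i\<close>. A pairing is a partition of the prevertices into
  two-element sets.\<close>

definition prevertices :: "nat \<Rightarrow> nat \<Rightarrow> (nat \<times> nat) set" where
  "prevertices n d = {..<n} \<times> {..<d}"

definition pairings :: "nat \<Rightarrow> nat \<Rightarrow> (nat \<times> nat) set set set" where
  "pairings n d = {P. partition_on (prevertices n d) P \<and> (\<forall>e\<in>P. card e = 2)}"

text \<open>\<open>pmf_of_set\<close> is only meaningful on finite nonempty sets; \<open>pairings n d\<close> is nonempty exactly
  when \<open>n * d\<close> is even.\<close>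

definition config_model :: "nat \<Rightarrow> nat \<Rightarrow> (nat \<times> nat) set set pmf" where
  "config_model n d = pmf_of_set (pairings n d)"

text \<open>The projection of a pairing \<open>P\<close> is the pseudograph with vertex set \<open>{..<n}\<close> whose edges are the
  pairs of \<open>P\<close> themselves, the map below giving the set of endpoints of an edge. Parallel edges are
  thus kept apart, and a loop at \<open>i\<close> is a pair with endpoint set \<open>{i}\<close>.\<close>

definition endpoints :: "(nat \<times> nat) set \<Rightarrow> nat set" where
  "endpoints e = fst ` e"

text \<open>A Hamiltonian cycle is a set of \<open>n\<close> pairs, not a cyclic sequence, so it carries neither a
  starting point nor an orientation: the enumerations \<open>v\<close> of the vertices and \<open>e\<close> of the pairs
  around the cycle are existentially quantified.\<close>

definition hamiltonian_cycles :: "nat \<Rightarrow> (nat \<times> nat) set set \<Rightarrow> (nat \<times> nat) set set set" where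
  "hamiltonian_cycles n P =
     {C. C \<subseteq> P \<and>
         (\<exists>v e. bij_betw v {..<n} {..<n} \<and> bij_betw e {..<n} C \<and>
                (\<forall>k<n. endpoints (e k) = {v k, v (Suc k mod n)}))}"

definition ham_count :: "nat \<Rightarrow> (nat \<times> nat) set set \<Rightarrow> real" where
  "ham_count n P = real (card (hamiltonian_cycles n P))"

definition normalized_ham_count :: "nat \<Rightarrow> nat \<Rightarrow> (nat \<times> nat) set set \<Rightarrow> real" where
  "normalized_ham_count n d P =
     ham_count n P / measure_pmf.expectation (config_model n d) (ham_count n)"

end

theory Submission
  imports Defs "HOL-Real_Asymp.Real_Asymp"
begin

text \<open>By symmetry the second moment of \<open>f\<^sub>n\<close> is a sum over the Hamiltonian cycles \<open>C\<close> compatible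
  with one fixed cycle \<open>C\<^sub>0\<close>. If \<open>C\<close> has \<open>m\<close> pairs outside \<open>C\<^sub>0\<close>, it is determined, up to one of
  \<open>n * (m - 1)!\<close> visiting orders of the arcs of \<open>C\<^sub>0\<close> that it keeps, by the labels it uses at each
  vertex. These labels form a closed walk of a three-state transfer matrix, so that their
  generating function in \<open>m\<close> is \<open>\<lambda>\<^sup>n + \<mu>\<^sup>n + 1\<close> for the roots \<open>\<lambda>, \<mu>\<close> of a quadratic polynomial. The
  remaining weight, \<open>(m - 1)!\<close> times a ratio of double factorials, is a Beta integral, which turns the
  whole sum into a single integral over \<open>[0, 1]\<close>. Parametrised by \<open>\<lambda> = (d - 1) s\<close> all functions involved
  are rational, the exponent has its unique maximum at \<open>s = 1\<close>, and Laplace's method, uniformly in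
  \<open>d\<close>, gives the main term \<open>d / (d - 2)\<close> with an error \<open>O(1 / sqrt n)\<close>.\<close>

section \<open>Perfect matchings\<close>

text \<open>Only the second moment is bounded from above, so visiting orders and labellings may be
  overcounted harmlessly. What must be exact to leading order is the constant
  \<open>sqrt (2 * pi / n)\<close>: it arises from the Gaussian peak of the integral and from
  Stirling's formula in the first moment, and it has to cancel between the two. Cycles carry a root
  and a direction because permuting bins and the prevertices inside them acts transitively on such
  objects. Every Hamiltonian cycle is then counted the same number of times; this multiplicity
  cancels in \<open>f_n\<close> and is never computed. The obstacle is uniformity in
  \<open>d\<close>. As functions of the integration variable the roots \<lambda> and \<mu> contain a
  square root. But their quadratic equation is linear in the weight \<open>z\<close> of a new
  vertex, so solving it for \<open>z\<close> with \<lambda> as the parameter avoids roots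
  altogether. All estimates become polynomial inequalities in \<open>s\<close> and \<open>D\<close>
  that are equalities at \<open>s = 1\<close>. There they produce the curvature
  \<open>(D - 2) / D\<close> of the exponent and the prefactor \<open>sqrt (D / (D - 2))\<close>,
  and together these give \<open>D / (D - 2)\<close>.\<close>

definition perfect_matchings :: "'a set \<Rightarrow> 'a set set set" where
  "perfect_matchings X = {P. partition_on X P \<and> (\<forall>e\<in>P. card e = 2)}"

text \<open>The double factorial \<open>(2 k - 1)!!\<close>.\<close>

definition odd_fact :: "nat \<Rightarrow> nat" where
  "odd_fact k = (\<Prod>i<k. 2 * i + 1)"

lemma finite_perfect_matchings: "finite X \<Longrightarrow> finite (perfect_matchings X)"
  by (rule finite_subset[of _ "Pow (Pow X)"])
     (auto simp: perfect_matchings_def partition_on_def)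

lemma perfect_matchings_empty: "perfect_matchings {} = {{}}"
  by (auto simp: perfect_matchings_def partition_on_empty)

lemma perfect_matchings_disjointD:
  assumes "P \<in> perfect_matchings X" "e \<in> P" "f \<in> P" "x \<in> e" "x \<in> f"
  shows "e = f"
  using assms unfolding perfect_matchings_def partition_on_def disjoint_def by blast

lemma perfect_matchings_subset:
  assumes "P \<in> perfect_matchings X" "E \<subseteq> P"
  shows "E \<in> perfect_matchings (\<Union>E)"
proof -
  have "disjoint E" "{} \<notin> E" "\<forall>e\<in>E. card e = 2"
    using assms by (auto simp: perfect_matchings_def partition_on_def disjoint_def)
  then show ?thesis by (simp add: perfect_matchings_def partition_on_def)
qed

lemma card_Union_perfect_matching:
  assumes "E \<in> perfect_matchings Y" "finite Y"
  shows "card Y = 2 * card E"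
proof -
  have fin: "finite E" using assms unfolding perfect_matchings_def
    by (auto intro: finite_elements)
  have "card Y = card (\<Union>E)" using assms by (auto simp: perfect_matchings_def partition_on_def)
  also have "\<dots> = (\<Sum>e\<in>E. card e)"
  proof (rule card_Union_disjoint)
    show "pairwise disjnt E"
      using assms by (auto simp: perfect_matchings_def partition_on_def disjoint_def pairwise_def disjnt_def)
    fix e assume "e \<in> E"
    then have "card e = 2" using assms by (simp add: perfect_matchings_def)
    then show "finite e" by (simp add: card_ge_0_finite)
  qed
  also have "\<dots> = 2 * card E" using assms by (simp add: perfect_matchings_def)
  finally show ?thesis .
qed

text \<open>A matching of \<open>X - Y\<close> can be glued to \<open>E\<close> freely. Conversely,
  a pair of \<open>P\<close> outside \<open>E\<close> cannot meet \<open>Y\<close>: the common point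
  would lie in two different pairs of \<open>P\<close>.\<close>

lemma perfect_matchings_extending:
  assumes E: "E \<in> perfect_matchings Y" and Y: "Y \<subseteq> X"
  shows "bij_betw (\<lambda>P. P \<union> E) (perfect_matchings (X - Y)) {P \<in> perfect_matchings X. E \<subseteq> P}"
proof (rule bij_betw_byWitness[where f' = "\<lambda>P. P - E"])
  have UE: "\<Union>E = Y" and Ene: "{} \<notin> E" and E2: "\<forall>e\<in>E. card e = 2"
    using E by (auto simp: perfect_matchings_def partition_on_def)
  show "\<forall>P\<in>perfect_matchings (X - Y). (P \<union> E) - E = P"
  proof
    fix P assume P: "P \<in> perfect_matchings (X - Y)"
    have "P \<inter> E = {}"
    proof (rule ccontr)
      assume "P \<inter> E \<noteq> {}"
      then obtain e where e: "e \<in> P" "e \<in> E" by blast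
      then obtain x where "x \<in> e" using Ene by (metis ex_in_conv)
      with e P UE show False unfolding perfect_matchings_def partition_on_def by blast
    qed
    then show "(P \<union> E) - E = P" by blast
  qed
  show "\<forall>P\<in>{P \<in> perfect_matchings X. E \<subseteq> P}. (P - E) \<union> E = P" by blast
  show "(\<lambda>P. P \<union> E) ` perfect_matchings (X - Y) \<subseteq> {P \<in> perfect_matchings X. E \<subseteq> P}"
  proof safe
    fix P assume P: "P \<in> perfect_matchings (X - Y)"
    have UP: "\<Union>P = X - Y" using P by (auto simp: perfect_matchings_def partition_on_def)
    have "disjoint (P \<union> E)"
      using P E UP UE by (intro disjoint_union) (auto simp: perfect_matchings_def partition_on_def)
    moreover have "\<Union>(P \<union> E) = X" using UP UE Y by auto
    ultimately show "P \<union> E \<in> perfect_matchings X"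
      using P E by (auto simp: perfect_matchings_def partition_on_def)
  qed
  show "(\<lambda>P. P - E) ` {P \<in> perfect_matchings X. E \<subseteq> P} \<subseteq> perfect_matchings (X - Y)"
  proof safe
    fix P assume P: "P \<in> perfect_matchings X" "E \<subseteq> P"
    have UP: "\<Union>P = X" using P by (auto simp: perfect_matchings_def partition_on_def)
    have "\<Union>(P - E) = X - Y"
    proof (intro equalityI subsetI)
      fix x assume "x \<in> \<Union>(P - E)"
      then obtain e where e: "e \<in> P" "e \<notin> E" "x \<in> e" by blast
      have "x \<notin> Y"
      proof
        assume "x \<in> Y"
        then obtain f where "f \<in> E" "x \<in> f" using UE by blast
        then show False using e P perfect_matchings_disjointD[OF P(1), of e f x] by blast
      qed
      then show "x \<in> X - Y" using e UP by blast
    next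
      fix x assume "x \<in> X - Y"
      then show "x \<in> \<Union>(P - E)" using UP UE by blast
    qed
    then show "P - E \<in> perfect_matchings (X - Y)"
      using P unfolding perfect_matchings_def partition_on_def disjoint_def by auto
  qed
qed

text \<open>Induction on \<open>k\<close>, classifying the matchings by the partner of one fixed
  point.\<close>

lemma card_perfect_matchings:
  "finite X \<Longrightarrow> card X = 2 * k \<Longrightarrow> card (perfect_matchings X) = odd_fact k"
proof (induction k arbitrary: X)
  case 0
  then show ?case by (simp add: perfect_matchings_empty odd_fact_def)
next
  case (Suc k)
  then obtain x where x: "x \<in> X" by (metis card.empty ex_in_conv nat.distinct(1) mult_eq_0_iff zero_neq_numeral)
  define M where "M y = {P \<in> perfect_matchings X. {{x, y}} \<subseteq> P}" for y
  have cM: "card (M y) = odd_fact k" if y: "y \<in> X - {x}" for y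
  proof -
    have 1: "{{x, y}} \<in> perfect_matchings {x, y}"
      using y by (auto simp: perfect_matchings_def partition_on_def)
    have 2: "{x, y} \<subseteq> X" using x y by blast
    have "card (M y) = card (perfect_matchings (X - {x, y}))"
      unfolding M_def using bij_betw_same_card[OF perfect_matchings_extending[OF 1 2]] by simp
    also have "card (X - {x, y}) = 2 * k"
      using Suc.prems x y by (subst card_Diff_subset) auto
    then have "card (perfect_matchings (X - {x, y})) = odd_fact k"
      using Suc.prems by (intro Suc.IH) auto
    finally show ?thesis .
  qed
  have "perfect_matchings X = (\<Union>y\<in>X - {x}. M y)"
  proof (intro equalityI subsetI)
    fix P assume P: "P \<in> perfect_matchings X"
    then obtain e where e: "e \<in> P" "x \<in> e" using x by (auto simp: perfect_matchings_def partition_on_def)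
    have "card e = 2" using P e by (auto simp: perfect_matchings_def)
    then obtain y where y: "e = {x, y}" "y \<noteq> x" using e by (auto simp: card_2_iff)
    moreover have "y \<in> X" using P e y by (auto simp: perfect_matchings_def partition_on_def)
    ultimately show "P \<in> (\<Union>y\<in>X - {x}. M y)" using P e by (auto simp: M_def)
  qed (auto simp: M_def)
  moreover have "card (\<Union>y\<in>X - {x}. M y) = (\<Sum>y\<in>X - {x}. card (M y))"
  proof (rule card_UN_disjoint)
    show "\<forall>y\<in>X - {x}. finite (M y)" using Suc.prems by (auto simp: M_def finite_perfect_matchings)
    show "\<forall>y\<in>X - {x}. \<forall>y'\<in>X - {x}. y \<noteq> y' \<longrightarrow> M y \<inter> M y' = {}"
    proof (intro ballI impI)
      fix y y' assume yy: "y \<in> X - {x}" "y' \<in> X - {x}" "y \<noteq> y'"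
      show "M y \<inter> M y' = {}"
      proof (rule ccontr)
        assume "M y \<inter> M y' \<noteq> {}"
        then obtain P where P: "P \<in> perfect_matchings X" "{x, y} \<in> P" "{x, y'} \<in> P"
          by (auto simp: M_def)
        then have "{x, y} = {x, y'}" using perfect_matchings_disjointD[OF P(1), of _ _ x] by blast
        then show False using yy by (auto simp: doubleton_eq_iff)
      qed
    qed
  qed (use Suc.prems in auto)
  ultimately have "card (perfect_matchings X) = (\<Sum>y\<in>X - {x}. odd_fact k)"
    using cM by simp
  also have "\<dots> = (2 * k + 1) * odd_fact k" using Suc.prems x by simp
  finally show ?case by (simp add: odd_fact_def)
qed

text \<open>\<open>P\<close> serves as a witness that \<open>E\<close> consists of disjoint pairs
  inside \<open>X\<close>, so that \<open>E\<close> occupies exactly \<open>2 * card E\<close>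
  points.\<close>

lemma card_perfect_matchings_extending:
  assumes X: "finite X" "card X = 2 * k" and E: "P \<in> perfect_matchings X" "E \<subseteq> P"
  shows "card {P \<in> perfect_matchings X. E \<subseteq> P} = odd_fact (k - card E)" and "card E \<le> k"
proof -
  have Y: "\<Union>E \<subseteq> X" using E by (auto simp: perfect_matchings_def partition_on_def)
  have fY: "finite (\<Union>E)" using Y X finite_subset by blast
  have E': "E \<in> perfect_matchings (\<Union>E)" using E by (rule perfect_matchings_subset)
  have c: "card (\<Union>E) = 2 * card E" by (rule card_Union_perfect_matching[OF E' fY])
  have "card (\<Union>E) \<le> card X" using Y X by (intro card_mono)
  then show "card E \<le> k" using c X by simp
  have "card (X - \<Union>E) = 2 * (k - card E)" using Y X fY c by (simp add: card_Diff_subset)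
  then show "card {P \<in> perfect_matchings X. E \<subseteq> P} = odd_fact (k - card E)"
    using bij_betw_same_card[OF perfect_matchings_extending[OF E' Y]] X
    by (simp add: card_perfect_matchings)
qed

lemma pairings_eq: "pairings n d = perfect_matchings (prevertices n d)"
  by (simp add: pairings_def perfect_matchings_def)

section \<open>Rooted cycles\<close>

text \<open>A rooted cycle \<open>(v, l)\<close> visits the vertices in the order \<open>v 0, v 1, \<dots>\<close>, enters vertex \<open>i\<close> through its
  prevertex \<open>(i, fst (l i))\<close> and leaves it through \<open>(i, snd (l i))\<close>.\<close>

definition labels :: "nat \<Rightarrow> (nat \<times> nat) set" where
  "labels d = {(a, b). a < d \<and> b < d \<and> a \<noteq> b}"

definition rooted_cycles :: "nat \<Rightarrow> nat \<Rightarrow> ((nat \<Rightarrow> nat) \<times> (nat \<Rightarrow> nat \<times> nat)) set" where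
  "rooted_cycles n d = {v. v permutes {..<n}} \<times> ({..<n} \<rightarrow>\<^sub>E labels d)"

definition step :: "nat \<Rightarrow> (nat \<Rightarrow> nat) \<Rightarrow> (nat \<Rightarrow> nat \<times> nat) \<Rightarrow> nat \<Rightarrow> (nat \<times> nat) set" where
  "step n v l k = {(v k, snd (l (v k))), (v (Suc k mod n), fst (l (v (Suc k mod n))))}"

definition cycle_pairs :: "nat \<Rightarrow> (nat \<Rightarrow> nat) \<times> (nat \<Rightarrow> nat \<times> nat) \<Rightarrow> (nat \<times> nat) set set" where
  "cycle_pairs n = (\<lambda>(v, l). step n v l ` {..<n})"

definition base_cycle :: "nat \<Rightarrow> (nat \<Rightarrow> nat) \<times> (nat \<Rightarrow> nat \<times> nat)" where
  "base_cycle n = (id, \<lambda>i\<in>{..<n}. (0, 1))"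

text \<open>For a cycle compatible with the base cycle, labels 0 and 1 are used exactly by the common pairs, so
  these are the vertices entered through a pair outside the base cycle.\<close>

definition new_vertices :: "nat \<Rightarrow> (nat \<Rightarrow> nat \<times> nat) \<Rightarrow> nat set" where
  "new_vertices n l = {i. i < n \<and> 2 \<le> fst (l i)}"

lemma Suc_mod_inj:
  assumes "i < n" "j < n" "Suc i mod n = Suc j mod n"
  shows "i = j"
  using assms by (auto simp: mod_Suc split: if_splits)

lemma inj_on_step:
  assumes v: "v permutes {..<n}" and l: "l \<in> {..<n} \<rightarrow>\<^sub>E labels d"
  shows "inj_on (step n v l) {..<n}"
proof (rule inj_onI)
  fix k j assume kj: "k \<in> {..<n}" "j \<in> {..<n}" and eq: "step n v l k = step n v l j"
  have inj: "v x = v y \<longleftrightarrow> x = y" for x y using permutes_inj[OF v] by (auto dest: injD)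
  have "(v k, snd (l (v k))) \<in> step n v l j" using eq by (auto simp: step_def)
  moreover have "v k < n" using permutes_in_image[OF v] kj by simp
  then have "l (v k) \<in> labels d" using l by (auto simp: PiE_def Pi_def)
  ultimately show "k = j" by (auto simp: step_def inj labels_def)
qed

lemma card_cycle_pairs:
  assumes "\<tau> \<in> rooted_cycles n d"
  shows "card (cycle_pairs n \<tau>) = n"
proof -
  obtain v l where \<tau>: "\<tau> = (v, l)" by (cases \<tau>)
  then have "inj_on (step n v l) {..<n}"
    using assms by (intro inj_on_step) (auto simp: rooted_cycles_def)
  then show ?thesis by (simp add: \<tau> cycle_pairs_def card_image)
qed

lemma base_cycle_in: "2 \<le> d \<Longrightarrow> base_cycle n \<in> rooted_cycles n d"
  by (auto simp: base_cycle_def rooted_cycles_def labels_def permutes_id)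

lemma cycle_pairs_base: "cycle_pairs n (base_cycle n) = (\<lambda>i. {(i, 1), (Suc i mod n, 0)}) ` {..<n}"
  by (auto simp: cycle_pairs_def base_cycle_def step_def image_iff)

section \<open>Cycles that can share a pairing with the base cycle\<close>

locale compatible_cycle =
  fixes n d v l
  assumes n2: "2 \<le> n" and d2: "2 \<le> d"
    and v: "v permutes {..<n}" and l: "l \<in> {..<n} \<rightarrow>\<^sub>E labels d"
    and disj: "disjoint (cycle_pairs n (base_cycle n) \<union> cycle_pairs n (v, l))"
begin

lemma v_eq [simp]: "v x = v y \<longleftrightarrow> x = y"
  using permutes_inj[OF v] by (auto dest: injD)

lemma v_less [simp]: "v k < n \<longleftrightarrow> k < n"
  using permutes_in_image[OF v, of k] by simp

lemma mod_n_less [simp]: "x mod n < n"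
  using n2 by simp

lemma v_surj: "i < n \<Longrightarrow> \<exists>k<n. v k = i"
  using permutes_image[OF v] by (metis imageE lessThan_iff)

lemma pred_ex: "i < n \<Longrightarrow> \<exists>k<n. Suc k mod n = i"
proof (cases i)
  case 0
  then show ?thesis using n2 by (intro exI[of _ "n - 1"]) simp
next
  case (Suc j)
  then show "i < n \<Longrightarrow> ?thesis" by (intro exI[of _ j]) simp
qed

text \<open>The base cycle occupies the labels 0 and 1 of every vertex. A pair of the second cycle
  touching one of them therefore meets a base pair, and by \<open>disj\<close> the two coincide. All
  rules below about entering and leaving through 0 and 1 come from this.\<close>

lemma same_edge:
  assumes "k < n" "i < n" "x \<in> step n v l k" "x = (i, 1) \<or> x = (Suc i mod n, 0)"
  shows "step n v l k = {(i, 1), (Suc i mod n, 0)}"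
proof -
  have 1: "step n v l k \<in> cycle_pairs n (v, l)" using assms by (auto simp: cycle_pairs_def)
  have 2: "{(i, 1), (Suc i mod n, 0)} \<in> cycle_pairs n (base_cycle n)"
    using assms by (auto simp: cycle_pairs_base)
  have "step n v l k \<inter> {(i, 1), (Suc i mod n, 0)} \<noteq> {}" using assms by blast
  with 1 2 disj show ?thesis by (auto dest: disjointD)
qed

lemma Suc_mod_ne: "i < n \<Longrightarrow> Suc i mod n \<noteq> i"
  using n2 by (auto simp: mod_Suc)

lemma out_1:
  assumes k: "k < n" and "snd (l (v k)) = 1"
  shows "v (Suc k mod n) = Suc (v k) mod n" "fst (l (v (Suc k mod n))) = 0"
proof -
  have "step n v l k = {(v k, 1), (Suc (v k) mod n, 0)}"
    using assms by (intro same_edge[of _ _ "(v k, 1)"]) (auto simp: step_def)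
  then show "v (Suc k mod n) = Suc (v k) mod n" "fst (l (v (Suc k mod n))) = 0"
    using Suc_mod_ne[of k] k assms by (auto simp: step_def doubleton_eq_iff)
qed

lemma in_1:
  assumes k: "k < n" and "fst (l (v (Suc k mod n))) = 1"
  shows "v k = Suc (v (Suc k mod n)) mod n" "snd (l (v k)) = 0"
proof -
  have "step n v l k = {(v (Suc k mod n), 1), (Suc (v (Suc k mod n)) mod n, 0)}"
    using assms by (intro same_edge[of _ _ "(v (Suc k mod n), 1)"]) (auto simp: step_def)
  then show "v k = Suc (v (Suc k mod n)) mod n" "snd (l (v k)) = 0"
    using Suc_mod_ne[of k] k assms by (auto simp: step_def doubleton_eq_iff)
qed

lemma out_0:
  assumes k: "k < n" and s: "snd (l (v k)) = 0"
  shows "fst (l (v (Suc k mod n))) = 1"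
proof -
  obtain i where i: "i < n" "Suc i mod n = v k" using pred_ex[of "v k"] k by auto
  have "step n v l k = {(i, 1), (Suc i mod n, 0)}"
    using assms i by (intro same_edge[of _ _ "(v k, 0)"]) (auto simp: step_def)
  then show ?thesis
    using Suc_mod_ne[of k] k i s by (auto simp: step_def doubleton_eq_iff)
qed

lemma in_0:
  assumes k: "k < n" and s: "fst (l (v (Suc k mod n))) = 0"
  shows "snd (l (v k)) = 1"
proof -
  obtain i where i: "i < n" "Suc i mod n = v (Suc k mod n)" using pred_ex[of "v (Suc k mod n)"] k by auto
  have "step n v l k = {(i, 1), (Suc i mod n, 0)}"
    using assms i by (intro same_edge[of _ _ "(v (Suc k mod n), 0)"]) (auto simp: step_def)
  then show ?thesis
    using Suc_mod_ne[of k] k i s by (auto simp: step_def doubleton_eq_iff)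
qed

lemma new_iff:
  assumes "k < n"
  shows "2 \<le> fst (l (v (Suc k mod n))) \<longleftrightarrow> 2 \<le> snd (l (v k))"
proof -
  have "fst (l (v (Suc k mod n))) = 0 \<longleftrightarrow> snd (l (v k)) = 1" using out_1[OF assms] in_0[OF assms] by blast
  moreover have "fst (l (v (Suc k mod n))) = 1 \<longleftrightarrow> snd (l (v k)) = 0" using in_1[OF assms] out_0[OF assms] by blast
  ultimately show ?thesis by linarith
qed

text \<open>Both sides say that the base pair from \<open>i\<close> to its successor is traversed
  forwards. The statement speaks of neighbours on the base cycle and no longer of \<open>v\<close>,
  which makes the constraint on labels local and opens the way to a transfer matrix. The lemma
  \<open>snd_0_iff\<close> is the backward counterpart.\<close>

lemma fst_0_iff:
  assumes "i < n"
  shows "fst (l (Suc i mod n)) = 0 \<longleftrightarrow> snd (l i) = 1"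
proof
  assume "snd (l i) = 1"
  then show "fst (l (Suc i mod n)) = 0" using v_surj[OF assms] out_1 by metis
next
  assume a: "fst (l (Suc i mod n)) = 0"
  obtain j where j: "j < n" "v j = Suc i mod n" using v_surj[of "Suc i mod n"] by auto
  obtain k where k: "k < n" "Suc k mod n = j" using pred_ex[OF j(1)] by auto
  have "snd (l (v k)) = 1" using in_0[OF k(1)] a j k by auto
  moreover then have "Suc (v k) mod n = Suc i mod n" using out_1[OF k(1)] j k by auto
  then have "v k = i" using Suc_mod_inj[of "v k" n i] k assms by auto
  ultimately show "snd (l i) = 1" by simp
qed

lemma snd_0_iff:
  assumes "i < n"
  shows "snd (l (Suc i mod n)) = 0 \<longleftrightarrow> fst (l i) = 1"
proof
  assume a: "fst (l i) = 1"
  obtain j where j: "j < n" "v j = i" using v_surj[OF assms] by auto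
  obtain k where k: "k < n" "Suc k mod n = j" using pred_ex[OF j(1)] by auto
  show "snd (l (Suc i mod n)) = 0" using in_1[OF k(1)] a j k by auto
next
  assume a: "snd (l (Suc i mod n)) = 0"
  obtain j where j: "j < n" "v j = Suc i mod n" using v_surj[of "Suc i mod n"] by auto
  have f: "fst (l (v (Suc j mod n))) = 1" using out_0[OF j(1)] a j by auto
  then have "Suc (v (Suc j mod n)) mod n = Suc i mod n" using in_1[OF j(1)] j by auto
  then have "v (Suc j mod n) = i" using Suc_mod_inj[of "v (Suc j mod n)" n i] j assms by auto
  then show "fst (l i) = 1" using f by simp
qed

text \<open>A pair outside the base cycle leaves one vertex and enters the next one in visiting
  order, so departures through labels from 2 on are as many as such entries.\<close>

lemma card_new:
  "card {k. k < n \<and> 2 \<le> snd (l (v k))} = card (new_vertices n l)"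
proof (rule bij_betw_same_card[of "\<lambda>k. v (Suc k mod n)"])
  show "bij_betw (\<lambda>k. v (Suc k mod n)) {k. k < n \<and> 2 \<le> snd (l (v k))} (new_vertices n l)"
  proof (rule bij_betw_imageI)
    show "inj_on (\<lambda>k. v (Suc k mod n)) {k. k < n \<and> 2 \<le> snd (l (v k))}"
      by (auto intro!: inj_onI dest: Suc_mod_inj)
    show "(\<lambda>k. v (Suc k mod n)) ` {k. k < n \<and> 2 \<le> snd (l (v k))} = new_vertices n l"
    proof (intro equalityI subsetI)
      fix i assume i: "i \<in> new_vertices n l"
      then obtain j where j: "j < n" "v j = i" using v_surj by (auto simp: new_vertices_def)
      obtain k where k: "k < n" "Suc k mod n = j" using pred_ex[OF j(1)] by auto
      show "i \<in> (\<lambda>k. v (Suc k mod n)) ` {k. k < n \<and> 2 \<le> snd (l (v k))}"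
        using i j k new_iff[OF k(1)] by (auto simp: new_vertices_def intro!: rev_image_eqI[of k])
    qed (auto simp: new_vertices_def new_iff)
  qed
qed

lemma old_step:
  assumes "k < n" "\<not> 2 \<le> snd (l (v k))"
  shows "step n v l k \<in> cycle_pairs n (base_cycle n)"
proof -
  have "snd (l (v k)) = 0 \<or> snd (l (v k)) = 1" using assms by auto
  then show ?thesis
  proof
    assume s: "snd (l (v k)) = 0"
    define i where "i = v (Suc k mod n)"
    have f: "fst (l i) = 1" unfolding i_def using assms(1) s by (rule out_0)
    have vk: "v k = Suc i mod n" unfolding i_def by (rule in_1(1)[OF assms(1) f[unfolded i_def]])
    have "step n v l k = {(v k, 0), (i, 1)}" by (simp only: step_def s f i_def[symmetric])
    also have "\<dots> = {(i, 1), (Suc i mod n, 0)}" by (simp only: vk insert_commute)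
    finally show ?thesis by (simp add: cycle_pairs_base i_def)
  next
    assume s: "snd (l (v k)) = 1"
    have "step n v l k = {(v k, 1), (Suc (v k) mod n, 0)}"
      using out_1[OF assms(1) s] by (simp add: step_def s)
    then show ?thesis using assms by (simp add: cycle_pairs_base)
  qed
qed

lemma card_union:
  "card (cycle_pairs n (base_cycle n) \<union> cycle_pairs n (v, l)) = n + card (new_vertices n l)"
proof -
  let ?B = "cycle_pairs n (base_cycle n)" and ?N = "{k. k < n \<and> 2 \<le> snd (l (v k))}"
  have S: "cycle_pairs n (v, l) = step n v l ` {..<n}" by (simp add: cycle_pairs_def)
  have "step n v l k \<in> ?B \<union> step n v l ` ?N" if "k < n" for k
    using old_step[OF that] that by blast
  then have "?B \<union> cycle_pairs n (v, l) = ?B \<union> step n v l ` ?N"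
    unfolding S by blast
  \<comment> \<open>Base pairs only use the labels 0 and 1, whereas a pair indexed by
    \<open>?N\<close> has an end with label at least 2.\<close>
  moreover have "?B \<inter> step n v l ` ?N = {}"
  proof -
    have "step n v l k \<notin> ?B" if "k \<in> ?N" for k
    proof
      assume "step n v l k \<in> ?B"
      then have "(v k, snd (l (v k))) \<in> (\<Union>?B)" by (auto simp: step_def)
      then show False using that by (auto simp: cycle_pairs_base)
    qed
    then show ?thesis by blast
  qed
  moreover have "card (step n v l ` ?N) = card (new_vertices n l)"
    using inj_on_step[OF v l] by (subst card_image) (auto simp: card_new intro: inj_on_subset)
  moreover have "card ?B = n" using base_cycle_in[OF d2] by (rule card_cycle_pairs)
  moreover have "finite ?B" by (auto simp: cycle_pairs_base)
  moreover have "finite (step n v l ` ?N)" by auto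
  ultimately show ?thesis by (simp add: card_Un_disjoint)
qed

end

section \<open>Symmetry\<close>

lemma finite_labels: "finite (labels d)"
  by (rule finite_subset[of _ "{..<d} \<times> {..<d}"]) (auto simp: labels_def)

lemma card_labels: "card (labels d) = d * (d - 1)"
proof -
  have "labels d = {..<d} \<times> {..<d} - (\<lambda>a. (a, a)) ` {..<d}" by (auto simp: labels_def)
  moreover have "card ((\<lambda>a. (a, a)) ` {..<d}) = d" by (subst card_image) (auto intro: inj_onI)
  ultimately show ?thesis by (simp add: card_Diff_subset algebra_simps image_subset_iff)
qed

lemma finite_rooted_cycles: "finite (rooted_cycles n d)"
  by (auto simp: rooted_cycles_def finite_permutations finite_labels intro!: finite_PiE)

lemma card_rooted_cycles: "card (rooted_cycles n d) = fact n * (d * (d - 1)) ^ n"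
  by (simp add: rooted_cycles_def card_cartesian_product card_permutations card_PiE card_labels)

text \<open>The action of the wreath product: \<open>q i\<close> permutes the prevertices of bin
  \<open>i\<close>, after which \<open>p\<close> moves the bin. The label at the new vertex
  \<open>i\<close> thus comes from bin \<open>inv p i\<close>.\<close>

definition relabel :: "nat \<Rightarrow> (nat \<Rightarrow> nat) \<Rightarrow> (nat \<Rightarrow> nat \<Rightarrow> nat) \<Rightarrow>
    (nat \<Rightarrow> nat) \<times> (nat \<Rightarrow> nat \<times> nat) \<Rightarrow> (nat \<Rightarrow> nat) \<times> (nat \<Rightarrow> nat \<times> nat)" where
  "relabel n p q = (\<lambda>(v, l). (p \<circ> v, \<lambda>i\<in>{..<n}. map_prod (q (inv p i)) (q (inv p i)) (l (inv p i))))"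

lemma relabel_in:
  assumes p: "p permutes {..<n}" and q: "\<And>i. q i permutes {..<d}" and \<tau>: "\<tau> \<in> rooted_cycles n d"
  shows "relabel n p q \<tau> \<in> rooted_cycles n d"
proof -
  obtain v l where vl: "\<tau> = (v, l)" by (cases \<tau>)
  have v: "v permutes {..<n}" and l: "l \<in> {..<n} \<rightarrow>\<^sub>E labels d" using \<tau> by (auto simp: vl rooted_cycles_def)
  have "map_prod (q (inv p i)) (q (inv p i)) (l (inv p i)) \<in> labels d" if "i < n" for i
  proof -
    have "inv p i < n" using permutes_in_image[OF permutes_inv[OF p]] that by auto
    then have 1: "l (inv p i) \<in> labels d" using l by auto
    obtain a b where ab: "l (inv p i) = (a, b)" by (cases "l (inv p i)")
    have "a < d" "b < d" "a \<noteq> b" using 1 by (auto simp: ab labels_def)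
    then show ?thesis
      using permutes_in_image[OF q[of "inv p i"]] permutes_inj[OF q[of "inv p i"]]
      by (auto simp: ab labels_def dest: injD)
  qed
  then show ?thesis
    using permutes_compose[OF v p] by (auto simp: relabel_def vl rooted_cycles_def)
qed

lemma inj_on_relabel:
  assumes p: "p permutes {..<n}" and q: "\<And>i. q i permutes {..<d}"
  shows "inj_on (relabel n p q) (rooted_cycles n d)"
proof (rule inj_onI)
  fix \<sigma> \<tau> assume \<sigma>: "\<sigma> \<in> rooted_cycles n d" and \<tau>: "\<tau> \<in> rooted_cycles n d"
    and eq: "relabel n p q \<sigma> = relabel n p q \<tau>"
  obtain v l w m where vl: "\<sigma> = (v, l)" "\<tau> = (w, m)" by (cases \<sigma>, cases \<tau>)
  have l: "l \<in> {..<n} \<rightarrow>\<^sub>E labels d" "m \<in> {..<n} \<rightarrow>\<^sub>E labels d"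
    using \<sigma> \<tau> by (auto simp: vl rooted_cycles_def)
  have "p \<circ> v = p \<circ> w" using eq by (simp add: relabel_def vl)
  then have "v = w" using permutes_inj[OF p] by (simp add: fun_eq_iff inj_eq)
  moreover have "l i = m i" if "i < n" for i
  proof -
    have pi: "p i < n" using permutes_in_image[OF p] that by auto
    have ii: "inv p (p i) = i" using permutes_inverses(2)[OF p] .
    have "snd (relabel n p q \<sigma>) (p i) = snd (relabel n p q \<tau>) (p i)" using eq by simp
    then have "map_prod (q i) (q i) (l i) = map_prod (q i) (q i) (m i)"
      using pi by (simp add: relabel_def vl ii)
    then show ?thesis using permutes_inj[OF q[of i]]
      by (cases "l i", cases "m i") (auto dest: injD)
  qed
  then have "l = m" using l by (intro PiE_ext) auto
  ultimately show "\<sigma> = \<tau>" by (simp add: vl)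
qed

lemma bij_betw_relabel:
  assumes "p permutes {..<n}" "\<And>i. q i permutes {..<d}"
  shows "bij_betw (relabel n p q) (rooted_cycles n d) (rooted_cycles n d)"
proof -
  have inj: "inj_on (relabel n p q) (rooted_cycles n d)"
    by (rule inj_on_relabel) (fact assms)+
  have "relabel n p q ` rooted_cycles n d \<subseteq> rooted_cycles n d"
    by (rule image_subsetI, rule relabel_in) (simp_all add: assms)
  then have "relabel n p q ` rooted_cycles n d = rooted_cycles n d"
    by (rule endo_inj_surj[OF finite_rooted_cycles _ inj])
  then show ?thesis by (rule bij_betw_imageI[OF inj])
qed

lemma cycle_pairs_relabel:
  assumes p: "p permutes {..<n}" and \<tau>: "\<tau> \<in> rooted_cycles n d"
  shows "cycle_pairs n (relabel n p q \<tau>) = image (\<lambda>(i, j). (p i, q i j)) ` cycle_pairs n \<tau>"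
proof -
  obtain v l where vl: "\<tau> = (v, l)" by (cases \<tau>)
  have v: "v permutes {..<n}" using \<tau> by (auto simp: vl rooted_cycles_def)
  have ii: "inv p (p i) = i" for i using permutes_inverses(2)[OF p] .
  have less: "p (v k) < n" if "k < n" for k
    using permutes_in_image[OF p] permutes_in_image[OF v] that by auto
  obtain w m where wm: "relabel n p q \<tau> = (w, m)" by (cases "relabel n p q \<tau>")
  have w: "w k = p (v k)" for k using wm by (auto simp: relabel_def vl)
  have m: "m (p (v k)) = map_prod (q (v k)) (q (v k)) (l (v k))" if "k < n" for k
    using wm less[OF that] by (auto simp: relabel_def vl ii)
  have "step n w m k = (\<lambda>(i, j). (p i, q i j)) ` step n v l k" if "k < n" for k
  proof -
    have "Suc k mod n < n" using that by simp
    then show ?thesis using that by (simp add: step_def w m)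
  qed
  then show ?thesis unfolding wm unfolding vl cycle_pairs_def by (simp add: image_image)
qed

lemma permutes_two_points:
  fixes a b a' b' :: "'a"
  assumes "a \<noteq> b" "a' \<noteq> b'" "{a, b, a', b'} \<subseteq> S"
  shows "\<exists>\<theta>. \<theta> permutes S \<and> \<theta> a = a' \<and> \<theta> b = b'"
proof -
  define x where "x = Transposition.transpose a a' b"
  have "x \<in> S" "x \<noteq> a'" using assms by (auto simp: x_def Transposition.transpose_def)
  then have "Transposition.transpose x b' \<circ> Transposition.transpose a a' permutes S"
    using assms by (intro permutes_compose permutes_swap_id) auto
  moreover have "(Transposition.transpose x b' \<circ> Transposition.transpose a a') a = a'" "(Transposition.transpose x b' \<circ> Transposition.transpose a a') b = b'"
    using \<open>x \<noteq> a'\<close> assms by (auto simp: x_def[symmetric])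
  ultimately show ?thesis by blast
qed

text \<open>The permutation \<open>w \<circ> inv v\<close> carries one visiting order to the other,
  and inside a bin any ordered pair of distinct labels can be moved to any other. Transitivity needs
  the root and the direction: they turn the two labels at a vertex into an ordered pair.\<close>

lemma relabel_transitive:
  assumes \<sigma>: "\<sigma> \<in> rooted_cycles n d" and \<tau>: "\<tau> \<in> rooted_cycles n d"
  shows "\<exists>p q. p permutes {..<n} \<and> (\<forall>i. q i permutes {..<d}) \<and> relabel n p q \<sigma> = \<tau>"
proof -
  obtain v l w m where vl: "\<sigma> = (v, l)" "\<tau> = (w, m)" by (cases \<sigma>, cases \<tau>)
  have v: "v permutes {..<n}" and w: "w permutes {..<n}"
    and l: "l \<in> {..<n} \<rightarrow>\<^sub>E labels d" and m: "m \<in> {..<n} \<rightarrow>\<^sub>E labels d"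
    using \<sigma> \<tau> by (auto simp: vl rooted_cycles_def)
  define p where "p = w \<circ> inv v"
  have p: "p permutes {..<n}" unfolding p_def by (intro permutes_compose permutes_inv v w)
  have "\<exists>\<theta>. \<theta> permutes {..<d} \<and> (i < n \<longrightarrow> map_prod \<theta> \<theta> (l i) = m (p i))" for i
  proof (cases "i < n")
    case True
    then have "p i < n" using permutes_in_image[OF p] by auto
    then have 1: "m (p i) \<in> labels d" "l i \<in> labels d" using l m True by auto
    obtain a b a' b' where ab: "l i = (a, b)" "m (p i) = (a', b')" by (cases "l i", cases "m (p i)")
    have "\<exists>\<theta>. \<theta> permutes {..<d} \<and> \<theta> a = a' \<and> \<theta> b = b'"
      using 1 by (intro permutes_two_points) (auto simp: ab labels_def)
    then show ?thesis by (auto simp: ab)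
  next
    case False
    then show ?thesis using permutes_id by blast
  qed
  then obtain q where q: "\<And>i. q i permutes {..<d}"
      "\<And>i. i < n \<Longrightarrow> map_prod (q i) (q i) (l i) = m (p i)" by metis
  have "p \<circ> v = w" using permutes_inv_o(2)[OF v] by (simp add: p_def o_assoc[symmetric])
  moreover have "(\<lambda>i\<in>{..<n}. map_prod (q (inv p i)) (q (inv p i)) (l (inv p i))) = m"
  proof (rule extensionalityI)
    show "m \<in> extensional {..<n}" using m by (auto simp: PiE_def)
    fix i assume "i \<in> {..<n}"
    then have "inv p i < n" using permutes_in_image[OF permutes_inv[OF p]] by auto
    then have "map_prod (q (inv p i)) (q (inv p i)) (l (inv p i)) = m (p (inv p i))" by (rule q(2))
    then show "(\<lambda>i\<in>{..<n}. map_prod (q (inv p i)) (q (inv p i)) (l (inv p i))) i = m i"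
      using \<open>i \<in> {..<n}\<close> permutes_inverses(1)[OF p] by simp
  qed simp
  ultimately have "relabel n p q \<sigma> = \<tau>" by (simp add: relabel_def vl)
  then show ?thesis using p q(1) by blast
qed

lemma bij_betw_perfect_matchings:
  assumes g: "bij_betw g X X"
  shows "bij_betw (image (image g)) (perfect_matchings X) (perfect_matchings X)"
proof (rule bij_betw_byWitness[where f' = "image (image (inv_into X g))"])
  have inj: "inj_on g X" and im: "g ` X = X" using g by (auto simp: bij_betw_def)
  have g': "bij_betw (inv_into X g) X X" using g by (rule bij_betw_inv_into)
  have inj': "inj_on (inv_into X g) X" and im': "inv_into X g ` X = X" using g' by (auto simp: bij_betw_def)
  have sub: "e \<subseteq> X" if "P \<in> perfect_matchings X" "e \<in> P" for P e
    using that by (auto simp: perfect_matchings_def partition_on_def)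
  have *: "image (image h) P \<in> perfect_matchings X"
    if h: "inj_on h X" "h ` X = X" and P: "P \<in> perfect_matchings X" for h P
  proof -
    have "partition_on X (image (image h) P)"
      unfolding partition_on_def disjoint_def
    proof (intro conjI ballI impI)
      show "\<Union>(image (image h) P) = X" using h P
        by (metis (mono_tags, lifting) image_Union perfect_matchings_def mem_Collect_eq partition_on_def)
      show "{} \<notin> image (image h) P"
        using P by (auto simp: perfect_matchings_def partition_on_def)
      fix e f assume ef: "e \<in> image (image h) P" "f \<in> image (image h) P" "e \<noteq> f"
      then obtain e' f' where e': "e = h ` e'" "f = h ` f'" "e' \<in> P" "f' \<in> P" by blast
      then have "e' \<inter> f' = {}" using ef perfect_matchings_disjointD[OF P, of e' f'] by blast
      then show "e \<inter> f = {}"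
        using inj_on_image_Int[OF h(1) sub[OF P e'(3)] sub[OF P e'(4)]] e' by auto
    qed
    moreover have "card (h ` e) = 2" if "e \<in> P" for e
    proof -
      have "card (h ` e) = card e" by (rule card_image[OF inj_on_subset[OF h(1) sub[OF P that]]])
      then show ?thesis using P that by (simp add: perfect_matchings_def)
    qed
    ultimately show ?thesis by (auto simp: perfect_matchings_def)
  qed
  show "image (image g) ` perfect_matchings X \<subseteq> perfect_matchings X" using *[OF inj im] by blast
  show "image (image (inv_into X g)) ` perfect_matchings X \<subseteq> perfect_matchings X" using *[OF inj' im'] by blast
  have 1: "inv_into X g ` g ` e = e" if "e \<subseteq> X" for e using inv_into_image_cancel[OF inj that] .
  have 2: "g ` inv_into X g ` e = e" if "e \<subseteq> X" for e using image_inv_into_cancel[OF im that] .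
  show "\<forall>P\<in>perfect_matchings X. image (image (inv_into X g)) (image (image g) P) = P"
  proof
    fix P assume P: "P \<in> perfect_matchings X"
    have "(\<lambda>e. inv_into X g ` g ` e) ` P = (\<lambda>e. e) ` P" using 1 sub[OF P] by (intro image_cong) auto
    then show "image (image (inv_into X g)) (image (image g) P) = P" by (simp add: image_image)
  qed
  show "\<forall>P\<in>perfect_matchings X. image (image g) (image (image (inv_into X g)) P) = P"
  proof
    fix P assume P: "P \<in> perfect_matchings X"
    have "(\<lambda>e. g ` inv_into X g ` e) ` P = (\<lambda>e. e) ` P" using 2 sub[OF P] by (intro image_cong) auto
    then show "image (image g) (image (image (inv_into X g)) P) = P" by (simp add: image_image)
  qed
qed

section \<open>Visiting orders for given labels\<close>

definition compatible_orders :: "nat \<Rightarrow> (nat \<Rightarrow> nat \<times> nat) \<Rightarrow> (nat \<Rightarrow> nat) set" where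
  "compatible_orders n l = {v. v permutes {..<n} \<and>
     disjoint (cycle_pairs n (base_cycle n) \<union> cycle_pairs n (v, l))}"

definition rotation :: "nat \<Rightarrow> nat \<Rightarrow> nat" where
  "rotation n k = (if k < n then Suc k mod n else k)"

lemma rotation_permutes: "rotation n permutes {..<n}"
proof (rule bij_imp_permutes)
  have "inj_on (rotation n) {..<n}"
    by (auto intro!: inj_onI simp: rotation_def dest: Suc_mod_inj)
  moreover have "rotation n ` {..<n} \<subseteq> {..<n}" by (auto simp: rotation_def)
  ultimately show "bij_betw (rotation n) {..<n} {..<n}"
    by (auto simp: bij_betw_def endo_inj_surj)
qed (auto simp: rotation_def)

lemma rotation_funpow_permutes: "(rotation n ^^ j) permutes {..<n}"
proof (induction j)
  case 0
  then show ?case by (simp only: funpow.simps permutes_id)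
next
  case (Suc j)
  then show ?case using permutes_compose[OF Suc rotation_permutes] by (simp only: funpow.simps)
qed

lemma rotation_funpow_0: "k < n \<Longrightarrow> (rotation n ^^ k) 0 = k"
  by (induction k) (auto simp: rotation_def)

lemma compatible_orders_rotation:
  assumes "v \<in> compatible_orders n l"
  shows "v \<circ> rotation n \<in> compatible_orders n l"
proof -
  have "step n (v \<circ> rotation n) l k = step n v l (rotation n k)" if "k < n" for k
    using that by (auto simp: step_def rotation_def)
  then have "step n (v \<circ> rotation n) l ` {..<n} = step n v l ` (rotation n ` {..<n})"
    by (auto simp: image_image)
  also have "rotation n ` {..<n} = {..<n}" by (rule permutes_image[OF rotation_permutes])
  finally have "cycle_pairs n (v \<circ> rotation n, l) = cycle_pairs n (v, l)"
    by (simp only: cycle_pairs_def prod.case)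
  then show ?thesis
    using assms permutes_compose[OF rotation_permutes] by (simp add: compatible_orders_def)
qed

lemma compatible_orders_rotation_funpow:
  "v \<in> compatible_orders n l \<Longrightarrow> v \<circ> (rotation n ^^ j) \<in> compatible_orders n l"
proof (induction j)
  case (Suc j)
  then have "(v \<circ> (rotation n ^^ j)) \<circ> rotation n \<in> compatible_orders n l"
    by (intro compatible_orders_rotation)
  then show ?case by (simp only: funpow_Suc_right o_assoc)
qed simp

lemma finite_compatible_orders: "finite (compatible_orders n l)"
  by (rule finite_subset[OF _ finite_permutations[of "{..<n}"]]) (auto simp: compatible_orders_def)

lemma finite_new_vertices: "finite (new_vertices n l)"
  by (auto simp: new_vertices_def)

text \<open>A new vertex starts an arc of consecutive common pairs, possibly an arc without pairs.
  The list records the order in which the cycle visits these arcs; how each arc is run through is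
  already fixed by \<open>l\<close>.\<close>

definition arc_order :: "nat \<Rightarrow> (nat \<Rightarrow> nat \<times> nat) \<Rightarrow> (nat \<Rightarrow> nat) \<Rightarrow> nat list" where
  "arc_order n l v = filter (\<lambda>i. i \<in> new_vertices n l) (map v [0..<n])"

lemma arc_order_split:
  assumes "k < n" "v k \<in> new_vertices n l"
  shows "\<exists>ys. arc_order n l v = filter (\<lambda>i. i \<in> new_vertices n l) (map v [0..<k]) @ v k # ys"
proof -
  have "[0..<n] = [0..<k] @ k # [Suc k..<n]" 
    using upt_add_eq_append[of 0 k "n - k"] upt_conv_Cons[OF assms(1)] assms(1) by simp
  then show ?thesis using assms by (simp add: arc_order_def)
qed

context
  fixes n d :: nat and l :: "nat \<Rightarrow> nat \<times> nat"
  assumes n2: "2 \<le> n" and d2: "2 \<le> d" and l: "l \<in> {..<n} \<rightarrow>\<^sub>E labels d"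
begin

text \<open>The successor of a vertex left through label 0 or 1 is its neighbour on the base cycle; otherwise it
  is the next new vertex.\<close>

lemma compatible_orders_eqI:
  assumes v: "v \<in> compatible_orders n l" and w: "w \<in> compatible_orders n l"
    and "v 0 = w 0" and eq: "arc_order n l v = arc_order n l w"
  shows "v = w"
proof -
  interpret V: compatible_cycle n d v l
    using v n2 d2 l by unfold_locales (auto simp: compatible_orders_def)
  interpret W: compatible_cycle n d w l
    using w n2 d2 l by unfold_locales (auto simp: compatible_orders_def)
  have *: "k \<le> n \<Longrightarrow> \<forall>j<k. v j = w j" for k
  proof (induction k)
    case (Suc k)
    then have k: "k < n" and IH: "\<forall>j<k. v j = w j" by auto
    have "v k = w k"
    proof (cases k)
      case 0
      then show ?thesis using \<open>v 0 = w 0\<close> by simp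
    next
      case (Suc j)
      then have j: "j < n" "v j = w j" "Suc j mod n = k" using k IH by auto
      consider "snd (l (v j)) = 1" | "snd (l (v j)) = 0" | "2 \<le> snd (l (v j))" by linarith
      then show ?thesis
      proof cases
        case 1
        have "v k = Suc (v j) mod n" using V.out_1(1)[OF j(1) 1] j(3) by simp
        moreover have "w k = Suc (w j) mod n" using W.out_1(1)[OF j(1)] 1 j by simp
        ultimately show ?thesis using j(2) by simp
      next
        case 2
        have "v j = Suc (v k) mod n" using V.in_1(1)[OF j(1) V.out_0[OF j(1) 2]] j(3) by simp
        moreover have "w j = Suc (w k) mod n"
          using W.in_1(1)[OF j(1) W.out_0[OF j(1)]] 2 j by simp
        ultimately show ?thesis using j(2) k by (intro Suc_mod_inj[of "v k" n]) auto
      next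
        case 3
        have "v k \<in> new_vertices n l" using V.new_iff[OF j(1)] 3 j(3) k by (simp add: new_vertices_def)
        moreover have "w k \<in> new_vertices n l"
          using W.new_iff[OF j(1)] 3 j k by (simp add: new_vertices_def)
        ultimately obtain ys zs where
          "arc_order n l v = filter (\<lambda>i. i \<in> new_vertices n l) (map v [0..<k]) @ v k # ys"
          "arc_order n l w = filter (\<lambda>i. i \<in> new_vertices n l) (map w [0..<k]) @ w k # zs"
          using arc_order_split[OF k] by meson
        moreover have "map v [0..<k] = map w [0..<k]" using IH by simp
        ultimately show ?thesis using eq by simp
      qed
    qed
    with IH show ?case by (auto simp: less_Suc_eq)
  qed simp
  show ?thesis
  proof
    fix k show "v k = w k"
      using *[of n] V.v W.v by (cases "k < n") (auto simp: permutes_def)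
  qed
qed

text \<open>When \<open>v 0\<close> is new it is the head of the arc list, so the list alone
  determines \<open>v\<close>, and it is one of the permutations of the new vertices.\<close>

lemma card_compatible_orders_from_new:
  "card {v \<in> compatible_orders n l. v 0 \<in> new_vertices n l} \<le> fact (card (new_vertices n l))"
proof -
  let ?V0 = "{v \<in> compatible_orders n l. v 0 \<in> new_vertices n l}"
  have "arc_order n l v \<in> permutations_of_set (new_vertices n l)" if "v \<in> compatible_orders n l" for v
  proof (rule permutations_of_setI)
    interpret V: compatible_cycle n d v l
      using that n2 d2 l by unfold_locales (auto simp: compatible_orders_def)
    have "new_vertices n l \<subseteq> v ` {0..<n}"
      using permutes_image[OF V.v] by (auto simp: new_vertices_def atLeast0LessThan)
    then show "set (arc_order n l v) = new_vertices n l" by (auto simp: arc_order_def)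
    show "distinct (arc_order n l v)"
      by (auto simp: arc_order_def distinct_map inj_on_def intro!: distinct_filter)
  qed
  moreover have "inj_on (arc_order n l) ?V0"
  proof (rule inj_onI)
    fix v w assume v: "v \<in> ?V0" and w: "w \<in> ?V0" and eq: "arc_order n l v = arc_order n l w"
    have "0 < n" using n2 by simp
    then obtain ys zs where "arc_order n l v = v 0 # ys" "arc_order n l w = w 0 # zs"
      using arc_order_split[of 0 n v l] arc_order_split[of 0 n w l] v w by auto
    then show "v = w" using v w eq by (intro compatible_orders_eqI) auto
  qed
  ultimately have "card ?V0 \<le> card (permutations_of_set (new_vertices n l))"
    by (intro card_inj_on_le[of "arc_order n l"]) auto
  then show ?thesis by (simp add: finite_new_vertices)
qed

lemma card_compatible_orders_at:
  assumes "k < n"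
  shows "card {v \<in> compatible_orders n l. v k \<in> new_vertices n l} \<le> fact (card (new_vertices n l))"
proof -
  let ?V = "\<lambda>k. {v \<in> compatible_orders n l. v k \<in> new_vertices n l}"
  let ?\<rho> = "rotation n ^^ k"
  have "card (?V k) \<le> card (?V 0)"
  proof (rule card_inj_on_le[of "\<lambda>v. v \<circ> ?\<rho>"])
    have "surj ?\<rho>" using rotation_funpow_permutes by (rule permutes_surj)
    then show "inj_on (\<lambda>v. v \<circ> ?\<rho>) (?V k)" by (auto intro!: inj_onI simp: fun_eq_iff surj_def) metis
    show "(\<lambda>v. v \<circ> ?\<rho>) ` ?V k \<subseteq> ?V 0"
      using rotation_funpow_0[OF assms] by (auto intro: compatible_orders_rotation_funpow)
    show "finite (?V 0)" using finite_compatible_orders by simp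
  qed
  also have "\<dots> \<le> fact (card (new_vertices n l))" by (rule card_compatible_orders_from_new)
  finally show ?thesis .
qed

text \<open>Double counting of the pairs of an order \<open>v\<close> and an index \<open>k\<close>
  with \<open>v k\<close> new. With \<open>m\<close> new vertices every order has \<open>m\<close>
  such indices, while every index admits at most \<open>m!\<close> orders; dividing
  \<open>n * m!\<close> by \<open>m\<close> gives the bound.\<close>

lemma card_compatible_orders:
  "card (compatible_orders n l) \<le> n * fact (card (new_vertices n l) - 1)"
proof (cases "new_vertices n l = {}")
  \<comment> \<open>Without new vertices the starting point determines the order. The bound then
    reads \<open>n\<close>, since \<open>0 - 1 = 0\<close> on natural numbers and
    \<open>fact 0 = 1\<close>.\<close>
  case True
  have "card (compatible_orders n l) \<le> card {..<n}"
  proof (rule card_inj_on_le[of "\<lambda>v. v 0"])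
    show "inj_on (\<lambda>v. v 0) (compatible_orders n l)"
      by (intro inj_onI compatible_orders_eqI) (auto simp: arc_order_def True)
    show "(\<lambda>v. v 0) ` compatible_orders n l \<subseteq> {..<n}"
      using n2 permutes_in_image by (fastforce simp: compatible_orders_def)
  qed simp
  then show ?thesis using True by simp
next
  case False
  let ?I = "new_vertices n l" and ?V = "compatible_orders n l"
  have m: "card ?I > 0" using False finite_new_vertices by (simp add: card_gt_0_iff)
  have cI: "card {k. k < n \<and> v k \<in> ?I} = card ?I" if "v \<in> ?V" for v
  proof -
    have v: "v permutes {..<n}" using that by (simp add: compatible_orders_def)
    have "v ` {k. k < n \<and> v k \<in> ?I} = ?I"
    proof (intro equalityI subsetI)
      fix i assume i: "i \<in> ?I"
      then have "i \<in> v ` {..<n}" using permutes_image[OF v] by (simp add: new_vertices_def)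
      then show "i \<in> v ` {k. k < n \<and> v k \<in> ?I}" using i by auto
    qed auto
    then show ?thesis using card_image[of v "{k. k < n \<and> v k \<in> ?I}"] permutes_inj_on[OF v] by simp
  qed
  have "card ?I * card ?V = (\<Sum>v\<in>?V. card {k \<in> {..<n}. v k \<in> ?I})"
    using cI by simp
  also have "\<dots> = (\<Sum>k<n. card {v \<in> ?V. v k \<in> ?I})"
    by (rule sum_multicount_gen) (auto simp: finite_compatible_orders)
  also have "\<dots> \<le> (\<Sum>k<n. fact (card ?I))"
    by (intro sum_mono card_compatible_orders_at) simp
  also have "\<dots> = card ?I * (n * fact (card ?I - 1))"
    using m by (simp add: fact_reduce)
  finally show ?thesis using m by simp
qed

end

section \<open>The second moment as a sum over labellings\<close>

text \<open>This is 0 when \<open>E\<close> contains two different intersecting pairs, so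
  incompatible cycles drop out of the sums by themselves.\<close>

definition extensions :: "nat \<Rightarrow> nat \<Rightarrow> (nat \<times> nat) set set \<Rightarrow> nat" where
  "extensions n d E = card {P \<in> pairings n d. E \<subseteq> P}"

lemma finite_prevertices: "finite (prevertices n d)"
  by (simp add: prevertices_def)

lemma cycle_pairs_subset_Pow:
  assumes "\<tau> \<in> rooted_cycles n d"
  shows "cycle_pairs n \<tau> \<subseteq> Pow (prevertices n d)"
proof -
  obtain v l where vl: "\<tau> = (v, l)" by (cases \<tau>)
  have v: "v permutes {..<n}" and l: "l \<in> {..<n} \<rightarrow>\<^sub>E labels d" using assms by (auto simp: vl rooted_cycles_def)
  have "step n v l k \<in> Pow (prevertices n d)" if "k < n" for k
  proof -
    have "v j < n" "l (v j) \<in> labels d" if "j < n" for j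
      using permutes_in_image[OF v] l that by auto
    from this[of k] this[of "Suc k mod n"] show ?thesis
      using that by (auto simp: step_def prevertices_def labels_def)
  qed
  then show ?thesis by (auto simp: vl cycle_pairs_def)
qed

lemma relabel_bij_betw_prevertices:
  assumes p: "p permutes {..<n}" and q: "\<And>i. q i permutes {..<d}"
  shows "bij_betw (\<lambda>(i, j). (p i, q i j)) (prevertices n d) (prevertices n d)"
proof -
  have inj: "inj_on (\<lambda>(i, j). (p i, q i j)) (prevertices n d)"
  proof (rule inj_onI, clarify)
    fix i j i' j' assume "p i = p i'" "q i j = q i' j'"
    moreover from this have "i = i'" using permutes_inj[OF p] by (auto dest: injD)
    ultimately show "i = i' \<and> j = j'" using permutes_inj[OF q[of i]] by (auto dest: injD)
  qed
  have "(\<lambda>(i, j). (p i, q i j)) ` prevertices n d \<subseteq> prevertices n d"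
    using permutes_in_image[OF p] permutes_in_image[OF q] by (auto simp: prevertices_def)
  then have "(\<lambda>(i, j). (p i, q i j)) ` prevertices n d = prevertices n d"
    by (rule endo_inj_surj[OF finite_prevertices _ inj])
  then show ?thesis by (rule bij_betw_imageI[OF inj])
qed

lemma extensions_image:
  assumes g: "bij_betw g (prevertices n d) (prevertices n d)" and E: "E \<subseteq> Pow (prevertices n d)"
  shows "extensions n d (image g ` E) = extensions n d E"
proof -
  let ?X = "prevertices n d"
  let ?F = "\<lambda>P. image g ` P"
  have b: "bij_betw ?F (perfect_matchings ?X) (perfect_matchings ?X)"
    by (rule bij_betw_perfect_matchings[OF g])
  have inj: "inj_on (image g) (Pow ?X)"
    using g by (intro inj_on_image_Pow) (auto simp: bij_betw_def)
  have *: "image g ` E \<subseteq> ?F P \<longleftrightarrow> E \<subseteq> P" if "P \<in> perfect_matchings ?X" for P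
  proof -
    have "P \<subseteq> Pow ?X" using that by (auto simp: perfect_matchings_def partition_on_def)
    then show ?thesis by (rule inj_on_image_subset_iff[OF inj E])
  qed
  have "{P \<in> perfect_matchings ?X. image g ` E \<subseteq> P} = ?F ` {P \<in> perfect_matchings ?X. E \<subseteq> P}"
  proof (intro equalityI subsetI)
    fix P assume P: "P \<in> {P \<in> perfect_matchings ?X. image g ` E \<subseteq> P}"
    then have "P \<in> ?F ` perfect_matchings ?X" using bij_betw_imp_surj_on[OF b] by simp
    then obtain P' where P': "P' \<in> perfect_matchings ?X" "P = ?F P'" by blast
    then have "E \<subseteq> P'" using *[OF P'(1)] P by simp
    then show "P \<in> ?F ` {P \<in> perfect_matchings ?X. E \<subseteq> P}"
      using P' by (intro image_eqI[of _ _ P']) simp_all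
  next
    fix P assume "P \<in> ?F ` {P \<in> perfect_matchings ?X. E \<subseteq> P}"
    then obtain P' where P': "P' \<in> perfect_matchings ?X" "E \<subseteq> P'" "P = ?F P'" by blast
    moreover have "?F P' \<in> perfect_matchings ?X" using b P'(1) by (rule bij_betwE[THEN bspec])
    ultimately show "P \<in> {P \<in> perfect_matchings ?X. image g ` E \<subseteq> P}" by (simp add: image_mono)
  qed
  moreover have "inj_on ?F {P \<in> perfect_matchings ?X. E \<subseteq> P}"
    using b by (auto simp: bij_betw_def intro: inj_on_subset)
  ultimately show ?thesis by (simp add: extensions_def pairings_eq card_image)
qed

lemma sum_extensions_invariant:
  assumes \<sigma>: "\<sigma> \<in> rooted_cycles n d" and \<sigma>': "\<sigma>' \<in> rooted_cycles n d"
  shows "(\<Sum>\<tau>\<in>rooted_cycles n d. extensions n d (cycle_pairs n \<sigma> \<union> cycle_pairs n \<tau>)) =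
         (\<Sum>\<tau>\<in>rooted_cycles n d. extensions n d (cycle_pairs n \<sigma>' \<union> cycle_pairs n \<tau>))"
proof -
  obtain p q where p: "p permutes {..<n}" and q: "\<And>i. q i permutes {..<d}" and eq: "relabel n p q \<sigma> = \<sigma>'"
    using relabel_transitive[OF \<sigma> \<sigma>'] by blast
  let ?g = "\<lambda>(i, j). (p i, q i j)"
  have b: "bij_betw (relabel n p q) (rooted_cycles n d) (rooted_cycles n d)"
    by (rule bij_betw_relabel) (fact p q)+
  have "(\<Sum>\<tau>\<in>rooted_cycles n d. extensions n d (cycle_pairs n \<sigma>' \<union> cycle_pairs n \<tau>)) =
        (\<Sum>\<tau>\<in>rooted_cycles n d. extensions n d (cycle_pairs n \<sigma>' \<union> cycle_pairs n (relabel n p q \<tau>)))"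
    using sum.reindex_bij_betw[OF b] by (rule sym)
  also have "\<dots> = (\<Sum>\<tau>\<in>rooted_cycles n d. extensions n d (cycle_pairs n \<sigma> \<union> cycle_pairs n \<tau>))"
  proof (rule sum.cong[OF refl])
    fix \<tau> assume \<tau>: "\<tau> \<in> rooted_cycles n d"
    have "cycle_pairs n \<sigma>' \<union> cycle_pairs n (relabel n p q \<tau>) =
          image ?g ` (cycle_pairs n \<sigma> \<union> cycle_pairs n \<tau>)"
      unfolding eq[symmetric] cycle_pairs_relabel[OF p \<sigma>] cycle_pairs_relabel[OF p \<tau>] image_Un ..
    then show "extensions n d (cycle_pairs n \<sigma>' \<union> cycle_pairs n (relabel n p q \<tau>)) =
          extensions n d (cycle_pairs n \<sigma> \<union> cycle_pairs n \<tau>)"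
      using extensions_image[OF relabel_bij_betw_prevertices[OF p q]]
        cycle_pairs_subset_Pow[OF \<sigma>] cycle_pairs_subset_Pow[OF \<tau>] by simp
  qed
  finally show ?thesis ..
qed

text \<open>With the roles exchanged this shows that all Hamiltonian cycles have equally many rooted
  versions.\<close>

lemma card_fibre_le:
  assumes \<sigma>: "\<sigma> \<in> rooted_cycles n d" and \<sigma>': "\<sigma>' \<in> rooted_cycles n d"
  shows "card {\<tau> \<in> rooted_cycles n d. cycle_pairs n \<tau> = cycle_pairs n \<sigma>} \<le>
         card {\<tau> \<in> rooted_cycles n d. cycle_pairs n \<tau> = cycle_pairs n \<sigma>'}"
proof -
  obtain p q where p: "p permutes {..<n}" and q: "\<And>i. q i permutes {..<d}" and eq: "relabel n p q \<sigma> = \<sigma>'"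
    using relabel_transitive[OF \<sigma> \<sigma>'] by blast
  show ?thesis
  proof (rule card_inj_on_le)
    have "inj_on (relabel n p q) (rooted_cycles n d)" by (rule inj_on_relabel) (fact p q)+
    then show "inj_on (relabel n p q) {\<tau> \<in> rooted_cycles n d. cycle_pairs n \<tau> = cycle_pairs n \<sigma>}"
      by (rule inj_on_subset) blast
    show "finite {\<tau> \<in> rooted_cycles n d. cycle_pairs n \<tau> = cycle_pairs n \<sigma>'}"
      using finite_rooted_cycles by simp
    show "relabel n p q ` {\<tau> \<in> rooted_cycles n d. cycle_pairs n \<tau> = cycle_pairs n \<sigma>} \<subseteq>
        {\<tau> \<in> rooted_cycles n d. cycle_pairs n \<tau> = cycle_pairs n \<sigma>'}"
    proof (rule image_subsetI)
      fix \<tau> assume "\<tau> \<in> {\<tau> \<in> rooted_cycles n d. cycle_pairs n \<tau> = cycle_pairs n \<sigma>}"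
      then have \<tau>: "\<tau> \<in> rooted_cycles n d" "cycle_pairs n \<tau> = cycle_pairs n \<sigma>" by auto
      have "relabel n p q \<tau> \<in> rooted_cycles n d" by (rule relabel_in) (fact p q \<tau>(1))+
      moreover have "cycle_pairs n (relabel n p q \<tau>) = cycle_pairs n \<sigma>'"
        unfolding eq[symmetric] cycle_pairs_relabel[OF p \<sigma>] cycle_pairs_relabel[OF p \<tau>(1)] \<tau>(2) ..
      ultimately show "relabel n p q \<tau> \<in>
          {\<tau> \<in> rooted_cycles n d. cycle_pairs n \<tau> = cycle_pairs n \<sigma>'}" by simp
    qed
  qed
qed

lemma cycle_pairs_hamiltonian:
  assumes \<tau>: "\<tau> \<in> rooted_cycles n d" and P: "cycle_pairs n \<tau> \<subseteq> P"
  shows "cycle_pairs n \<tau> \<in> hamiltonian_cycles n P"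
proof -
  obtain v l where vl: "\<tau> = (v, l)" by (cases \<tau>)
  have v: "v permutes {..<n}" and l: "l \<in> {..<n} \<rightarrow>\<^sub>E labels d" using \<tau> by (auto simp: vl rooted_cycles_def)
  have "bij_betw v {..<n} {..<n}" using v by (rule permutes_imp_bij)
  moreover have "bij_betw (step n v l) {..<n} (cycle_pairs n \<tau>)"
    using inj_on_step[OF v l] by (auto simp: vl cycle_pairs_def bij_betw_def)
  moreover have "endpoints (step n v l k) = {v k, v (Suc k mod n)}" for k
    by (simp add: endpoints_def step_def)
  ultimately show ?thesis using P unfolding hamiltonian_cycles_def by blast
qed

text \<open>The label for entering a vertex is read off from the pair before it and the label for
  leaving from the pair after it. They differ because distinct pairs of \<open>P\<close> share no
  prevertex.\<close>

lemma hamiltonian_is_cycle_pairs: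
  assumes n: "2 \<le> n" and P: "P \<in> pairings n d" and C: "C \<in> hamiltonian_cycles n P"
  shows "\<exists>\<tau>\<in>rooted_cycles n d. cycle_pairs n \<tau> = C"
proof -
  from C obtain v0 e where CP: "C \<subseteq> P" and v0: "bij_betw v0 {..<n} {..<n}" and e: "bij_betw e {..<n} C"
    and ep0: "\<And>k. k < n \<Longrightarrow> endpoints (e k) = {v0 k, v0 (Suc k mod n)}"
    by (auto simp: hamiltonian_cycles_def)
  have PM: "P \<in> perfect_matchings (prevertices n d)" using P by (simp add: pairings_eq)
  define v where "v k = (if k < n then v0 k else k)" for k
  have v: "v permutes {..<n}"
  proof (rule bij_imp_permutes)
    show "bij_betw v {..<n} {..<n}" using v0 by (rule bij_betw_cong[THEN iffD1, rotated]) (simp add: v_def)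
  qed (simp add: v_def)
  have inj: "v x = v y \<longleftrightarrow> x = y" for x y using permutes_inj[OF v] by (auto dest: injD)
  have ep: "endpoints (e k) = {v k, v (Suc k mod n)}" if "k < n" for k
    using ep0[OF that] that by (simp add: v_def)
  have "\<exists>a b. e k = {(v k, b), (v (Suc k mod n), a)}" if k: "k < n" for k
  proof -
    have "e k \<in> P" using CP e k by (auto simp: bij_betw_def)
    then have "card (e k) = 2" using PM by (simp add: perfect_matchings_def)
    then obtain x y where xy: "e k = {x, y}" "x \<noteq> y" by (auto simp: card_2_iff)
    have "{fst x, fst y} = {v k, v (Suc k mod n)}" using ep[OF k] xy by (simp add: endpoints_def)
    then have "fst x = v k \<and> fst y = v (Suc k mod n) \<or> fst y = v k \<and> fst x = v (Suc k mod n)"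
      by (auto simp: doubleton_eq_iff)
    moreover obtain i j i' j' where "x = (i, j)" "y = (i', j')" by (cases x, cases y)
    ultimately have "e k = {(v k, j), (v (Suc k mod n), j')} \<or> e k = {(v k, j'), (v (Suc k mod n), j)}"
      using xy(1) by (auto simp: insert_commute)
    then show ?thesis by blast
  qed
  then obtain a b where ab: "\<And>k. k < n \<Longrightarrow> e k = {(v k, b k), (v (Suc k mod n), a k)}" by metis
  \<comment> \<open>The cyclic predecessor of an index; by \<open>2 \<le> n\<close> it differs from
    the index itself.\<close>
  define pr where "pr k = (if k = 0 then n - 1 else k - 1)" for k :: nat
  have pr: "pr k < n" "Suc (pr k) mod n = k" "pr k \<noteq> k" if "k < n" for k
    using that n by (auto simp: pr_def)
  have pr': "pr (Suc k mod n) = k" if "k < n" for k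
    using that pr[of "Suc k mod n"] Suc_mod_inj[of "pr (Suc k mod n)" n k] by auto
  define l where "l = (\<lambda>i\<in>{..<n}. (a (pr (inv v i)), b (inv v i)))"
  have lv: "l (v k) = (a (pr k), b k)" if "k < n" for k
    using permutes_in_image[OF v, of k] permutes_inverses(2)[OF v] that by (simp add: l_def)
  have step: "step n v l k = e k" if "k < n" for k
  proof -
    have "Suc k mod n < n" using that by simp
    then show ?thesis using that by (simp add: step_def lv pr' ab)
  qed
  have "l i \<in> labels d" if "i < n" for i
  proof -
    have "i \<in> v ` {..<n}" using permutes_image[OF v] that by simp
    then obtain k where k: "k < n" "v k = i" by blast
    have eP: "e k \<in> P" "e (pr k) \<in> P" using CP e k pr by (auto simp: bij_betw_def)
    have 1: "(v k, b k) \<in> e k" using ab k by simp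
    have 2: "(v k, a (pr k)) \<in> e (pr k)" using ab[OF pr(1)[OF k(1)]] pr(2)[OF k(1)] by simp
    have "b k < d" "a (pr k) < d"
      using eP 1 2 PM by (auto simp: perfect_matchings_def partition_on_def prevertices_def)
    moreover have "a (pr k) \<noteq> b k"
    proof
      assume "a (pr k) = b k"
      then have "e k = e (pr k)" using 1 2 perfect_matchings_disjointD[OF PM eP] by simp
      then have "k = pr k" using e k pr by (auto simp: bij_betw_def inj_on_def)
      then show False using pr(3)[OF k(1)] by simp
    qed
    ultimately show ?thesis using lv[OF k(1)] k(2) by (simp add: labels_def)
  qed
  then have "l \<in> {..<n} \<rightarrow>\<^sub>E labels d" by (auto simp: l_def)
  then have "(v, l) \<in> rooted_cycles n d" using v by (simp add: rooted_cycles_def)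
  moreover have "cycle_pairs n (v, l) = C"
    using step e by (auto simp: cycle_pairs_def bij_betw_def)
  ultimately show ?thesis by blast
qed

lemma card_rooted_cycles_in:
  assumes n: "2 \<le> n" and d: "2 \<le> d" and P: "P \<in> pairings n d"
  shows "card {\<tau> \<in> rooted_cycles n d. cycle_pairs n \<tau> \<subseteq> P} =
    card {\<tau> \<in> rooted_cycles n d. cycle_pairs n \<tau> = cycle_pairs n (base_cycle n)} * card (hamiltonian_cycles n P)"
    (is "card ?S = ?c * _")
proof -
  have im: "cycle_pairs n ` ?S = hamiltonian_cycles n P"
  proof (intro equalityI subsetI)
    fix C assume C: "C \<in> hamiltonian_cycles n P"
    moreover have "C \<subseteq> P" using C by (auto simp: hamiltonian_cycles_def)
    ultimately show "C \<in> cycle_pairs n ` ?S" using hamiltonian_is_cycle_pairs[OF n P C] by auto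
  qed (auto intro: cycle_pairs_hamiltonian)
  have fib: "card {\<tau> \<in> ?S. cycle_pairs n \<tau> = C} = ?c" if C: "C \<in> hamiltonian_cycles n P" for C
  proof -
    have "C \<in> cycle_pairs n ` ?S" using im C by simp
    then obtain \<sigma> where \<sigma>: "\<sigma> \<in> ?S" "cycle_pairs n \<sigma> = C" by blast
    have "{\<tau> \<in> ?S. cycle_pairs n \<tau> = C} = {\<tau> \<in> rooted_cycles n d. cycle_pairs n \<tau> = cycle_pairs n \<sigma>}"
      using \<sigma> by auto
    moreover have "card {\<tau> \<in> rooted_cycles n d. cycle_pairs n \<tau> = cycle_pairs n \<sigma>} = ?c"
      using \<sigma> by (intro antisym card_fibre_le base_cycle_in d) auto
    ultimately show ?thesis by simp
  qed
  have "card ?S = (\<Sum>C\<in>cycle_pairs n ` ?S. card {\<tau> \<in> ?S. cycle_pairs n \<tau> = C})"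
    unfolding card_eq_sum using finite_rooted_cycles by (intro sum.image_gen) simp
  also have "\<dots> = (\<Sum>C\<in>hamiltonian_cycles n P. ?c)" unfolding im using fib by (intro sum.cong) auto
  finally show ?thesis by simp
qed

text \<open>Conditions between cyclic neighbours that compatibility forces for every visiting order.
  That they are necessary is all an upper bound requires.\<close>

definition valid_labellings :: "nat \<Rightarrow> nat \<Rightarrow> (nat \<Rightarrow> nat \<times> nat) set" where
  "valid_labellings n d = {l \<in> {..<n} \<rightarrow>\<^sub>E labels d. \<forall>i<n.
     (fst (l (Suc i mod n)) = 0 \<longleftrightarrow> snd (l i) = 1) \<and> (snd (l (Suc i mod n)) = 0 \<longleftrightarrow> fst (l i) = 1)}"

lemma odd_fact_pos [simp]: "0 < odd_fact k"
  by (simp add: odd_fact_def prod_pos)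

lemma odd_fact_nonzero [simp]: "odd_fact k \<noteq> 0"
  using odd_fact_pos[of k] by simp

lemma finite_pairings: "finite (pairings n d)"
  by (simp add: pairings_eq finite_perfect_matchings finite_prevertices)

lemma card_prevertices: "card (prevertices n d) = n * d"
  by (simp add: prevertices_def card_cartesian_product)

lemma card_pairings: "even (n * d) \<Longrightarrow> card (pairings n d) = odd_fact (n * d div 2)"
  unfolding pairings_eq by (rule card_perfect_matchings[OF finite_prevertices]) (simp add: card_prevertices)

lemma extensions_invariant:
  assumes \<sigma>: "\<sigma> \<in> rooted_cycles n d" and \<sigma>': "\<sigma>' \<in> rooted_cycles n d"
  shows "extensions n d (cycle_pairs n \<sigma>') = extensions n d (cycle_pairs n \<sigma>)"
proof -
  obtain p q where p: "p permutes {..<n}" and q: "\<And>i. q i permutes {..<d}" and eq: "relabel n p q \<sigma> = \<sigma>'"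
    using relabel_transitive[OF \<sigma> \<sigma>'] by blast
  show ?thesis
    unfolding eq[symmetric] cycle_pairs_relabel[OF p \<sigma>]
    using extensions_image[OF relabel_bij_betw_prevertices[OF p q]] cycle_pairs_subset_Pow[OF \<sigma>] by simp
qed

lemma extensions_base:
  assumes n: "2 \<le> n" and d: "2 \<le> d" and ev: "even (n * d)"
  shows "extensions n d (cycle_pairs n (base_cycle n)) = odd_fact (n * d div 2 - n)"
proof -
  let ?E = "cycle_pairs n (base_cycle n)"
  have sub: "\<Union>?E \<subseteq> prevertices n d"
    using cycle_pairs_subset_Pow[OF base_cycle_in[OF d]] by blast
  have fin: "finite (\<Union>?E)" using finite_subset[OF sub finite_prevertices] .
  have E: "?E \<in> perfect_matchings (\<Union>?E)"
    unfolding perfect_matchings_def partition_on_def disjoint_def cycle_pairs_base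
    by (auto dest: Suc_mod_inj)
  have "card (\<Union>?E) = 2 * n"
    using card_Union_perfect_matching[OF E fin] card_cycle_pairs[OF base_cycle_in[OF d]] by simp
  then have "card (prevertices n d - \<Union>?E) = 2 * (n * d div 2 - n)"
    using ev by (simp add: card_Diff_subset[OF fin sub] card_prevertices diff_mult_distrib2)
  then show ?thesis
    unfolding extensions_def pairings_eq
    using bij_betw_same_card[OF perfect_matchings_extending[OF E sub]]
      card_perfect_matchings[of "prevertices n d - \<Union>?E"] finite_prevertices by simp
qed

text \<open>Both moments count incidences between pairings and rooted cycles. By invariance the
  inner sum is the same for every first cycle, so the base cycle can be fixed at the price of a
  factor \<open>r\<close>. The fibre size \<open>c\<close> occurs in \<open>f_n\<close> both above
  and below and cancels.\<close>

lemma second_moment_eq: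
  assumes n: "2 \<le> n" and d: "2 \<le> d" and ev: "even (n * d)"
  shows "measure_pmf.expectation (config_model n d) (\<lambda>P. (normalized_ham_count n d P)\<^sup>2) =
    real (\<Sum>\<tau>\<in>rooted_cycles n d. extensions n d (cycle_pairs n (base_cycle n) \<union> cycle_pairs n \<tau>)) *
    real (odd_fact (n * d div 2)) /
    (fact n * (real d * (real d - 1)) ^ n * (real (odd_fact (n * d div 2 - n)))\<^sup>2)"
proof -
  let ?R = "rooted_cycles n d" and ?P = "pairings n d"
  let ?B = "real (odd_fact (n * d div 2 - n))" and ?N = "real (odd_fact (n * d div 2))"
  define S where "S = real (\<Sum>\<tau>\<in>?R. extensions n d (cycle_pairs n (base_cycle n) \<union> cycle_pairs n \<tau>))"
  define r where "r = real (card ?R)"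
  define h where "h P = real (card {\<tau> \<in> ?R. cycle_pairs n \<tau> \<subseteq> P})" for P
  define c where "c = real (card {\<tau> \<in> ?R. cycle_pairs n \<tau> = cycle_pairs n (base_cycle n)})"
  have rr: "r = fact n * (real d * (real d - 1)) ^ n"
    using d by (simp add: r_def card_rooted_cycles of_nat_diff)
  have r0: "r > 0" using d by (simp add: rr)
  have "base_cycle n \<in> {\<tau> \<in> ?R. cycle_pairs n \<tau> = cycle_pairs n (base_cycle n)}"
    using base_cycle_in[OF d, of n] by simp
  then have c0: "c > 0"
    using finite_rooted_cycles unfolding c_def of_nat_0_less_iff card_gt_0_iff by (intro conjI) (blast, simp)
  have hc: "ham_count n P = h P / c" if "P \<in> ?P" for P
    using card_rooted_cycles_in[OF n d that] c0 by (simp add: ham_count_def h_def c_def)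
  have ex: "measure_pmf.expectation (config_model n d) g = (\<Sum>P\<in>?P. g P) / ?N" for g :: "_ \<Rightarrow> real"
  proof -
    have "card ?P > 0" by (simp add: card_pairings[OF ev])
    then have "?P \<noteq> {}" by auto
    then show ?thesis
      unfolding config_model_def by (simp add: integral_pmf_of_set finite_pairings card_pairings[OF ev])
  qed
  have h1: "h P = (\<Sum>\<tau>\<in>?R. of_bool (cycle_pairs n \<tau> \<subseteq> P))" for P
    using finite_rooted_cycles by (simp add: h_def sum_of_bool_eq Int_def)
  have ext: "(\<Sum>P\<in>?P. of_bool (E \<subseteq> P)) = real (extensions n d E)" for E
    using finite_pairings by (simp add: extensions_def sum_of_bool_eq Int_def)
  have sum1: "(\<Sum>P\<in>?P. h P) = r * ?B"
  proof -
    have "(\<Sum>P\<in>?P. h P) = (\<Sum>\<tau>\<in>?R. real (extensions n d (cycle_pairs n \<tau>)))"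
      unfolding h1 by (subst sum.swap) (simp only: ext)
    also have "\<dots> = (\<Sum>\<tau>\<in>?R. ?B)"
      using extensions_invariant[OF base_cycle_in[OF d]] extensions_base[OF n d ev] by (intro sum.cong) auto
    finally show ?thesis by (simp add: r_def)
  qed
  have sum2: "(\<Sum>P\<in>?P. (h P)\<^sup>2) = r * S"
  proof -
    have "(h P)\<^sup>2 = (\<Sum>\<sigma>\<in>?R. \<Sum>\<tau>\<in>?R. of_bool (cycle_pairs n \<sigma> \<union> cycle_pairs n \<tau> \<subseteq> P))" for P
      unfolding power2_eq_square h1 sum_product by (intro sum.cong) auto
    then have "(\<Sum>P\<in>?P. (h P)\<^sup>2) =
        (\<Sum>P\<in>?P. \<Sum>\<sigma>\<in>?R. \<Sum>\<tau>\<in>?R. of_bool (cycle_pairs n \<sigma> \<union> cycle_pairs n \<tau> \<subseteq> P))" by simp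
    also have "\<dots> = (\<Sum>\<sigma>\<in>?R. \<Sum>P\<in>?P. \<Sum>\<tau>\<in>?R. of_bool (cycle_pairs n \<sigma> \<union> cycle_pairs n \<tau> \<subseteq> P))"
      by (rule sum.swap)
    also have "\<dots> = (\<Sum>\<sigma>\<in>?R. \<Sum>\<tau>\<in>?R. real (extensions n d (cycle_pairs n \<sigma> \<union> cycle_pairs n \<tau>)))"
      by (intro sum.cong refl, subst sum.swap) (simp only: ext)
    also have "\<dots> = (\<Sum>\<sigma>\<in>?R. S)"
      unfolding S_def of_nat_sum[symmetric]
      by (intro sum.cong refl arg_cong[of _ _ real] sum_extensions_invariant base_cycle_in d)
    finally show ?thesis by (simp add: r_def)
  qed
  define \<mu> where "\<mu> = measure_pmf.expectation (config_model n d) (ham_count n)"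
  have mu: "\<mu> = r * ?B / c / ?N"
    unfolding \<mu>_def ex using sum1 hc by (simp add: sum_divide_distrib[symmetric])
  have "measure_pmf.expectation (config_model n d) (\<lambda>P. (normalized_ham_count n d P)\<^sup>2) =
      (\<Sum>P\<in>?P. (h P)\<^sup>2 / (c\<^sup>2 * \<mu>\<^sup>2)) / ?N"
    unfolding ex using hc
    by (simp add: normalized_ham_count_def \<mu>_def[symmetric] power_divide power_mult_distrib)
  also have "\<dots> = r * S / (c\<^sup>2 * \<mu>\<^sup>2) / ?N" by (simp add: sum_divide_distrib[symmetric] sum2)
  also have "\<dots> = S * ?N / (r * ?B\<^sup>2)"
    unfolding mu using c0 r0 by (simp add: field_simps power2_eq_square)
  finally show ?thesis by (simp add: S_def rr)
qed

lemma sum_extensions_le: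
  assumes n: "2 \<le> n" and d: "2 \<le> d" and ev: "even (n * d)"
  shows "(\<Sum>\<tau>\<in>rooted_cycles n d. extensions n d (cycle_pairs n (base_cycle n) \<union> cycle_pairs n \<tau>)) \<le>
    (\<Sum>l | l \<in> valid_labellings n d \<and> card (new_vertices n l) \<le> n * d div 2 - n.
       n * fact (card (new_vertices n l) - 1) * odd_fact (n * d div 2 - n - card (new_vertices n l)))"
proof -
  let ?D = "n * d div 2" and ?L = "{..<n} \<rightarrow>\<^sub>E labels d" and ?m = "\<lambda>l. card (new_vertices n l)"
  let ?ext = "\<lambda>v l. extensions n d (cycle_pairs n (base_cycle n) \<union> cycle_pairs n (v, l))"
  let ?V = "{l. l \<in> valid_labellings n d \<and> ?m l \<le> ?D - n}"
  \<comment> \<open>A nonzero count supplies a pairing that contains both cycles; its existence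
    makes them compatible and bounds the number of new vertices.\<close>
  have key: "v \<in> compatible_orders n l \<and> l \<in> ?V \<and> ?ext v l = odd_fact (?D - n - ?m l)"
    if v: "v permutes {..<n}" and l: "l \<in> ?L" and "?ext v l \<noteq> 0" for v l
  proof -
    let ?E = "cycle_pairs n (base_cycle n) \<union> cycle_pairs n (v, l)"
    from that(3) obtain P where P: "P \<in> perfect_matchings (prevertices n d)" "?E \<subseteq> P"
      by (metis (mono_tags, lifting) Collect_empty_eq card.empty extensions_def pairings_eq)
    have "disjoint ?E" using perfect_matchings_subset[OF P] by (simp add: perfect_matchings_def partition_on_def)
    then interpret compatible_cycle n d v l using n d v l by unfold_locales
    have "card (prevertices n d) = 2 * ?D" using ev by (simp add: card_prevertices)
    note * = card_perfect_matchings_extending[OF finite_prevertices this P]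
    have "l \<in> valid_labellings n d"
      using l fst_0_iff snd_0_iff by (simp add: valid_labellings_def)
    moreover have "?m l \<le> ?D - n" using *(2) unfolding card_union by simp
    moreover have "v \<in> compatible_orders n l" using v disj by (simp add: compatible_orders_def)
    ultimately show ?thesis using *(1) unfolding card_union by (simp add: extensions_def pairings_eq)
  qed
  have finV: "finite ?V"
  proof (rule finite_subset)
    show "?V \<subseteq> ?L" by (auto simp: valid_labellings_def)
    show "finite ?L" by (simp add: finite_PiE finite_labels)
  qed
  have "(\<Sum>\<tau>\<in>rooted_cycles n d. extensions n d (cycle_pairs n (base_cycle n) \<union> cycle_pairs n \<tau>)) =
      (\<Sum>v | v permutes {..<n}. \<Sum>l\<in>?L. ?ext v l)"
    unfolding rooted_cycles_def by (simp add: sum.cartesian_product split_def)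
  also have "\<dots> = (\<Sum>l\<in>?L. \<Sum>v | v permutes {..<n}. ?ext v l)" by (rule sum.swap)
  also have "\<dots> = (\<Sum>l\<in>?V. \<Sum>v | v permutes {..<n}. ?ext v l)"
  proof (rule sum.mono_neutral_right)
    show "finite ?L" by (simp add: finite_PiE finite_labels)
    show "?V \<subseteq> ?L" by (auto simp: valid_labellings_def)
    show "\<forall>l\<in>?L - ?V. (\<Sum>v | v permutes {..<n}. ?ext v l) = 0"
      using key by (intro ballI sum.neutral) blast
  qed
  also have "\<dots> \<le> (\<Sum>l\<in>?V. n * fact (?m l - 1) * odd_fact (?D - n - ?m l))"
  proof (rule sum_mono)
    fix l assume "l \<in> ?V"
    then have l: "l \<in> ?L" by (auto simp: valid_labellings_def)
    have "(\<Sum>v | v permutes {..<n}. ?ext v l) = (\<Sum>v\<in>compatible_orders n l. ?ext v l)"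
      using key l by (intro sum.mono_neutral_right) (auto simp: finite_permutations compatible_orders_def)
    also have "\<dots> \<le> (\<Sum>v\<in>compatible_orders n l. odd_fact (?D - n - ?m l))"
    proof (rule sum_mono)
      fix v assume "v \<in> compatible_orders n l"
      then have "v permutes {..<n}" by (simp add: compatible_orders_def)
      then show "?ext v l \<le> odd_fact (?D - n - ?m l)" using key[of v l] l by (cases "?ext v l = 0") auto
    qed
    also have "\<dots> = card (compatible_orders n l) * odd_fact (?D - n - ?m l)" by simp
    also have "\<dots> \<le> n * fact (?m l - 1) * odd_fact (?D - n - ?m l)"
      using card_compatible_orders[OF n d l] by (intro mult_right_mono) auto
    finally show "(\<Sum>v | v permutes {..<n}. ?ext v l) \<le> n * fact (?m l - 1) * odd_fact (?D - n - ?m l)" .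
  qed
  finally show ?thesis .
qed

section \<open>The transfer matrix\<close>

text \<open>The states describe how the cycle uses the pair of the base cycle between vertex \<open>i\<close> and its successor:
  not at all (0), forwards (1) or backwards (2).\<close>

definition left_state :: "nat \<times> nat \<Rightarrow> nat" where
  "left_state x = (if fst x = 0 then 1 else if snd x = 0 then 2 else 0)"

definition right_state :: "nat \<times> nat \<Rightarrow> nat" where
  "right_state x = (if snd x = 1 then 1 else if fst x = 1 then 2 else 0)"

text \<open>The state carried into the vertex with index \<open>n\<close>; before vertex 0 it is the
  freely chosen start state \<open>s\<close>.\<close>

definition end_state :: "nat \<Rightarrow> (nat \<Rightarrow> nat \<times> nat) \<Rightarrow> nat \<Rightarrow> nat" where
  "end_state s l n = (if n = 0 then s else right_state (l (n - 1)))"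

definition new_weight :: "real \<Rightarrow> nat \<times> nat \<Rightarrow> real" where
  "new_weight z x = (if 2 \<le> fst x then z else 1)"

text \<open>The entry \<open>(s, t)\<close> of the \<open>n\<close>-th power of the transfer matrix,
  written out as a sum over walks.\<close>

definition path_sum :: "nat \<Rightarrow> real \<Rightarrow> nat \<Rightarrow> nat \<Rightarrow> nat \<Rightarrow> real" where
  "path_sum d z n s t = (\<Sum>l\<in>{..<n} \<rightarrow>\<^sub>E labels d.
     (\<Prod>i<n. new_weight z (l i) * of_bool (left_state (l i) = end_state s l i)) * of_bool (end_state s l n = t))"

definition transfer :: "nat \<Rightarrow> real \<Rightarrow> nat \<Rightarrow> nat \<Rightarrow> real" where
  "transfer d z s t = (\<Sum>x\<in>labels d. new_weight z x * of_bool (left_state x = s) * of_bool (right_state x = t))"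

lemma states: "left_state x \<in> {0, 1, 2}" "right_state x \<in> {0, 1, 2}"
  by (auto simp: left_state_def right_state_def)

lemma left_state_iff:
  "left_state (a, b) = 0 \<longleftrightarrow> a \<noteq> 0 \<and> b \<noteq> 0"
  "left_state (a, b) = Suc 0 \<longleftrightarrow> a = 0"
  "left_state (a, b) = 2 \<longleftrightarrow> a \<noteq> 0 \<and> b = 0"
  by (simp_all add: left_state_def)

lemma right_state_iff:
  "right_state (a, b) = 0 \<longleftrightarrow> a \<noteq> 1 \<and> b \<noteq> 1"
  "right_state (a, b) = Suc 0 \<longleftrightarrow> b = 1"
  "right_state (a, b) = 2 \<longleftrightarrow> a = 1 \<and> b \<noteq> 1"
  by (simp_all add: right_state_def)

lemma path_sum_0: "path_sum d z 0 s t = of_bool (s = t)"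
  by (simp add: path_sum_def end_state_def)

lemma path_sum_Suc:
  assumes s: "s \<in> {0, 1, 2}"
  shows "path_sum d z (Suc n) s t = (\<Sum>r\<in>{0, 1, 2}. path_sum d z n s r * transfer d z r t)"
proof -
  let ?L = "{..<n} \<rightarrow>\<^sub>E labels d"
  let ?A = "\<lambda>l. \<Prod>i<n. new_weight z (l i) * of_bool (left_state (l i) = end_state s l i)"
  let ?F = "\<lambda>l'. (\<Prod>i<Suc n. new_weight z (l' i) * of_bool (left_state (l' i) = end_state s l' i)) *
      of_bool (end_state s l' (Suc n) = t)"
  have upd: "?F (l(n := x)) = ?A l * (new_weight z x * of_bool (left_state x = end_state s l n) * of_bool (right_state x = t))"
    for l x
  proof -
    have "end_state s (l(n := x)) i = end_state s l i" if "i \<le> n" for i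
      using that by (auto simp: end_state_def)
    moreover have "end_state s (l(n := x)) (Suc n) = right_state x" by (simp add: end_state_def)
    moreover have "(\<Prod>i<n. new_weight z ((l(n := x)) i) * of_bool (left_state ((l(n := x)) i) = end_state s (l(n := x)) i)) = ?A l"
      using calculation(1) by (intro prod.cong) auto
    ultimately show ?thesis by simp
  qed
  have "path_sum d z (Suc n) s t = sum ?F (insert n {..<n} \<rightarrow>\<^sub>E labels d)"
    by (simp add: path_sum_def lessThan_Suc)
  also have "\<dots> = sum ?F ((\<lambda>(x, l). l(n := x)) ` (labels d \<times> ?L))"
    by (simp add: PiE_insert_eq)
  also have "\<dots> = (\<Sum>(x, l)\<in>labels d \<times> ?L. ?F (l(n := x)))"
    using inj_combinator[of n "{..<n}" "\<lambda>_. labels d"] by (subst sum.reindex) (simp_all add: split_def)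
  also have "\<dots> = (\<Sum>x\<in>labels d. \<Sum>l\<in>?L. ?F (l(n := x)))" by (simp add: sum.cartesian_product)
  \<comment> \<open>The state before the last vertex is made explicit by inserting a sum of
    indicators over its three possible values.\<close>
  also have "\<dots> = (\<Sum>x\<in>labels d. \<Sum>l\<in>?L. \<Sum>r\<in>{0, 1, 2}. (?A l * of_bool (end_state s l n = r)) *
      (new_weight z x * of_bool (left_state x = r) * of_bool (right_state x = t)))"
  proof (intro sum.cong refl)
    fix x l
    have "end_state s l n \<in> {0, 1, 2}" using s states by (auto simp: end_state_def)
    then show "?F (l(n := x)) = (\<Sum>r\<in>{0, 1, 2}. (?A l * of_bool (end_state s l n = r)) *
      (new_weight z x * of_bool (left_state x = r) * of_bool (right_state x = t)))"
      unfolding upd by auto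
  qed
  also have "\<dots> = (\<Sum>r\<in>{0, 1, 2}. \<Sum>l\<in>?L. \<Sum>x\<in>labels d. (?A l * of_bool (end_state s l n = r)) *
      (new_weight z x * of_bool (left_state x = r) * of_bool (right_state x = t)))"
    by (rule trans[OF sum.swap], rule trans[OF sum.cong[OF refl sum.swap] sum.swap])
  also have "\<dots> = (\<Sum>r\<in>{0, 1, 2}. path_sum d z n s r * transfer d z r t)"
    unfolding path_sum_def transfer_def sum_product ..
  finally show ?thesis .
qed

lemma transfer_eq_card:
  assumes "\<And>x. x \<in> labels d \<Longrightarrow> left_state x = s \<Longrightarrow> right_state x = t \<Longrightarrow> new_weight z x = y"
  shows "transfer d z s t = real (card {x \<in> labels d. left_state x = s \<and> right_state x = t}) * y"
proof -
  have "transfer d z s t = (\<Sum>x\<in>labels d. of_bool (left_state x = s \<and> right_state x = t) * y)"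
    unfolding transfer_def using assms by (intro sum.cong) auto
  then show ?thesis using finite_labels by (simp add: sum_distrib_right[symmetric] sum_of_bool_eq Int_def)
qed

lemma card_image_interval: "inj_on f {2..<d} \<Longrightarrow> card (f ` {2..<d}) = d - 2" for f :: "nat \<Rightarrow> nat \<times> nat"
  by (simp add: card_image)

text \<open>There are \<open>c\<close> labels different from 0 and 1. The weight \<open>z\<close> is
  charged where a vertex is entered through one of them, hence at the transitions from 0 to 1 and
  from 2 to 0 but not at those from 1 to 0 and from 0 to 2.\<close>

lemma transfer_values:
  assumes d: "2 \<le> d"
  defines "c \<equiv> real d - 2"
  shows "transfer d z 0 0 = c * (c - 1) * z" "transfer d z 0 1 = c * z" "transfer d z 0 2 = c"
    "transfer d z 1 0 = c" "transfer d z 1 1 = 1" "transfer d z 1 2 = 0"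
    "transfer d z 2 0 = c * z" "transfer d z 2 1 = 0" "transfer d z 2 2 = 1"
proof -
  have c: "real (d - 2) = c" using d by (simp add: c_def of_nat_diff)
  have real_sq_diff: "real (e * e - e) = real e * (real e - 1)" for e
    by (cases e) (auto simp: algebra_simps)
  note defs = left_state_iff right_state_iff labels_def new_weight_def
  have "transfer d z 0 0 = real (card {x \<in> labels d. left_state x = 0 \<and> right_state x = 0}) * z"
    by (rule transfer_eq_card) (auto simp: defs)
  also have "{x \<in> labels d. left_state x = 0 \<and> right_state x = 0} =
      {2..<d} \<times> {2..<d} - (\<lambda>a. (a, a)) ` {2..<d}"
    by (auto simp: defs)
  also have "card \<dots> = (d - 2) * (d - 2) - (d - 2)"
    by (subst card_Diff_subset) (auto simp: card_cartesian_product card_image inj_on_def)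
  also have "real \<dots> = c * (c - 1)"
    using real_sq_diff[of "d - 2"] unfolding c .
  finally show "transfer d z 0 0 = c * (c - 1) * z" .
  have "transfer d z 0 1 = real (card {x \<in> labels d. left_state x = 0 \<and> right_state x = 1}) * z"
    by (rule transfer_eq_card) (auto simp: defs)
  also have "{x \<in> labels d. left_state x = 0 \<and> right_state x = 1} = (\<lambda>a. (a, 1)) ` {2..<d}"
    using d by (auto simp: defs)
  finally show "transfer d z 0 1 = c * z" by (simp add: card_image_interval inj_on_def c)
  have "transfer d z 0 2 = real (card {x \<in> labels d. left_state x = 0 \<and> right_state x = 2}) * 1"
    by (rule transfer_eq_card) (auto simp: defs)
  also have "{x \<in> labels d. left_state x = 0 \<and> right_state x = 2} = (\<lambda>a. (1, a)) ` {2..<d}"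
    using d by (auto simp: defs)
  finally show "transfer d z 0 2 = c" by (simp add: card_image_interval inj_on_def c)
  have "transfer d z 1 0 = real (card {x \<in> labels d. left_state x = 1 \<and> right_state x = 0}) * 1"
    by (rule transfer_eq_card) (auto simp: defs)
  also have "{x \<in> labels d. left_state x = 1 \<and> right_state x = 0} = (\<lambda>a. (0, a)) ` {2..<d}"
    using d by (auto simp: defs)
  finally show "transfer d z 1 0 = c" by (simp add: card_image_interval inj_on_def c)
  have "transfer d z 1 1 = real (card {x \<in> labels d. left_state x = 1 \<and> right_state x = 1}) * 1"
    by (rule transfer_eq_card) (auto simp: defs)
  also have "{x \<in> labels d. left_state x = 1 \<and> right_state x = 1} = {(0, 1)}"
    using d by (auto simp: defs)
  finally show "transfer d z 1 1 = 1" by simp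
  have "transfer d z 1 2 = real (card {x \<in> labels d. left_state x = 1 \<and> right_state x = 2}) * 1"
    by (rule transfer_eq_card) (auto simp: defs)
  also have "{x \<in> labels d. left_state x = 1 \<and> right_state x = 2} = {}"
    using d by (auto simp: defs)
  finally show "transfer d z 1 2 = 0" by simp
  have "transfer d z 2 0 = real (card {x \<in> labels d. left_state x = 2 \<and> right_state x = 0}) * z"
    by (rule transfer_eq_card) (auto simp: defs)
  also have "{x \<in> labels d. left_state x = 2 \<and> right_state x = 0} = (\<lambda>a. (a, 0)) ` {2..<d}"
    using d by (auto simp: defs)
  finally show "transfer d z 2 0 = c * z" by (simp add: card_image_interval inj_on_def c)
  have "transfer d z 2 1 = real (card {x \<in> labels d. left_state x = 2 \<and> right_state x = 1}) * 1"
    by (rule transfer_eq_card) (auto simp: defs)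
  also have "{x \<in> labels d. left_state x = 2 \<and> right_state x = 1} = {}"
    using d by (auto simp: defs)
  finally show "transfer d z 2 1 = 0" by simp
  have "transfer d z 2 2 = real (card {x \<in> labels d. left_state x = 2 \<and> right_state x = 2}) * 1"
    by (rule transfer_eq_card) (auto simp: defs)
  also have "{x \<in> labels d. left_state x = 2 \<and> right_state x = 2} = {(1, 0)}"
    using d by (auto simp: defs)
  finally show "transfer d z 2 2 = 1" by simp
qed

text \<open>The transfer matrix has the eigenvalues \<open>a\<close>, \<open>b\<close> and 1; the recursion \<open>rec\<close> is Cayley--Hamilton.\<close>

lemma path_sum_trace:
  assumes d: "2 \<le> d"
  defines "c \<equiv> real d - 2"
  assumes sum: "a + b = 1 + c * (c - 1) * z" and prod: "a * b = - ((c + 1) * c * z)"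
  shows "(\<Sum>s\<in>{0, 1, 2}. path_sum d z n s s) = a ^ n + b ^ n + 1"
proof -
  note vals = transfer_values[OF d, folded c_def]
  define A where "A n s t = path_sum d z n s t" for n s t
  have A0: "A (Suc n) s 0 = A n s 0 * (c * (c - 1) * z) + A n s 1 * c + A n s 2 * (c * z)"
    and A1: "A (Suc n) s 1 = A n s 0 * (c * z) + A n s 1"
    and A2: "A (Suc n) s 2 = A n s 0 * c + A n s 2" if "s \<in> {0, 1, 2}" for n s
    using that by (simp_all only: A_def path_sum_Suc) (simp_all add: vals vals[unfolded One_nat_def])
  define p where "p = 1 + c * (c - 1) * z"
  define q where "q = - ((c + 1) * c * z)"
  have rec: "A (Suc (Suc (Suc n))) s t = (1 + p) * A (Suc (Suc n)) s t - (p + q) * A (Suc n) s t + q * A n s t"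
    if s: "s \<in> {0, 1, 2}" and t: "t \<in> {0, 1, 2}" for n s t
  proof -
    consider "t = 0" | "t = 1" | "t = 2" using t by blast
    then show ?thesis
      by cases (simp_all only: A0[OF s] A1[OF s] A2[OF s] p_def q_def, simp_all add: algebra_simps)
  qed
  define T where "T n = A n 0 0 + A n 1 1 + A n 2 2" for n
  have T3: "T (Suc (Suc (Suc n))) = (1 + p) * T (Suc (Suc n)) - (p + q) * T (Suc n) + q * T n" for n
    unfolding T_def by (simp add: rec algebra_simps)
  have init: "A 0 s t = of_bool (s = t)" for s t by (simp add: A_def path_sum_0)
  have T0: "T 0 = 3" and T1: "T (Suc 0) = 1 + p" and T2: "T (Suc (Suc 0)) = p\<^sup>2 - 2 * q + 1"
    unfolding T_def by (simp_all add: A0 A1 A2 init A1[unfolded One_nat_def] p_def q_def power2_eq_square algebra_simps)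
  have lm: "a + b = p" "a * b = q" using sum prod by (simp_all add: p_def q_def)
  have "T n = a ^ n + b ^ n + 1 \<and> T (Suc n) = a ^ Suc n + b ^ Suc n + 1 \<and>
      T (Suc (Suc n)) = a ^ Suc (Suc n) + b ^ Suc (Suc n) + 1"
  proof (induction n)
    case 0
    show ?case unfolding T0 T1 T2 lm[symmetric] by (simp add: power2_eq_square algebra_simps)
  next
    case (Suc n)
    have "T (Suc (Suc (Suc n))) = a ^ Suc (Suc (Suc n)) + b ^ Suc (Suc (Suc n)) + 1"
      unfolding T3 using Suc unfolding lm[symmetric] by (simp add: algebra_simps)
    then show ?case using Suc by simp
  qed
  then show ?thesis by (simp add: T_def A_def)
qed

text \<open>Validity says that the states of neighbouring vertices agree around the cycle. Valid
  labellings are therefore the closed walks, and their weighted sum is the trace of the matrix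
  power.\<close>

lemma sum_valid_labellings:
  assumes n: "0 < n" and d: "2 \<le> d"
  defines "c \<equiv> real d - 2"
  assumes "a + b = 1 + c * (c - 1) * z" and "a * b = - ((c + 1) * c * z)"
  shows "(\<Sum>l\<in>valid_labellings n d. z ^ card (new_vertices n l)) = a ^ n + b ^ n + 1"
proof -
  let ?L = "{..<n} \<rightarrow>\<^sub>E labels d"
  have w: "(\<Prod>i<n. new_weight z (l i)) = z ^ card (new_vertices n l)" for l
    by (simp add: new_weight_def prod.If_cases new_vertices_def Int_def lessThan_def)
  have valid: "l \<in> valid_labellings n d \<longleftrightarrow> (\<forall>i<n. left_state (l i) = end_state (right_state (l (n - 1))) l i)"
    if l: "l \<in> ?L" for l
  proof -
    have lab: "fst (l i) \<noteq> snd (l i)" if "i < n" for i using l that by (auto simp: labels_def PiE_def Pi_def)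
    have st: "left_state (l (Suc i mod n)) = right_state (l i) \<longleftrightarrow>
       (fst (l (Suc i mod n)) = 0 \<longleftrightarrow> snd (l i) = 1) \<and> (snd (l (Suc i mod n)) = 0 \<longleftrightarrow> fst (l i) = 1)"
      if "i < n" for i
      using lab[of i] lab[of "Suc i mod n"] that by (auto simp: left_state_def right_state_def)
    have "l \<in> valid_labellings n d \<longleftrightarrow> (\<forall>i<n. left_state (l (Suc i mod n)) = right_state (l i))"
      using l st by (auto simp: valid_labellings_def)
    also have "\<dots> \<longleftrightarrow> (\<forall>i<n. left_state (l i) = end_state (right_state (l (n - 1))) l i)"
    proof safe
      fix i assume *: "\<forall>i<n. left_state (l (Suc i mod n)) = right_state (l i)" and i: "i < n"
      show "left_state (l i) = end_state (right_state (l (n - 1))) l i"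
        using *[rule_format, of "i - 1"] *[rule_format, of "n - 1"] i n by (cases i) (auto simp: end_state_def)
    next
      fix i assume *: "\<forall>i<n. left_state (l i) = end_state (right_state (l (n - 1))) l i" and i: "i < n"
      show "left_state (l (Suc i mod n)) = right_state (l i)"
        using *[rule_format, of "Suc i mod n"] i n by (auto simp: end_state_def mod_Suc)
    qed
    finally show ?thesis .
  qed
  have "(\<Sum>s\<in>{0, 1, 2}. path_sum d z n s s) = (\<Sum>l\<in>?L. \<Sum>s\<in>{0, 1, 2}.
      (\<Prod>i<n. new_weight z (l i) * of_bool (left_state (l i) = end_state s l i)) * of_bool (end_state s l n = s))"
    unfolding path_sum_def by (rule sum.swap)
  also have "\<dots> = (\<Sum>l\<in>?L. z ^ card (new_vertices n l) * of_bool (l \<in> valid_labellings n d))"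
  proof (rule sum.cong[OF refl])
    fix l assume l: "l \<in> ?L"
    define r where "r = right_state (l (n - 1))"
    \<comment> \<open>The last label fixes the final state, so only one start state closes the
      walk.\<close>
    have "end_state s l n = r" for s using n by (simp add: end_state_def r_def)
    moreover have "r \<in> {0, 1, 2}" unfolding r_def by (rule states)
    ultimately have "(\<Sum>s\<in>{0, 1, 2}. (\<Prod>i<n. new_weight z (l i) * of_bool (left_state (l i) = end_state s l i)) *
        of_bool (end_state s l n = s)) = (\<Prod>i<n. new_weight z (l i) * of_bool (left_state (l i) = end_state r l i))"
      by auto
    also have "\<dots> = z ^ card (new_vertices n l) * (\<Prod>i<n. of_bool (left_state (l i) = end_state r l i))"
      by (simp add: prod.distrib w)
    also have "(\<Prod>i<n. of_bool (left_state (l i) = end_state r l i)) = (of_bool (l \<in> valid_labellings n d) :: real)"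
      unfolding valid[OF l] r_def[symmetric] by auto
    finally show "(\<Sum>s\<in>{0, 1, 2}. (\<Prod>i<n. new_weight z (l i) * of_bool (left_state (l i) = end_state s l i)) *
        of_bool (end_state s l n = s)) = z ^ card (new_vertices n l) * of_bool (l \<in> valid_labellings n d)" .
  qed
  also have "\<dots> = (\<Sum>l\<in>valid_labellings n d. z ^ card (new_vertices n l))"
  proof -
    have "finite ?L" by (simp add: finite_PiE finite_labels)
    moreover have "valid_labellings n d \<subseteq> ?L" by (auto simp: valid_labellings_def)
    ultimately show ?thesis by (intro sum.mono_neutral_cong_right) auto
  qed
  finally show ?thesis using path_sum_trace[OF d, folded c_def, OF assms(4,5), of n] by simp
qed

section \<open>Stirling's formula\<close>

text \<open>At \<open>x = 1 / n\<close> the left-hand side is \<open>1 / (n + 1 / 2)\<close>,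
  exactly what makes the Stirling error decreasing.\<close>

lemma ln_one_plus_ge:
  fixes x :: real
  assumes "0 \<le> x"
  shows "2 * x / (2 + x) \<le> ln (1 + x)"
proof -
  let ?f = "\<lambda>x::real. ln (1 + x) - 2 * x / (2 + x)"
  have "?f 0 \<le> ?f x"
  proof (rule DERIV_nonneg_imp_nondecreasing[OF assms])
    fix y :: real assume y: "0 \<le> y" "y \<le> x"
    have "(?f has_real_derivative 1 / (1 + y) - (2 * (2 + y) - 2 * y) / (2 + y)\<^sup>2) (at y)"
      using y by (auto intro!: derivative_eq_intros simp: power2_eq_square)
    moreover have "1 / (1 + y) - (2 * (2 + y) - 2 * y) / (2 + y)\<^sup>2 = y\<^sup>2 / ((1 + y) * (2 + y)\<^sup>2)"
      using y by (simp add: divide_simps) (simp add: power2_eq_square algebra_simps)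
    ultimately show "\<exists>z. (?f has_real_derivative z) (at y) \<and> 0 \<le> z"
      using y by (intro exI[of _ "y\<^sup>2 / ((1 + y) * (2 + y)\<^sup>2)"]) auto
  qed
  then show ?thesis by simp
qed

text \<open>The right-hand side is \<open>(1 + x - 1 / (1 + x)) / 2\<close>. At
  \<open>x = 1 / n\<close> it bounds the decrement of the Stirling error by a telescoping
  difference.\<close>

lemma ln_one_plus_le:
  fixes x :: real
  assumes "0 \<le> x"
  shows "ln (1 + x) \<le> x * (2 + x) / (2 * (1 + x))"
proof -
  let ?f = "\<lambda>x::real. (1 + x - 1 / (1 + x)) / 2 - ln (1 + x)"
  have "?f 0 \<le> ?f x"
  proof (rule DERIV_nonneg_imp_nondecreasing[OF assms])
    fix y :: real assume y: "0 \<le> y" "y \<le> x"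
    have "(?f has_real_derivative (1 + 1 / (1 + y)\<^sup>2) / 2 - 1 / (1 + y)) (at y)"
      using y by (auto intro!: derivative_eq_intros simp: power2_eq_square)
    moreover have "(1 + 1 / (1 + y)\<^sup>2) / 2 - 1 / (1 + y) = (1 - 1 / (1 + y))\<^sup>2 / 2"
      unfolding power_one_over[symmetric] by (simp add: power2_eq_square algebra_simps)
    ultimately show "\<exists>z. (?f has_real_derivative z) (at y) \<and> 0 \<le> z"
      by (intro exI[of _ "(1 - 1 / (1 + y))\<^sup>2 / 2"]) auto
  qed
  moreover have "(1 + x - 1 / (1 + x)) / 2 = x * (2 + x) / (2 * (1 + x))"
    using assms by (simp add: field_simps)
  ultimately show ?thesis by simp
qed

text \<open>The logarithm of the quotient of \<open>n!\<close> and
  \<open>n^(n + 1/2) exp (- n)\<close>; its limit is \<open>ln (2 * pi) / 2\<close>.\<close>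

definition stirling_error :: "nat \<Rightarrow> real" where
  "stirling_error n = ln (fact n) - (real n + 1 / 2) * ln (real n) + real n"

lemma stirling_error_diff:
  assumes "0 < n"
  shows "stirling_error n - stirling_error (Suc n) = (real n + 1 / 2) * ln (1 + 1 / real n) - 1"
proof -
  define a b where "a = ln (real (Suc n))" and "b = ln (real n)"
  have "1 + 1 / real n = real (Suc n) / real n" using assms by (simp add: field_simps)
  then have 1: "ln (1 + 1 / real n) = a - b" using assms by (simp add: ln_div a_def b_def)
  have 2: "ln (fact (Suc n) :: real) = a + ln (fact n)"
    unfolding a_def by (simp only: fact_Suc of_nat_mult ln_mult_pos of_nat_0_less_iff zero_less_Suc fact_gt_zero)
  show ?thesis
    unfolding stirling_error_def 1 2 a_def[symmetric] b_def[symmetric] by (simp add: field_simps)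
qed

lemma stirling_error_diff_bounds:
  assumes "0 < n"
  shows "stirling_error (Suc n) \<le> stirling_error n"
    and "stirling_error n - stirling_error (Suc n) \<le> 1 / 4 * (1 / real n - 1 / real (Suc n))"
proof -
  have n: "real n > 0" using assms by simp
  have "(real n + 1 / 2) * (2 * (1 / real n) / (2 + 1 / real n)) \<le> (real n + 1 / 2) * ln (1 + 1 / real n)"
    using n by (intro mult_left_mono ln_one_plus_ge) auto
  moreover have "(real n + 1 / 2) * (2 * (1 / real n) / (2 + 1 / real n)) = 1"
    using n by (simp add: field_simps)
  ultimately show "stirling_error (Suc n) \<le> stirling_error n"
    using stirling_error_diff[OF assms] by simp
  have "(real n + 1 / 2) * ln (1 + 1 / real n) \<le>
      (real n + 1 / 2) * (1 / real n * (2 + 1 / real n) / (2 * (1 + 1 / real n)))"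
    using n by (intro mult_left_mono ln_one_plus_le) auto
  also have "\<dots> = 1 + 1 / 4 * (1 / real n - 1 / real (Suc n))"
    using n by (simp add: divide_simps) (simp add: algebra_simps)
  finally show "stirling_error n - stirling_error (Suc n) \<le> 1 / 4 * (1 / real n - 1 / real (Suc n))"
    using stirling_error_diff[OF assms] by linarith
qed

lemma stirling_error_add:
  assumes "0 < n"
  shows "stirling_error (n + k) \<le> stirling_error n \<and>
    stirling_error n - stirling_error (n + k) \<le> 1 / 4 * (1 / real n - 1 / real (n + k))"
proof (induction k)
  case (Suc k)
  then show ?case using stirling_error_diff_bounds[of "n + k"] assms by simp
qed simp

lemma stirling_error_double:
  assumes "0 < n"
  shows "stirling_error (2 * n) \<le> stirling_error n" "stirling_error n - stirling_error (2 * n) \<le> 1 / (8 * real n)"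
proof -
  have "1 / 4 * (1 / real n - 1 / real (n + n)) = 1 / (8 * real n)" using assms by (simp add: field_simps)
  then show "stirling_error (2 * n) \<le> stirling_error n"
    "stirling_error n - stirling_error (2 * n) \<le> 1 / (8 * real n)"
    using stirling_error_add[OF assms, of n] unfolding mult_2 by auto
qed

lemma wallis_product:
  "(\<Prod>k=1..n. (4 * real k ^ 2) / (4 * real k ^ 2 - 1)) = (4 ^ n * (fact n)\<^sup>2 / fact (2 * n))\<^sup>2 / (2 * real n + 1)"
proof (induction n)
  case (Suc n)
  define g where "g n = (4 ^ n * (fact n)\<^sup>2 / fact (2 * n) :: real)" for n
  define x where "x = 2 * real n + 1"
  have x: "x > 0" by (simp add: x_def)
  have "(fact (2 * Suc n) :: real) = (x + 1) * x * fact (2 * n)"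
    by (simp add: algebra_simps x_def)
  moreover have "(fact (Suc n) :: real) = (x + 1) / 2 * fact n" by (simp add: algebra_simps x_def)
  ultimately have "g (Suc n) = (4 * 4 ^ n * (fact n)\<^sup>2 * ((x + 1) * (x + 1) / 4)) / ((x + 1) * x * fact (2 * n))"
    unfolding g_def by (simp only: power_Suc) (simp add: power2_eq_square field_simps)
  also have "\<dots> = g n * ((x + 1) / x)" using x by (simp add: g_def mult_ac)
  finally have g: "g (Suc n) = g n * ((x + 1) / x)" .
  have f: "4 * real (Suc n) ^ 2 = (x + 1)\<^sup>2" "(x + 1)\<^sup>2 - 1 = x * (x + 2)"
    by (simp_all add: x_def power2_eq_square algebra_simps)
  have "(\<Prod>k=1..Suc n. (4 * real k ^ 2) / (4 * real k ^ 2 - 1)) = (g n)\<^sup>2 / x * ((x + 1)\<^sup>2 / (x * (x + 2)))"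
  proof -
    have "(\<Prod>k=1..Suc n. (4 * real k ^ 2) / (4 * real k ^ 2 - 1)) =
        (\<Prod>k=1..n. (4 * real k ^ 2) / (4 * real k ^ 2 - 1)) * (4 * real (Suc n) ^ 2 / (4 * real (Suc n) ^ 2 - 1))"
      by (subst prod.nat_ivl_Suc') (simp, rule mult.commute)
    then show ?thesis by (simp only: f Suc.IH[folded g_def x_def])
  qed
  also have "\<dots> = (g (Suc n))\<^sup>2 / (x + 2)"
    unfolding g by (simp add: power2_eq_square mult_ac)
  finally show ?case by (simp add: g_def x_def add_ac)
qed simp

text \<open>In this combination the logarithms reduce to the reciprocal of the central binomial
  coefficient, scaled by \<open>4 ^ n\<close>, whose square is the Wallis product up to an
  elementary factor.\<close>

lemma stirling_error_wallis:
  assumes "0 < n"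
  shows "exp (2 * (2 * stirling_error n - stirling_error (2 * n))) =
    (\<Prod>k=1..n. (4 * real k ^ 2) / (4 * real k ^ 2 - 1)) * ((2 * real n + 1) * 2 / real n)"
proof -
  define x where "x = (4 ^ n * (fact n)\<^sup>2 / fact (2 * n) :: real)"
  have x: "x > 0" by (simp add: x_def)
  have n: "2 * real n + 1 \<noteq> 0" "real n > 0" using assms by simp_all
  have "ln x = real n * ln 4 + 2 * ln (fact n) - ln (fact (2 * n))"
    by (simp add: ln_div ln_mult_pos ln_realpow x_def)
  moreover have "ln 4 = 2 * ln (2::real)" using ln_realpow[of 2 2] by simp
  moreover have "ln (real (2 * n)) = ln 2 + ln (real n)" using assms by (simp add: ln_mult_pos)
  ultimately have "2 * (2 * stirling_error n - stirling_error (2 * n)) = 2 * ln x + ln (2 / real n)"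
    using assms by (simp add: stirling_error_def ln_div algebra_simps)
  also have "\<dots> = ln (x\<^sup>2 * (2 / real n))" using x n by (subst ln_mult_pos) (auto simp: ln_realpow)
  finally have "exp (2 * (2 * stirling_error n - stirling_error (2 * n))) = x\<^sup>2 * (2 / real n)"
    using x n by simp
  moreover have "a / y * (y * 2 / m) = a * (2 / m)" if "y \<noteq> 0" for a y m :: real
    using that by simp
  ultimately show ?thesis unfolding wallis_product x_def[symmetric] using n by metis
qed

text \<open>A decreasing sequence stays above its limit. The limit is found by subtracting from the
  Wallis combination the difference of the errors at \<open>n\<close> and \<open>2 * n\<close>,
  which vanishes asymptotically.\<close>

lemma stirling_lower:
  assumes "0 < n"
  shows "ln (2 * pi) / 2 \<le> stirling_error n"
proof -
  have lim1: "(\<lambda>n. exp (2 * (2 * stirling_error n - stirling_error (2 * n)))) \<longlonglongrightarrow> pi / 2 * 4"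
  proof (rule Lim_transform_eventually)
    have "(\<lambda>n. (2 * real n + 1) * 2 / real n) \<longlonglongrightarrow> 4"
    proof (rule Lim_transform_eventually)
      show "(\<lambda>n. 4 + 2 * inverse (real n)) \<longlonglongrightarrow> 4"
        using tendsto_add[OF tendsto_const tendsto_mult[OF tendsto_const lim_inverse_n]] by fastforce
      show "\<forall>\<^sub>F n in sequentially. 4 + 2 * inverse (real n) = (2 * real n + 1) * 2 / real n"
        using eventually_gt_at_top[of 0] by eventually_elim (simp add: field_simps)
    qed
    then show "(\<lambda>n. (\<Prod>k=1..n. (4 * real k ^ 2) / (4 * real k ^ 2 - 1)) * ((2 * real n + 1) * 2 / real n))
        \<longlonglongrightarrow> pi / 2 * 4"
      by (intro tendsto_mult wallis)
    show "\<forall>\<^sub>F n in sequentially. (\<Prod>k=1..n. (4 * real k ^ 2) / (4 * real k ^ 2 - 1)) * ((2 * real n + 1) * 2 / real n)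
        = exp (2 * (2 * stirling_error n - stirling_error (2 * n)))"
      using eventually_gt_at_top[of 0] by eventually_elim (simp only: stirling_error_wallis)
  qed
  then have "(\<lambda>n. ln (exp (2 * (2 * stirling_error n - stirling_error (2 * n))))) \<longlonglongrightarrow> ln (pi / 2 * 4)"
    by (rule tendsto_ln) simp
  then have lim2: "(\<lambda>n. 2 * (2 * stirling_error n - stirling_error (2 * n))) \<longlonglongrightarrow> ln (2 * pi)"
    by (simp add: mult.commute)
  have lim3: "(\<lambda>n. stirling_error n - stirling_error (2 * n)) \<longlonglongrightarrow> 0"
  proof (rule tendsto_sandwich)
    show "\<forall>\<^sub>F n in sequentially. 0 \<le> stirling_error n - stirling_error (2 * n)"
      using eventually_gt_at_top[of 0] by eventually_elim (use stirling_error_double in simp)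
    show "\<forall>\<^sub>F n in sequentially. stirling_error n - stirling_error (2 * n) \<le> 1 / 8 * inverse (real n)"
      using eventually_gt_at_top[of 0]
      by eventually_elim (use stirling_error_double in \<open>simp add: field_simps\<close>)
    show "(\<lambda>n. 1 / 8 * inverse (real n)) \<longlonglongrightarrow> 0"
      by (simp add: lim_inverse_n)
  qed simp
  have "(\<lambda>n. (2 * (2 * stirling_error n - stirling_error (2 * n)) - 2 * (stirling_error n - stirling_error (2 * n))) / 2)
      \<longlonglongrightarrow> (ln (2 * pi) - 2 * 0) / 2"
    by (intro tendsto_intros lim2 lim3) simp
  then have "stirling_error \<longlonglongrightarrow> ln (2 * pi) / 2" by (simp add: algebra_simps)
  then have lim: "(\<lambda>k. stirling_error (n + k)) \<longlonglongrightarrow> ln (2 * pi) / 2"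
    by (subst add.commute) (rule LIMSEQ_ignore_initial_segment)
  then show ?thesis
    by (rule LIMSEQ_le_const2) (use stirling_error_add[OF assms] in blast)
qed

lemma fact_eq_odd_fact: "(fact (2 * k) :: real) = 2 ^ k * fact k * real (odd_fact k)"
  by (induction k) (simp_all add: odd_fact_def algebra_simps)

text \<open>From \<open>(2 k)! = 2^k k! (2 k - 1)!!\<close>: Stirling's constant cancels in the
  quotient of the two factorials, and the factor 2 inside the square root leaves
  \<open>ln 2 / 2\<close>.\<close>

lemma ln_odd_fact:
  assumes "0 < k"
  shows "ln (real (odd_fact k)) = real k * ln (2 * real k) - real k + ln 2 / 2
    - (stirling_error k - stirling_error (2 * k))"
proof -
  have "ln (fact (2 * k) :: real) = real k * ln 2 + ln (fact k) + ln (real (odd_fact k))"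
    unfolding fact_eq_odd_fact by (simp add: ln_mult_pos ln_realpow)
  then show ?thesis using assms by (simp add: stirling_error_def ln_mult_pos algebra_simps)
qed

text \<open>The right-hand side is twice the expected number of Hamiltonian cycles.\<close>

lemma first_moment_lower:
  fixes n d :: nat
  assumes n: "0 < n" and d: "3 \<le> d" and ev: "even (n * d)"
  defines "K \<equiv> n * d div 2 - n"
  defines "D \<equiv> real d"
  shows "sqrt (2 * pi / real n) * ((D - 1) ^ n * ((D - 2) / D) powr (real n * (D - 2) / 2)) * exp (- 1 / (4 * real n))
    \<le> fact (n - 1) * (D * (D - 1)) ^ n * real (odd_fact K) / real (odd_fact (n * d div 2))" (is "?L \<le> ?R")
proof -
  obtain h where h: "n * d = 2 * h" using ev by blast
  have nd: "real n * D = 2 * real h" using h unfolding D_def by (metis of_nat_mult of_nat_numeral)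
  have D: "D \<ge> 3" "real n > 0" using d n by (auto simp: D_def)
  have half: "n * d div 2 = h" and Kh: "K = h - n" by (simp_all add: K_def h)
  have "n * 3 \<le> 2 * h" using h d by (metis mult_le_mono2)
  then have nh: "n \<le> h" "K > 0" "h > 0" using n by (auto simp: Kh)
  have K2: "2 * real K = real n * (D - 2)" using nh nd by (simp add: Kh of_nat_diff algebra_simps)
  have hK: "real h = real K + real n" using nh by (simp add: Kh)
  have hD: "2 * real h = real n * D" using nd by simp
  define a b c where "a = ln (real n)" and "b = ln (D - 2)" and "c = ln D"
  have 1: "ln (2 * real K) = a + b" unfolding K2 using D by (simp add: ln_mult_pos a_def b_def)
  have 2: "ln (2 * real h) = a + c" unfolding hD using D by (simp add: ln_mult_pos a_def c_def)
  have f: "fact (n - 1) = (fact n / real n :: real)" using n by (simp add: fact_reduce)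
  have lnR: "ln ?R = (ln (fact n) - a) + real n * (c + ln (D - 1)) + ln (real (odd_fact K)) - ln (real (odd_fact h))"
    unfolding f half using D odd_fact_pos[of K] odd_fact_pos[of h]
    by (simp add: ln_div ln_mult_pos ln_realpow a_def c_def)
  have lnL: "ln ?L = (ln (2 * pi) - a) / 2 + real n * ln (D - 1) + (2 * real K / 2) * (b - c) - 1 / (4 * real n)"
    unfolding K2 using D by (simp add: ln_div ln_mult_pos ln_realpow ln_sqrt ln_powr a_def b_def c_def)
  \<comment> \<open>By \<open>3 \<le> d\<close> one has \<open>K \<ge> n / 2\<close>, which turns
    the error \<open>1 / (8 * K)\<close> into the \<open>1 / (4 * n)\<close> of the
    statement.\<close>
  have "real n * 1 \<le> real n * (D - 2)" using D by (intro mult_left_mono) auto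
  then have "real K \<ge> real n / 2" using K2 by simp
  then have "1 / (8 * real K) \<le> 1 / (4 * real n)" using D nh by (intro divide_left_mono) auto
  then have "stirling_error K - stirling_error (2 * K) \<le> 1 / (4 * real n)"
    using stirling_error_double(2)[OF nh(2)] by linarith
  moreover have "stirling_error (2 * h) \<le> stirling_error h" using stirling_error_double(1)[OF nh(3)] .
  moreover have "ln (2 * pi) / 2 + (real n + 1 / 2) * a - real n \<le> ln (fact n)"
    using stirling_lower[OF n] by (simp add: stirling_error_def a_def)
  moreover have "ln (real (odd_fact h)) =
      (real K + real n) * (a + c) - (real K + real n) + ln 2 / 2 - (stirling_error h - stirling_error (2 * h))"
    using ln_odd_fact[OF nh(3), unfolded 2] by (simp only: hK)
  ultimately have "ln ?L \<le> ln ?R"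
    unfolding lnR lnL ln_odd_fact[OF nh(2)] 1 by (simp add: field_simps)
  moreover have "?L > 0" "?R > 0" using D odd_fact_pos[of K] odd_fact_pos[of "n * d div 2"] by simp_all
  ultimately show ?thesis by (simp only: ln_le_cancel_iff)
qed

section \<open>The Beta integral\<close>

lemma odd_fact_Gamma: "real (odd_fact k) = 2 ^ k * Gamma (real k + 1 / 2) / sqrt pi"
proof (induction k)
  case 0
  then show ?case by (simp add: odd_fact_def Gamma_one_half_real)
next
  case (Suc k)
  have "real k + 1 / 2 \<notin> \<int>\<^sub>\<le>\<^sub>0" by (auto elim!: nonpos_Ints_cases)
  then have "Gamma (real (Suc k) + 1 / 2) = (real k + 1 / 2) * Gamma (real k + 1 / 2)"
    using Gamma_plus1[of "real k + 1 / 2"] by (simp add: add_ac)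
  moreover have "real (odd_fact (Suc k)) = (2 * (real k + 1 / 2)) * real (odd_fact k)"
    by (simp add: odd_fact_def algebra_simps)
  ultimately show ?case by (simp only: Suc power_Suc times_divide_eq_right mult_ac)
qed

lemma fact_odd_fact_Beta:
  assumes "0 < m" "m \<le> k"
  shows "fact (m - 1) * real (odd_fact (k - m)) / real (odd_fact k) = (1 / 2) ^ m * Beta (real m) (real k + 1 / 2 - real m)"
proof -
  have "Gamma (real m) = (fact (m - 1) :: real)"
    using Gamma_fact[of "m - 1", where 'a = real] assms by (simp add: of_nat_diff)
  moreover have "real k + 1 / 2 - real m = real (k - m) + 1 / 2" using assms by simp
  moreover have "real m + (real (k - m) + 1 / 2) = real k + 1 / 2" using assms by simp
  ultimately have "Beta (real m) (real k + 1 / 2 - real m) =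
      fact (m - 1) * Gamma (real (k - m) + 1 / 2) / Gamma (real k + 1 / 2)"
    by (simp only: Beta_def)
  moreover have "(2::real) ^ k = 2 ^ m * 2 ^ (k - m)" using assms by (simp flip: power_add)
  ultimately show ?thesis
    unfolding odd_fact_Gamma by (simp add: power_one_over)
qed

text \<open>The Beta integral is arranged so that \<open>m\<close> enters only as the exponent of
  \<open>x / (2 * (1 - x))\<close>. Summed over labellings, the integrand becomes their generating
  function at \<open>z = x / (2 * (1 - x))\<close> times a factor free of \<open>m\<close>.\<close>

lemma has_integral_fact_odd_fact:
  assumes "0 < m" "m \<le> k"
  shows "((\<lambda>x. (x / (2 * (1 - x))) ^ m * ((1 - x) powr (real k - 1 / 2) / x)) has_integral
    fact (m - 1) * real (odd_fact (k - m)) / real (odd_fact k)) {0..1}"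
proof -
  have "((\<lambda>x. (1 / 2) ^ m * (x powr (real m - 1) * (1 - x) powr (real k + 1 / 2 - real m - 1)))
      has_integral (1 / 2) ^ m * Beta (real m) (real k + 1 / 2 - real m)) {0..1}"
    using assms by (intro has_integral_mult_right has_integral_Beta_real) auto
  then show ?thesis
    unfolding fact_odd_fact_Beta[OF assms]
  proof (rule has_integral_spike_finite[rotated 2, of _ _ _ "{0, 1}"])
    fix x :: real assume "x \<in> {0..1} - {0, 1}"
    then have x: "0 < x" "x < 1" by auto
    have "x powr (real m - 1) = x ^ m / x" using x by (simp add: powr_diff powr_realpow)
    moreover have "real k + 1 / 2 - real m - 1 = (real k - 1 / 2) - real m" by simp
    then have "(1 - x) powr (real k + 1 / 2 - real m - 1) = (1 - x) powr (real k - 1 / 2) / (1 - x) ^ m"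
      using x by (simp only: powr_diff) (simp add: powr_realpow)
    moreover have "(x / (2 * (1 - x))) ^ m = x ^ m / (2 ^ m * (1 - x) ^ m)"
      by (simp only: power_divide power_mult_distrib)
    ultimately show "(x / (2 * (1 - x))) ^ m * ((1 - x) powr (real k - 1 / 2) / x) =
        (1 / 2) ^ m * (x powr (real m - 1) * (1 - x) powr (real k + 1 / 2 - real m - 1))"
      by (simp add: power_one_over)
  qed simp
qed

section \<open>Laplace's method\<close>

text \<open>In terms of \<open>s\<close> the eigenvalues are \<open>(D - 1) s\<close> and \<open>- L s / R s\<close>, the integration variable is
  \<open>X s = 2 s L s / Q s\<close>, and \<open>G\<close> is the exponent per vertex, normalised to \<open>G 1 = 0\<close>. The assumption
  excludes \<open>3 < D < 4\<close>, where a coefficient of \<open>N\<close> is negative.\<close>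

locale laplace =
  fixes D :: real
  assumes D: "D = 3 \<or> 4 \<le> D"
begin

definition L :: "real \<Rightarrow> real" where "L s = (D - 1) * s - 1"
definition R :: "real \<Rightarrow> real" where "R s = (D - 3) * s + 1"
definition Q :: "real \<Rightarrow> real" where "Q s = 2 * (D - 1) * s\<^sup>2 + (D - 1) * (D - 4) * s + (D - 2)"
definition N :: "real \<Rightarrow> real" where
  "N s = (D - 1) * (D - 3) * (D - 4) * s\<^sup>2 + 2 * (D - 1) * (D - 3) * s + (D - 2)"
definition G :: "real \<Rightarrow> real" where "G s = ln s + (D - 2) / 2 * (ln D + ln (R s) - ln (Q s))"
text \<open>The negative of the second derivative of \<open>G\<close> at 1.\<close>

definition \<kappa> :: real where "\<kappa> = (D - 2) / D"

lemma D3: "3 \<le> D" using D by auto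

lemma D34: "0 \<le> (D - 3) * (D - 4)" using D by auto

lemma \<kappa>_bounds: "1 / 3 \<le> \<kappa>" "\<kappa> \<le> 1"
  using D3 by (auto simp: \<kappa>_def field_simps)

lemma R_pos: "0 \<le> s \<Longrightarrow> 0 < R s"
  using D3 by (simp add: R_def add_nonneg_pos)

lemma Q_pos: "0 \<le> s \<Longrightarrow> 0 < Q s"
proof -
  assume s: "0 \<le> s"
  consider "D = 3" | "4 \<le> D" using D by blast
  then show ?thesis
  proof cases
    case 1
    have "Q s = 3 * s\<^sup>2 + (s - 1)\<^sup>2" by (simp only: Q_def) (simp add: 1 power2_eq_square algebra_simps)
    then show ?thesis by (cases "s = 0") (simp_all add: add_pos_nonneg)
  next
    case 2
    then show ?thesis using s by (simp add: Q_def add_nonneg_pos)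
  qed
qed

text \<open>An equality at \<open>s = 1\<close>, so \<open>1 - s\<close> splits off and the cofactor
  is visibly nonnegative. The later polynomial bounds follow the same pattern: losses away from 1
  are harmless, but at 1 the bounds must be exact.\<close>

lemma Q_le: assumes "0 \<le> s" "s \<le> 1" shows "Q s \<le> D * (D - 2)"
proof -
  have "D * (D - 2) - Q s = (1 - s) * ((D - 1) * (D - 2 + 2 * s))"
    by (simp add: Q_def power2_eq_square algebra_simps)
  then show ?thesis using assms D3 by (smt (verit) mult_nonneg_nonneg)
qed

lemma Q_ge: assumes "0 \<le> s" "s \<le> 1" shows "D * (D - 2) * s\<^sup>2 \<le> Q s"
proof -
  have eq: "Q s - D * (D - 2) * s\<^sup>2 = (1 - s) * ((D\<^sup>2 - 4 * D + 2) * s + (D - 2))"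
    by (simp add: Q_def power2_eq_square algebra_simps)
  consider "D = 3" | "4 \<le> D" using D by blast
  then show ?thesis
  proof cases
    case 1
    have "(1 - s) * ((D\<^sup>2 - 4 * D + 2) * s + (D - 2)) = (1 - s)\<^sup>2"
      using 1 by (simp add: power2_eq_square)
    then show ?thesis using eq by (smt (verit) zero_le_power2)
  next
    case 2
    have "D\<^sup>2 - 4 * D + 2 = D * (D - 4) + 2" by (simp add: power2_eq_square algebra_simps)
    also have "\<dots> \<ge> 0" using 2 by simp
    finally have "(1 - s) * ((D\<^sup>2 - 4 * D + 2) * s + (D - 2)) \<ge> 0" using assms D3 by simp
    then show ?thesis using eq by simp
  qed
qed

text \<open>For \<open>4 \<le> D\<close> the factors are bounded separately. For
  \<open>D = 3\<close> the bound \<open>Q s \<le> D * (D - 2) * s\<^sup>2\<close> fails, since the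
  difference is \<open>- (s - 1)\<^sup>2\<close>, and only the product can be estimated.\<close>

lemma QR_le: assumes "1 \<le> s" shows "Q s * R s \<le> D * (D - 2)\<^sup>2 * s ^ 3"
proof -
  consider "D = 3" | "4 \<le> D" using D by blast
  then show ?thesis
  proof cases
    case 1
    have "D * (D - 2)\<^sup>2 * s ^ 3 - Q s * R s = (s - 1) * (2 * s\<^sup>2 + s * (s - 1) + 1)"
      by (simp only: Q_def R_def) (simp add: 1 power2_eq_square power3_eq_cube algebra_simps)
    also have "\<dots> \<ge> 0" using assms by (intro mult_nonneg_nonneg add_nonneg_nonneg) auto
    finally show ?thesis by simp
  next
    case 2
    have "D * (D - 2) * s\<^sup>2 - Q s = (s - 1) * ((D * (D - 4) + 2) * s + (D - 2))"
      by (simp add: Q_def power2_eq_square algebra_simps)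
    also have "\<dots> \<ge> 0" using assms 2 by (intro mult_nonneg_nonneg add_nonneg_nonneg) auto
    finally have 1: "Q s \<le> D * (D - 2) * s\<^sup>2" by simp
    have "R s \<le> (D - 2) * s" using assms by (simp add: R_def algebra_simps)
    then have "Q s * R s \<le> (D * (D - 2) * s\<^sup>2) * ((D - 2) * s)"
      using 1 assms 2 Q_pos[of s] R_pos[of s] by (intro mult_mono) auto
    then show ?thesis by (simp add: power2_eq_square power3_eq_cube mult_ac)
  qed
qed

lemma N_ge_small: assumes "0 \<le> s" "s \<le> 1" shows "(D - 2) ^ 3 * s\<^sup>2 \<le> N s"
proof -
  have "N s - (D - 2) ^ 3 * s\<^sup>2 = 2 * ((D - 1) * (D - 3)) * (s * (1 - s)) + (D - 2) * ((1 - s) * (1 + s))"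
    by (simp add: N_def power2_eq_square power3_eq_cube algebra_simps)
  also have "\<dots> \<ge> 0" using assms D3 by (intro mult_nonneg_nonneg add_nonneg_nonneg) auto
  finally show ?thesis by simp
qed

lemma N_ge_large: assumes "1 \<le> s" shows "(D - 2) ^ 3 \<le> N s"
proof -
  have "N s - (D - 2) ^ 3 = (D - 1) * ((D - 3) * (D - 4)) * ((s - 1) * (s + 1)) + 2 * ((D - 1) * (D - 3)) * (s - 1)"
    by (simp add: N_def power2_eq_square power3_eq_cube algebra_simps)
  moreover have "0 \<le> (D - 1) * ((D - 3) * (D - 4))" using D3 by (intro mult_nonneg_nonneg[OF _ D34]) simp
  then have "0 \<le> (D - 1) * ((D - 3) * (D - 4)) * ((s - 1) * (s + 1))"
    using assms by (intro mult_nonneg_nonneg[of "(D - 1) * ((D - 3) * (D - 4))"]) auto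
  moreover have "0 \<le> 2 * ((D - 1) * (D - 3)) * (s - 1)" using assms D3 by simp
  ultimately show ?thesis by linarith
qed

text \<open>The numerator over the common denominator has the exact factor \<open>1 - s\<close>;
  \<open>N\<close> is defined as its cofactor. As \<open>N\<close> is positive for
  \<open>0 < s\<close>, the point 1 is the only critical one.\<close>

lemma G_deriv:
  assumes s: "0 < s"
  shows "(G has_real_derivative (1 - s) * (N s / (s * Q s * R s))) (at s)"
proof -
  have QR: "Q s > 0" "R s > 0" using s Q_pos R_pos by auto
  have "(G has_real_derivative 1 / s + (D - 2) / 2 * ((D - 3) / R s - (4 * (D - 1) * s + (D - 1) * (D - 4)) / Q s)) (at s)"
    unfolding G_def[abs_def] using s QR unfolding Q_def R_def
    by (auto intro!: derivative_eq_intros simp: power2_eq_square)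
  moreover have "Q s * R s * 2 + (D - 2) * s * ((D - 3) * Q s - (4 * (D - 1) * s + (D - 1) * (D - 4)) * R s)
      = 2 * ((1 - s) * N s)"
    by (simp add: Q_def R_def N_def power2_eq_square algebra_simps)
  then have "1 / s + (D - 2) / 2 * ((D - 3) / R s - (4 * (D - 1) * s + (D - 1) * (D - 4)) / Q s) =
      (1 - s) * (N s / (s * Q s * R s))"
    using s QR by (simp add: divide_simps) (simp add: algebra_simps)
  ultimately show ?thesis by simp
qed

lemma G_1: "G 1 = 0"
proof -
  have "Q 1 = D * (D - 2)" "R 1 = D - 2" by (simp_all add: Q_def R_def algebra_simps)
  then show ?thesis using D3 by (simp add: G_def ln_mult_pos)
qed

text \<open>The derivative is at least \<open>\<kappa> * y * (1 - y)\<close>, and the bound is the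
  integral of this from \<open>s\<close> to 1.\<close>

lemma G_le_small:
  assumes s: "0 < s" "s \<le> 1"
  shows "G s \<le> - \<kappa> * ((1 - s)\<^sup>2 * (1 + 2 * s) / 6)"
proof -
  let ?f = "\<lambda>s. G s + \<kappa> * ((1 - s)\<^sup>2 * (1 + 2 * s) / 6)"
  have "?f s \<le> ?f 1"
  proof (rule DERIV_nonneg_imp_nondecreasing[OF s(2)])
    fix y assume y: "s \<le> y" "y \<le> 1"
    then have y0: "0 < y" using s by simp
    have QR: "Q y > 0" "R y > 0" using y0 Q_pos R_pos by auto
    have "((\<lambda>s. (1 - s)\<^sup>2 * (1 + 2 * s) / 6) has_real_derivative - (y * (1 - y))) (at y)"
      by (auto intro!: derivative_eq_intros simp: power2_eq_square field_simps)
    from DERIV_add[OF G_deriv[OF y0] DERIV_cmult[OF this]]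
    have "(?f has_real_derivative (1 - y) * (N y / (y * Q y * R y)) + \<kappa> * (- (y * (1 - y)))) (at y)" .
    moreover have "\<kappa> * y \<le> N y / (y * Q y * R y)"
    proof -
      have "R y \<le> D - 2" using y D3 mult_left_mono[of y 1 "D - 3"] by (simp add: R_def)
      then have "Q y * R y \<le> (D * (D - 2)) * (D - 2)"
        using Q_le[of y] y y0 QR D3 by (intro mult_mono) auto
      then have "\<kappa> * y\<^sup>2 * (Q y * R y) \<le> \<kappa> * y\<^sup>2 * ((D * (D - 2)) * (D - 2))"
        using \<kappa>_bounds by (intro mult_left_mono) auto
      also have "\<dots> = (D - 2) ^ 3 * y\<^sup>2" using D3 by (simp add: \<kappa>_def power3_eq_cube)
      also have "\<dots> \<le> N y" using N_ge_small y y0 by simp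
      finally show ?thesis using QR y0 by (simp add: le_divide_eq power2_eq_square mult_ac)
    qed
    then have "0 \<le> (1 - y) * (N y / (y * Q y * R y) - \<kappa> * y)" using y by simp
    ultimately show "\<exists>z. (?f has_real_derivative z) (at y) \<and> 0 \<le> z"
      by (intro exI conjI) (auto simp: algebra_simps)
  qed
  then show ?thesis by (simp add: G_1)
qed

text \<open>The derivative is at most \<open>- \<kappa> * (y - 1) / y ^ 4\<close>, and the bound is
  the integral of this from 1 to \<open>s\<close>. The power of \<open>y\<close> matches the growth
  of \<open>Q * R\<close> allowed by \<open>QR_le\<close>.\<close>

lemma G_le_large:
  assumes s: "1 \<le> s"
  shows "G s \<le> - \<kappa> * ((s - 1)\<^sup>2 * (s + 2) / (6 * s ^ 3))"
proof -
  let ?f = "\<lambda>s. G s + \<kappa> * (1 / 6 - 1 / (2 * s\<^sup>2) + 1 / (3 * s ^ 3))"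
  have "?f s \<le> ?f 1"
  proof (rule DERIV_nonpos_imp_nonincreasing[OF s])
    fix y assume y: "1 \<le> y" "y \<le> s"
    then have y0: "0 < y" by simp
    have QR: "Q y > 0" "R y > 0" using y0 Q_pos R_pos by auto
    have "((\<lambda>s. 1 / 6 - 1 / (2 * s\<^sup>2) + 1 / (3 * s ^ 3)) has_real_derivative 1 / y ^ 3 - 1 / y ^ 4) (at y)"
      using y0 by (auto intro!: derivative_eq_intros simp: field_simps eval_nat_numeral)
    from DERIV_add[OF G_deriv[OF y0] DERIV_cmult[OF this]]
    have der: "(?f has_real_derivative (1 - y) * (N y / (y * Q y * R y)) + \<kappa> * (1 / y ^ 3 - 1 / y ^ 4)) (at y)" .
    have eq: "1 / y ^ 3 - 1 / y ^ 4 = (y - 1) * (1 / y ^ 4)"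
      using y0 by (simp add: field_simps eval_nat_numeral)
    have "\<kappa> * (1 / y ^ 4) \<le> N y / (y * Q y * R y)"
    proof -
      have "\<kappa> * (Q y * R y) \<le> \<kappa> * (D * (D - 2)\<^sup>2 * y ^ 3)"
        using QR_le[OF y(1)] \<kappa>_bounds by (intro mult_left_mono) auto
      also have "\<dots> = (D - 2) ^ 3 * y ^ 3" using D3 by (simp add: \<kappa>_def power3_eq_cube power2_eq_square)
      also have "\<dots> \<le> N y * y ^ 3" using N_ge_large y by (intro mult_right_mono) auto
      finally have "\<kappa> * (Q y * R y) \<le> N y * y ^ 3" .
      then show ?thesis using QR y0 by (simp add: divide_simps eval_nat_numeral mult_ac)
    qed
    then have le: "(1 - y) * (N y / (y * Q y * R y) - \<kappa> * (1 / y ^ 4)) \<le> 0" using y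
      by (intro mult_nonpos_nonneg) auto
    have ring: "(1 - y) * a + \<kappa> * ((y - 1) * b) = (1 - y) * (a - \<kappa> * b)" for a b
      by (simp add: algebra_simps)
    show "\<exists>z. (?f has_real_derivative z) (at y) \<and> z \<le> 0"
      using der[unfolded eq ring] le by (intro exI conjI)
  qed
  moreover have "1 / 6 - 1 / (2 * s\<^sup>2) + 1 / (3 * s ^ 3) = (s - 1)\<^sup>2 * (s + 2) / (6 * s ^ 3)"
    using s by (simp add: divide_simps) (simp add: eval_nat_numeral algebra_simps)
  ultimately show ?thesis by (simp add: G_1)
qed

end

section \<open>The substitution \<open>x = X s\<close> and the integrand away from its peak\<close>

context laplace
begin

definition T :: "real \<Rightarrow> real" where "T s = (D - 1) * (D - 3) * s\<^sup>2 + 2 * (D - 1) * s - 1"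
definition X :: "real \<Rightarrow> real" where "X s = 2 * s * L s / Q s"
definition X' :: "real \<Rightarrow> real" where "X' s = 2 * (D - 2) * T s / (Q s)\<^sup>2"

lemma L_pos_imp: "0 < L s \<Longrightarrow> 0 < s"
  using D3 by (auto simp: L_def zero_less_mult_iff dest: less_trans[OF zero_less_one])

lemma X_pos: "0 < L s \<Longrightarrow> 0 < X s"
  using L_pos_imp[of s] Q_pos[of s] by (simp add: X_def)

lemma one_minus_X: "0 \<le> s \<Longrightarrow> 1 - X s = (D - 2) * R s / Q s"
proof -
  assume "0 \<le> s"
  then have "Q s > 0" by (rule Q_pos)
  moreover have "Q s - 2 * s * L s = (D - 2) * R s"
    by (simp add: Q_def L_def R_def power2_eq_square algebra_simps)
  ultimately show ?thesis by (simp add: X_def diff_divide_distrib[symmetric] divide_simps)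
qed

lemma X_less_1: "0 \<le> s \<Longrightarrow> X s < 1"
  using one_minus_X[of s] R_pos[of s] Q_pos[of s] D3 by (smt (verit) divide_pos_pos mult_pos_pos)

lemma X_deriv:
  assumes "0 \<le> s"
  shows "(X has_real_derivative X' s) (at s)"
proof -
  have Q: "Q s > 0" using assms by (rule Q_pos)
  have "((\<lambda>s. 2 * s * L s) has_real_derivative (4 * (D - 1) * s - 2)) (at s)"
    unfolding L_def by (auto intro!: derivative_eq_intros simp: algebra_simps)
  moreover have "(Q has_real_derivative (4 * (D - 1) * s + (D - 1) * (D - 4))) (at s)"
    unfolding Q_def[abs_def] by (auto intro!: derivative_eq_intros)
  ultimately have "(X has_real_derivative ((4 * (D - 1) * s - 2) * Q s
      - 2 * s * L s * (4 * (D - 1) * s + (D - 1) * (D - 4))) / (Q s * Q s)) (at s)"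
    unfolding X_def[abs_def] using Q by (intro DERIV_divide) auto
  moreover have "(4 * (D - 1) * s - 2) * Q s - 2 * s * L s * (4 * (D - 1) * s + (D - 1) * (D - 4))
      = 2 * (D - 2) * T s"
    by (simp add: Q_def L_def T_def power2_eq_square algebra_simps)
  ultimately show ?thesis by (simp add: X'_def power2_eq_square)
qed

lemma T_pos: "0 \<le> L s \<Longrightarrow> 0 < T s"
proof -
  assume "0 \<le> L s"
  then have "0 < 2 * ((D - 1) * s) - 1" by (simp add: L_def)
  moreover have "0 \<le> (D - 1) * (D - 3) * s\<^sup>2" using D3 by simp
  ultimately have "0 < (D - 1) * (D - 3) * s\<^sup>2 + (2 * ((D - 1) * s) - 1)" by (rule add_nonneg_pos[rotated])
  also have "\<dots> = T s" by (simp add: T_def algebra_simps)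
  finally show ?thesis .
qed

lemma X_mono:
  assumes "0 \<le> L a" "a \<le> b"
  shows "X a \<le> X b"
proof (rule DERIV_nonneg_imp_nondecreasing[OF assms(2)])
  fix y assume y: "a \<le> y" "y \<le> b"
  have "L a \<le> L y" using y D3 by (simp add: L_def mult_left_mono)
  then have Ly: "0 \<le> L y" using assms by simp
  then have "0 \<le> (D - 1) * y" by (simp add: L_def)
  then have "0 \<le> y" using D3 by (simp add: zero_le_mult_iff)
  then show "\<exists>z. (X has_real_derivative z) (at y) \<and> 0 \<le> z"
    using X_deriv[of y] T_pos[OF Ly] D3 by (intro exI[of _ "X' y"]) (simp add: X'_def)
qed

lemma X_surj:
  assumes x: "0 < x" "x < 1"
  shows "\<exists>s. 0 < L s \<and> X s = x"
proof -
  define a where "a = 1 / (D - 1)"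
  \<comment> \<open>For \<open>1 \<le> b\<close> the bounds on \<open>R b\<close> and
    \<open>Q b\<close> give \<open>1 - X b \<le> D / b\<close>, so this \<open>b\<close> is large
    enough for \<open>x \<le> X b\<close>.\<close>
  define b where "b = max 1 (D / (1 - x))"
  have La: "L a = 0" using D3 by (simp add: L_def a_def)
  have a: "0 < a" "a \<le> 1" using D3 by (simp_all add: a_def)
  have b: "1 \<le> b" "D \<le> b * (1 - x)" using x by (simp_all add: b_def max_def field_simps)
  have Qb: "(D - 1) * b\<^sup>2 \<le> Q b"
  proof -
    have "Q b - (D - 1) * b\<^sup>2 = (D - 1) * (b * (b - 1)) + (D - 1) * (D - 3) * b + (D - 2)"
      by (simp add: Q_def power2_eq_square algebra_simps)
    then show ?thesis using b D3 by (smt (verit) mult_nonneg_nonneg)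
  qed
  have "(D - 2) * R b \<le> (1 - x) * ((D - 1) * b\<^sup>2)"
  proof -
    have "R b \<le> (D - 2) * b" using b by (simp add: R_def algebra_simps)
    then have "(D - 2) * R b \<le> (D - 2) * ((D - 2) * b)" using D3 by (intro mult_left_mono) auto
    also have "\<dots> \<le> (D - 1) * (D * b)"
      using D3 b mult_right_mono[of "(D - 2) * (D - 2)" "(D - 1) * D" b] by (simp add: algebra_simps)
    also have "\<dots> \<le> (D - 1) * ((b * (1 - x)) * b)" using b D3 by (intro mult_left_mono mult_right_mono) auto
    finally show ?thesis by (simp add: power2_eq_square mult_ac)
  qed
  also have "\<dots> \<le> (1 - x) * Q b" using x by (intro mult_left_mono Qb) simp
  finally have "(D - 2) * R b \<le> (1 - x) * Q b" .
  then have "1 - X b \<le> 1 - x" using b Q_pos[of b] by (simp add: one_minus_X divide_le_eq)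
  then have "x \<le> X b" by simp
  moreover have "X a \<le> x" using x by (simp add: X_def La)
  moreover have "isCont X s" if "a \<le> s" for s using X_deriv[of s] a that by (intro DERIV_isCont) auto
  ultimately obtain s where s: "a \<le> s" "s \<le> b" "X s = x"
    using IVT[of X a x b] a b by auto
  have "s \<noteq> a" using s x by (auto simp: X_def La)
  then have "a < s" using s by simp
  then have "0 < L s" using D3 by (simp add: a_def L_def field_simps)
  then show ?thesis using s by blast
qed

text \<open>The height of the peak: the value at \<open>s = 1\<close> of the left-hand side of
  \<open>exp_G\<close>.\<close>

definition A0 :: "nat \<Rightarrow> real" where
  "A0 n = (D - 1) ^ n * ((D - 2) / D) powr (real n * (D - 2) / 2)"

lemma A0_pos: "0 < A0 n"
  using D3 by (simp add: A0_def)

lemma exp_G: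
  assumes s: "0 < s"
  shows "((D - 1) * s) ^ n * (1 - X s) powr (real n * (D - 2) / 2) = A0 n * exp (real n * G s)"
proof -
  have pos: "Q s > 0" "R s > 0" using s Q_pos R_pos by auto
  have eq: "1 - X s = (D - 2) / D * (D * R s / Q s)" using one_minus_X[of s] s D3 by simp
  then have 1: "(1 - X s) powr (real n * (D - 2) / 2) =
      ((D - 2) / D) powr (real n * (D - 2) / 2) * (D * R s / Q s) powr (real n * (D - 2) / 2)"
    unfolding eq by (intro powr_mult)
  have "(D * R s / Q s) powr (real n * (D - 2) / 2) = exp (real n * ((D - 2) / 2 * (ln D + ln (R s) - ln (Q s))))"
    using pos D3 by (simp add: powr_def ln_mult_pos ln_div)
  moreover have "s ^ n = exp (real n * ln s)" using s by (simp add: exp_of_nat_mult)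
  ultimately show ?thesis unfolding 1 A0_def G_def
    by (simp add: power_mult_distrib distrib_left exp_add)
qed

lemma R_ge_1: "0 \<le> s \<Longrightarrow> 1 \<le> R s"
  using D3 by (simp add: R_def)

lemma ratio_le:
  assumes "0 < L s"
  shows "L s / R s \<le> (D - 1) * s" "L s / R s \<le> L s"
proof -
  have s: "0 < s" using L_pos_imp[OF assms] .
  show "L s / R s \<le> L s" using R_ge_1[of s] s assms by (simp add: divide_le_eq mult_le_cancel_left1)
  then show "L s / R s \<le> (D - 1) * s" by (simp add: L_def)
qed

text \<open>The second eigenvalue is smaller than the first by a fixed factor, so its power costs
  only \<open>(3 / 4) ^ n\<close>. For \<open>D = 3\<close> the claim is precisely
  \<open>s \<le> 2\<close>, the right end of the middle range.\<close>

lemma ratio_le_middle: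
  assumes s: "3 / 4 \<le> s" "s \<le> 2"
  shows "L s / R s \<le> 3 / 4 * ((D - 1) * s)"
proof -
  have R: "R s > 0" using s R_pos by simp
  have "L s \<le> 3 / 4 * ((D - 1) * s) * R s"
  proof (cases "D = 3")
    case True
    show ?thesis unfolding L_def R_def using s by (simp add: True)
  next
    case False
    then have D4: "4 \<le> D" using D by blast
    then have "1 * s \<le> (D - 3) * s" using s by (intro mult_right_mono) auto
    then have "4 / 3 \<le> R s" unfolding R_def using s by linarith
    then have "3 / 4 * ((D - 1) * s) * (4 / 3) \<le> 3 / 4 * ((D - 1) * s) * R s"
      using D4 s by (intro mult_left_mono) auto
    moreover have "3 / 4 * ((D - 1) * s) * (4 / 3) = (D - 1) * s" by simp
    ultimately show ?thesis unfolding L_def by linarith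
  qed
  then show ?thesis using R by (simp add: divide_le_eq)
qed

text \<open>The constant is the product of \<open>1 / 3 \<le> \<kappa>\<close> and
  \<open>1 / 96 = (1 / 4)\<^sup>2 / 6\<close>, the latter coming from the end
  \<open>s = 3 / 4\<close>.\<close>

lemma G_outer:
  assumes "0 < s" "s \<le> 3 / 4 \<or> 2 \<le> s"
  shows "G s \<le> - 1 / 288"
proof -
  have *: "- \<kappa> * h \<le> - 1 / 288" if "1 / 96 \<le> h" for h
  proof -
    have "1 / 3 * (1 / 96) \<le> \<kappa> * h" using \<kappa>_bounds that by (intro mult_mono) auto
    then show ?thesis by simp
  qed
  from assms(2) show ?thesis
  proof
    assume s: "s \<le> 3 / 4"
    have "(1 / 4)\<^sup>2 \<le> (1 - s)\<^sup>2" using s by (intro power_mono) auto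
    then have "(1 / 4)\<^sup>2 * 1 \<le> (1 - s)\<^sup>2 * (1 + 2 * s)" using assms by (intro mult_mono) auto
    then have "1 / 96 \<le> (1 - s)\<^sup>2 * (1 + 2 * s) / 6" by (simp add: power2_eq_square)
    then show ?thesis using G_le_small[of s] *[of "(1 - s)\<^sup>2 * (1 + 2 * s) / 6"] s assms by linarith
  next
    assume s: "2 \<le> s"
    have "(s / 2)\<^sup>2 \<le> (s - 1)\<^sup>2" using s by (intro power_mono) auto
    then have "(s / 2)\<^sup>2 * s \<le> (s - 1)\<^sup>2 * (s + 2)" using s by (intro mult_mono) auto
    then have "s ^ 3 / 4 \<le> (s - 1)\<^sup>2 * (s + 2)" by (simp add: power2_eq_square power3_eq_cube)
    moreover have pos: "0 < s ^ 3" using s by simp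
    ultimately have "1 / 96 * (6 * s ^ 3) \<le> (s - 1)\<^sup>2 * (s + 2)" by linarith
    then have "1 / 96 \<le> (s - 1)\<^sup>2 * (s + 2) / (6 * s ^ 3)" using pos by (simp only: le_divide_eq) simp
    then show ?thesis using G_le_large[of s] *[of "(s - 1)\<^sup>2 * (s + 2) / (6 * s ^ 3)"] s by linarith
  qed
qed

text \<open>The term \<open>- 1\<close> is the third eigenvalue's contribution 1 minus the 2 of the
  labellings without new vertices, which are treated apart.\<close>

definition integrand :: "nat \<Rightarrow> real \<Rightarrow> real" where
  "integrand n s = (((D - 1) * s) ^ n + (- L s / R s) ^ n - 1) *
     ((1 - X s) powr (real n * (D - 2) / 2 - 1 / 2) / X s)"

lemma power_diff_le:
  fixes a :: real
  assumes "1 \<le> a"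
  shows "a ^ n - 1 \<le> real n * (a - 1) * a ^ n"
proof (induction n)
  case (Suc n)
  have "a ^ Suc n - 1 = a * (a ^ n - 1) + (a - 1)" by (simp add: algebra_simps)
  also have "\<dots> \<le> a * (real n * (a - 1) * a ^ n) + (a - 1) * a ^ Suc n"
  proof (intro add_mono mult_left_mono Suc)
    have "1 \<le> a ^ Suc n" using assms by (rule one_le_power)
    then show "a - 1 \<le> (a - 1) * a ^ Suc n" using assms mult_left_mono[of 1 "a ^ Suc n" "a - 1"] by simp
  qed (use assms in auto)
  also have "\<dots> = real (Suc n) * (a - 1) * a ^ Suc n" by (simp add: algebra_simps)
  finally show ?case .
qed simp

text \<open>Where \<open>L s\<close> tends to 0 the eigenvalues tend to 1 and 0, the numerator
  vanishes and so does \<open>X s\<close>. The second bound exhibits the factor \<open>L s\<close>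
  that makes up for dividing by \<open>X s\<close>; for large \<open>s\<close> the first is
  enough.\<close>

lemma numerator_bounds:
  assumes L: "0 < L s" and n: "0 < n"
  shows "((D - 1) * s) ^ n + (- L s / R s) ^ n - 1 \<le> 2 * ((D - 1) * s) ^ n"
    and "((D - 1) * s) ^ n + (- L s / R s) ^ n - 1 \<le> (real n + 1) * L s * ((D - 1) * s) ^ n"
proof -
  define a where "a = (D - 1) * s"
  define b where "b = L s / R s"
  have s: "0 < s" using L_pos_imp[OF L] .
  have a: "1 \<le> a" "L s = a - 1" using L by (simp_all add: a_def L_def)
  have b: "0 \<le> b" "b \<le> a" "b \<le> a - 1"
    using ratio_le[OF L] R_pos[of s] s L a by (simp_all add: a_def b_def)
  have "\<bar>- L s / R s\<bar> = b" using L R_pos[of s] s by (simp add: b_def)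
  then have 1: "(- L s / R s) ^ n \<le> b ^ n"
    using abs_ge_self[of "(- L s / R s) ^ n"] unfolding power_abs by simp
  have "b ^ n \<le> a ^ n" using b by (intro power_mono) auto
  then show "((D - 1) * s) ^ n + (- L s / R s) ^ n - 1 \<le> 2 * ((D - 1) * s) ^ n"
    using 1 by (simp add: a_def[symmetric])
  have "b ^ n = b * b ^ (n - 1)" using n by (simp add: power_eq_if)
  also have "\<dots> \<le> (a - 1) * a ^ n"
  proof (intro mult_mono)
    have "b ^ (n - 1) \<le> a ^ (n - 1)" using b by (intro power_mono) auto
    also have "\<dots> \<le> a ^ n" using a by (intro power_increasing) auto
    finally show "b ^ (n - 1) \<le> a ^ n" .
  qed (use b a in auto)
  finally show "((D - 1) * s) ^ n + (- L s / R s) ^ n - 1 \<le> (real n + 1) * L s * ((D - 1) * s) ^ n"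
    using 1 power_diff_le[OF a(1), of n] unfolding a(2) a_def[symmetric] by (simp add: algebra_simps)
qed

lemma integrand_factor:
  assumes "0 < L s"
  shows "((D - 1) * s) ^ n * ((1 - X s) powr (real n * (D - 2) / 2 - 1 / 2) / X s) =
    A0 n * exp (real n * G s) * ((1 - X s) powr (- (1 / 2)) / X s)"
proof -
  have s: "0 < s" using L_pos_imp[OF assms] .
  have "(1 - X s) powr (real n * (D - 2) / 2 - 1 / 2) =
      (1 - X s) powr (real n * (D - 2) / 2) * (1 - X s) powr (- (1 / 2))"
    by (subst powr_add[symmetric]) simp
  then have "((D - 1) * s) ^ n * ((1 - X s) powr (real n * (D - 2) / 2 - 1 / 2) / X s) =
      (((D - 1) * s) ^ n * (1 - X s) powr (real n * (D - 2) / 2)) * ((1 - X s) powr (- (1 / 2)) / X s)"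
    by (simp only: times_divide_eq_right mult.assoc)
  then show ?thesis by (simp only: exp_G[OF s])
qed

lemma integrand_outer:
  assumes L: "0 < L s" and n: "0 < n" and s: "s \<le> 3 / 4 \<or> 2 \<le> s"
  shows "integrand n s \<le> A0 n * (2 * (real n + 1) * D ^ 3 * exp (- real n / 288)) * (1 - X s) powr (- (1 / 2))"
proof -
  have s0: "0 < s" using L_pos_imp[OF L] .
  have Q: "Q s > 0" using s0 Q_pos by simp
  have X: "0 < X s" using X_pos[OF L] .
  have "\<exists>c. ((D - 1) * s) ^ n + (- L s / R s) ^ n - 1 \<le> c * ((D - 1) * s) ^ n \<and> 0 \<le> c \<and>
      c / X s \<le> 2 * (real n + 1) * D ^ 3"
  proof (cases "2 \<le> s")
    case True
    have "Q s \<le> D * (2 * s * L s)"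
    proof -
      have "D * (2 * s * L s) - Q s = 2 * (D - 1)\<^sup>2 * (s * (s - 1)) + (D\<^sup>2 - D - 2) * (s - 1) + (D\<^sup>2 - 2 * D)"
        by (simp add: Q_def L_def power2_eq_square algebra_simps)
      moreover have "D\<^sup>2 - D - 2 = (D - 2) * (D + 1)" "D\<^sup>2 - 2 * D = D * (D - 2)"
        by (simp_all add: power2_eq_square algebra_simps)
      ultimately show ?thesis using True D3 by (smt (verit) mult_nonneg_nonneg zero_le_power2)
    qed
    then have "1 / X s \<le> D" using L s0 Q by (simp add: X_def divide_le_eq mult_ac)
    moreover have "D \<le> (real n + 1) * D ^ 3"
    proof -
      have "1 * D \<le> (real n + 1) * D ^ 3"
        using D3 power_increasing[of 1 3 D] by (intro mult_mono) auto
      then show ?thesis by simp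
    qed
    ultimately have "2 * (1 / X s) \<le> 2 * ((real n + 1) * D ^ 3)" by linarith
    then have "2 / X s \<le> 2 * (real n + 1) * D ^ 3"
      by (simp only: times_divide_eq_right mult_1_right mult.assoc)
    then show ?thesis using numerator_bounds(1)[OF L n] by (intro exI[of _ 2]) auto
  next
    case False
    then have s1: "s \<le> 3 / 4" using s by simp
    have "1 \<le> (D - 1) * s" using L by (simp add: L_def)
    have "L s / X s = Q s / (2 * s)" using L s0 Q by (simp add: X_def)
    also have "\<dots> \<le> D * (D - 2) / (2 * s)"
      using Q_le[of s] s0 s1 by (intro divide_right_mono) auto
    also have "\<dots> = D * (D - 2) * (1 / (2 * s))" by simp
    also have "\<dots> \<le> D * (D - 2) * (D - 1)"
      using \<open>1 \<le> (D - 1) * s\<close> s0 D3 by (intro mult_left_mono) (auto simp: divide_le_eq)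
    also have "\<dots> \<le> D * D * D" using D3 by (intro mult_mono) auto
    finally have "L s / X s \<le> D ^ 3" by (simp add: power3_eq_cube)
    then have "(real n + 1) * (L s / X s) \<le> (real n + 1) * D ^ 3" by (intro mult_left_mono) auto
    also have "\<dots> \<le> 2 * (real n + 1) * D ^ 3" using D3 by simp
    finally show ?thesis using numerator_bounds(2)[OF L n] L by (intro exI[of _ "(real n + 1) * L s"]) auto
  qed
  then obtain c where c: "((D - 1) * s) ^ n + (- L s / R s) ^ n - 1 \<le> c * ((D - 1) * s) ^ n" "0 \<le> c"
    "c / X s \<le> 2 * (real n + 1) * D ^ 3" by blast
  have "integrand n s \<le> c * ((D - 1) * s) ^ n * ((1 - X s) powr (real n * (D - 2) / 2 - 1 / 2) / X s)"
    unfolding integrand_def using c X by (intro mult_right_mono) auto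
  also have "\<dots> = c / X s * (A0 n * exp (real n * G s)) * (1 - X s) powr (- (1 / 2))"
  proof -
    have "c * p * q = c * (p * q)" for p q :: real by simp
    then show ?thesis by (simp only: integrand_factor[OF L]) simp
  qed
  also have "\<dots> \<le> (2 * (real n + 1) * D ^ 3) * (A0 n * exp (- real n / 288)) * (1 - X s) powr (- (1 / 2))"
  proof (intro mult_right_mono mult_mono)
    show "exp (real n * G s) \<le> exp (- real n / 288)"
      using mult_left_mono[OF G_outer[OF s0 s], of "real n"] by simp
  qed (use c A0_pos[of n] D3 in \<open>auto intro: less_imp_le\<close>)
  finally show ?thesis by (simp add: mult_ac)
qed

end

section \<open>Gaussian integrals and a perturbed exponential\<close>

lemma gaussian_integral_le:
  fixes a b c m :: real
  assumes "0 < c"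
  shows "(\<lambda>t. exp (- c * (t - m)\<^sup>2)) integrable_on {a..b}"
    and "integral {a..b} (\<lambda>t. exp (- c * (t - m)\<^sup>2)) \<le> sqrt (pi / c)"
proof -
  define \<sigma> where "\<sigma> = sqrt (1 / (2 * c))"
  have \<sigma>: "\<sigma> > 0" "\<sigma>\<^sup>2 = 1 / (2 * c)" using assms by (simp_all add: \<sigma>_def)
  have eq: "exp (- c * (t - m)\<^sup>2) = sqrt (pi / c) * normal_density m \<sigma> t" for t
    using assms unfolding normal_density_def \<sigma>(2) by (simp add: real_sqrt_divide mult.commute)
  have "(normal_density m \<sigma> has_integral 1) UNIV"
    using has_integral_integral_lborel[OF integrable_normal_density[OF \<sigma>(1), of m]]
      integral_normal_density[OF \<sigma>(1), of m] by simp
  from has_integral_mult_right[OF this, of "sqrt (pi / c)"]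
  have hi: "((\<lambda>t. exp (- c * (t - m)\<^sup>2)) has_integral sqrt (pi / c)) UNIV"
    by (simp only: eq mult_1_right)
  show int: "(\<lambda>t. exp (- c * (t - m)\<^sup>2)) integrable_on {a..b}"
    by (intro integrable_continuous_real continuous_intros)
  show "integral {a..b} (\<lambda>t. exp (- c * (t - m)\<^sup>2)) \<le> sqrt (pi / c)"
    using integral_subset_le[OF _ int has_integral_integrable[OF hi]] integral_unique[OF hi] by simp
qed

lemma abs_gaussian_integral_le:
  fixes a b c m :: real
  assumes c: "0 < c" and ab: "a \<le> m" "m \<le> b"
  shows "(\<lambda>t. \<bar>t - m\<bar> * exp (- c * (t - m)\<^sup>2)) integrable_on {a..b}"
    and "integral {a..b} (\<lambda>t. \<bar>t - m\<bar> * exp (- c * (t - m)\<^sup>2)) \<le> 1 / c"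
proof -
  let ?f = "\<lambda>t. \<bar>t - m\<bar> * exp (- c * (t - m)\<^sup>2)"
  show int: "?f integrable_on {a..b}"
    by (intro integrable_continuous_real continuous_intros)
  have 1: "((\<lambda>t. (m - t) * exp (- c * (t - m)\<^sup>2)) has_integral
      (exp (- c * (m - m)\<^sup>2) / (2 * c) - exp (- c * (a - m)\<^sup>2) / (2 * c))) {a..m}"
    by (rule fundamental_theorem_of_calculus[OF ab(1)])
       (use c in \<open>auto intro!: derivative_eq_intros simp: has_real_derivative_iff_has_vector_derivative[symmetric] field_simps\<close>)
  have 2: "((\<lambda>t. (t - m) * exp (- c * (t - m)\<^sup>2)) has_integral
      (- exp (- c * (b - m)\<^sup>2) / (2 * c) - (- exp (- c * (m - m)\<^sup>2) / (2 * c)))) {m..b}"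
    by (rule fundamental_theorem_of_calculus[OF ab(2)])
       (use c in \<open>auto intro!: derivative_eq_intros simp: has_real_derivative_iff_has_vector_derivative[symmetric] field_simps\<close>)
  have "integral {a..m} ?f = integral {a..m} (\<lambda>t. (m - t) * exp (- c * (t - m)\<^sup>2))"
    by (intro integral_cong) auto
  also have "\<dots> \<le> 1 / (2 * c)" using integral_unique[OF 1] c by (simp add: diff_divide_distrib[symmetric] divide_right_mono)
  finally have i1: "integral {a..m} ?f \<le> 1 / (2 * c)" .
  have "integral {m..b} ?f = integral {m..b} (\<lambda>t. (t - m) * exp (- c * (t - m)\<^sup>2))"
    by (intro integral_cong) auto
  also have "\<dots> \<le> 1 / (2 * c)" using integral_unique[OF 2] c by (simp add: diff_divide_distrib[symmetric] divide_right_mono)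
  finally have i2: "integral {m..b} ?f \<le> 1 / (2 * c)" .
  have "integral {a..b} ?f = integral {a..m} ?f + integral {m..b} ?f"
    using Henstock_Kurzweil_Integration.integral_combine[OF ab int] by simp
  also have "\<dots> \<le> 1 / (2 * c) + 1 / (2 * c)" using i1 i2 by (rule add_mono)
  finally show "integral {a..b} ?f \<le> 1 / c" by simp
qed

text \<open>The weaker exponent \<open>a / 12\<close> absorbs the factor \<open>a\<close> that the mean value theorem produces.\<close>

lemma exp_perturb_le:
  fixes a b t :: real
  assumes "0 \<le> a" "a * (1 - 3 * t) \<le> b" "a / 6 \<le> b" "0 \<le> t"
  shows "exp (- b) \<le> exp (- a) + 36 * t * exp (- a / 12)"
proof (cases "a \<le> b")
  case True
  then have "exp (- b) \<le> exp (- a)" by simp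
  then show ?thesis using assms by (smt (verit) exp_gt_zero mult_nonneg_nonneg)
next
  case False
  have "1 + (b - a) \<le> exp (b - a)" by (rule exp_ge_add_one_self)
  then have "(1 + (b - a)) * exp (- b) \<le> exp (b - a) * exp (- b)" by (intro mult_right_mono) auto
  then have "exp (- b) - exp (- a) \<le> (a - b) * exp (- b)" by (simp add: exp_add[symmetric] algebra_simps)
  also have "\<dots> \<le> (3 * t * a) * exp (- (a / 6))"
    using assms False by (intro mult_mono) (auto simp: algebra_simps)
  also have "\<dots> = 36 * t * (a / 12 * exp (- (a / 12))) * exp (- (a / 12))"
    by (simp add: exp_add[symmetric])
  also have "\<dots> \<le> 36 * t * 1 * exp (- (a / 12))"
  proof (intro mult_right_mono mult_left_mono)
    have "a / 12 \<le> exp (a / 12)" using exp_ge_add_one_self[of "a / 12"] by linarith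
    then show "a / 12 * exp (- (a / 12)) \<le> 1" by (simp add: exp_minus divide_le_eq field_simps)
  qed (use assms in auto)
  finally show ?thesis by simp
qed

section \<open>The integrand near its peak\<close>

context laplace
begin

text \<open>The slowly varying factor beside \<open>exp (n * G s)\<close> after the substitution.
  Its value at \<open>s = 1\<close> is \<open>w0\<close>.\<close>

definition W :: "real \<Rightarrow> real" where "W s = X' s * ((1 - X s) powr (- (1 / 2)) / X s)"

lemma W_eq:
  assumes "0 < L s"
  shows "W s = (D - 2) * T s / (s * L s * sqrt (Q s * ((D - 2) * R s)))"
proof -
  have s: "0 < s" using L_pos_imp[OF assms] .
  have pos: "Q s > 0" "R s > 0" "D - 2 > 0" using s Q_pos R_pos D3 by auto
  define q r where "q = sqrt (Q s)" and "r = sqrt ((D - 2) * R s)"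
  have qr: "q > 0" "r > 0" "Q s = q * q" "(D - 2) * R s = r * r" using pos by (simp_all add: q_def r_def)
  have "(1 - X s) powr (- (1 / 2)) = inverse (sqrt (1 - X s))"
    using X_less_1[of s] s by (simp add: powr_minus powr_half_sqrt)
  also have "\<dots> = q / r"
    unfolding one_minus_X[OF less_imp_le[OF s]] by (simp add: real_sqrt_divide q_def r_def)
  finally have 1: "(1 - X s) powr (- (1 / 2)) = q / r" .
  have 2: "sqrt (Q s * ((D - 2) * R s)) = q * r" by (simp add: q_def r_def real_sqrt_mult)
  have "W s = X' s * (q / r / X s)" by (simp only: W_def 1)
  also have "\<dots> = 2 * (D - 2) * T s / (q * q)\<^sup>2 * (q / r / (2 * s * L s / (q * q)))"
    by (simp only: X'_def X_def qr(3))
  also have "\<dots> = (D - 2) * T s / (s * L s * (q * r))"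
    using s assms qr(1,2) by (simp add: power2_eq_square field_simps)
  finally show ?thesis by (simp only: 2)
qed

definition w0 :: real where "w0 = sqrt (D / (D - 2))"

lemma w0_eq: "w0 * sqrt (D * (D - 2)) = D"
  using D3 by (simp add: w0_def real_sqrt_mult[symmetric])

lemma w0_bounds: "1 \<le> w0" "w0 \<le> 2"
proof -
  show "1 \<le> w0" using D3 by (simp add: w0_def)
  have "D / (D - 2) \<le> 4" using D3 by (simp add: divide_le_eq)
  then show "w0 \<le> 2" unfolding w0_def by (simp add: real_le_lsqrt)
qed

lemma W_le_large:
  assumes "1 \<le> s"
  shows "W s \<le> w0"
proof -
  have "D - 1 \<le> (D - 1) * s" using assms D3 by simp
  then have L: "(D - 2) * s \<le> L s" "0 < L s" using assms D3 by (simp_all add: L_def algebra_simps)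
  have s: "0 < s" using assms by simp
  have T: "T s \<le> D * (D - 2) * s\<^sup>2"
  proof -
    have "D * (D - 2) * s\<^sup>2 - T s = (s - 1) * ((2 * D - 3) * s - 1)"
      by (simp add: T_def power2_eq_square algebra_simps)
    moreover have "1 \<le> (2 * D - 3) * s" using D3 assms mult_mono[of 1 "2 * D - 3" 1 s] by simp
    ultimately show ?thesis using assms by (smt (verit) mult_nonneg_nonneg)
  qed
  have Q: "D * (D - 2) \<le> Q s"
  proof -
    have "Q s - D * (D - 2) = (s - 1) * ((D - 1) * (2 * (s - 1) + D))"
      by (simp add: Q_def power2_eq_square algebra_simps)
    then show ?thesis using assms D3 by (smt (verit) mult_nonneg_nonneg)
  qed
  have R: "D - 2 \<le> R s" using assms D3 mult_left_mono[of 1 s "D - 3"] by (simp add: R_def)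
  have "sqrt (D * (D - 2)) * (D - 2) = sqrt (D * (D - 2) * ((D - 2) * (D - 2)))"
    using D3 by (simp add: real_sqrt_mult)
  also have "\<dots> \<le> sqrt (Q s * ((D - 2) * R s))"
    using Q R D3 Q_pos[of s] s by (intro real_sqrt_le_mono mult_mono) auto
  finally have sq: "sqrt (D * (D - 2)) * (D - 2) \<le> sqrt (Q s * ((D - 2) * R s))" .
  have "(D - 2) * T s \<le> (D - 2) * (D * (D - 2) * s\<^sup>2)" using T D3 by (intro mult_left_mono) auto
  also have "\<dots> = (D - 2) * ((w0 * sqrt (D * (D - 2))) * (D - 2) * s\<^sup>2)" unfolding w0_eq ..
  also have "\<dots> = w0 * ((s * ((D - 2) * s)) * (sqrt (D * (D - 2)) * (D - 2)))"
    by (simp only: power2_eq_square mult_ac)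
  also have "\<dots> \<le> w0 * ((s * L s) * sqrt (Q s * ((D - 2) * R s)))"
    using L sq s D3 w0_bounds by (intro mult_left_mono mult_mono) auto
  finally have "(D - 2) * T s \<le> w0 * (s * L s * sqrt (Q s * ((D - 2) * R s)))" .
  moreover have "0 < s * L s * sqrt (Q s * ((D - 2) * R s))"
    using s L D3 Q_pos[of s] R_pos[of s] by simp
  ultimately show ?thesis unfolding W_eq[OF L(2)] by (simp only: divide_le_eq if_True)
qed

text \<open>The polynomial bounds give \<open>w0 / (s ^ 3 * (2 * s - 1))\<close>, and on this range
  40 is a sufficient slope for a linear majorant.\<close>

lemma W_le_small:
  assumes "3 / 4 \<le> s" "s \<le> 1"
  shows "W s \<le> w0 * (1 + 40 * (1 - s))"
proof -
  have s: "0 < s" using assms by simp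
  have L: "(D - 2) * (2 * s - 1) \<le> L s" "0 < L s"
  proof -
    have "L s - (D - 2) * (2 * s - 1) = (D - 3) * (1 - s)" by (simp add: L_def algebra_simps)
    also have "\<dots> \<ge> 0" using assms D3 by simp
    finally show "(D - 2) * (2 * s - 1) \<le> L s" by simp
    moreover have "0 < (D - 2) * (2 * s - 1)" using assms D3 by simp
    ultimately show "0 < L s" by linarith
  qed
  have T: "T s \<le> D * (D - 2)"
  proof -
    have "D * (D - 2) - T s = (D - 1) * (D - 3) * ((1 - s) * (1 + s)) + 2 * (D - 1) * (1 - s)"
      by (simp add: T_def power2_eq_square algebra_simps)
    also have "\<dots> \<ge> 0" using assms D3 by simp
    finally show ?thesis by simp
  qed
  have R: "(D - 2) * s \<le> R s" using assms by (simp add: R_def algebra_simps)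
  have "sqrt (D * (D - 2)) * ((D - 2) * s\<^sup>2) = sqrt (D * (D - 2) * ((D - 2) * s\<^sup>2)\<^sup>2)"
    using D3 by (simp add: real_sqrt_mult)
  also have "D * (D - 2) * ((D - 2) * s\<^sup>2)\<^sup>2 = (D * (D - 2) * s\<^sup>2) * ((D - 2) * ((D - 2) * (s * s)))"
    by (simp add: power2_eq_square)
  also have "sqrt \<dots> \<le> sqrt (Q s * ((D - 2) * R s))"
  proof (intro real_sqrt_le_mono mult_mono mult_left_mono)
    have "(D - 2) * (s * s) \<le> (D - 2) * s" using assms D3 by (intro mult_left_mono) (auto simp: mult_le_one)
    then show "(D - 2) * (s * s) \<le> R s" using R by linarith
  qed (use Q_ge[of s] Q_pos[of s] assms D3 in auto)
  finally have sq: "sqrt (D * (D - 2)) * ((D - 2) * s\<^sup>2) \<le> sqrt (Q s * ((D - 2) * R s))" .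
  have poly: "1 \<le> (1 + 40 * (1 - s)) * (s ^ 3 * (2 * s - 1))"
  proof -
    define t where "t = 1 - s"
    have t: "0 \<le> t" "t \<le> 1 / 4" using assms by (simp_all add: t_def)
    have "0 \<le> (1 - 2 * t) * (t\<^sup>2 * (3 - t))" using t by simp
    \<comment> \<open>Bernoulli's inequality for the cube reduces the claim to
      \<open>1 \<le> (1 + 40 * t) * (1 - 3 * t) * (1 - 2 * t)\<close>.\<close>
    then have "(1 - 3 * t) * (1 - 2 * t) \<le> (1 - t) ^ 3 * (1 - 2 * t)"
      by (simp add: power2_eq_square power3_eq_cube algebra_simps)
    then have "(1 + 40 * t) * ((1 - 3 * t) * (1 - 2 * t)) \<le> (1 + 40 * t) * ((1 - t) ^ 3 * (1 - 2 * t))"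
      using t by (intro mult_left_mono) auto
    moreover have "(1 + 40 * t) * ((1 - 3 * t) * (1 - 2 * t)) = 1 + t * ((1 / 4 - t) * (134 - 240 * t) + 3 / 2)"
      by (simp add: algebra_simps)
    moreover have "0 \<le> t * ((1 / 4 - t) * (134 - 240 * t) + 3 / 2)"
      using t by (intro mult_nonneg_nonneg add_nonneg_nonneg) auto
    ultimately have "1 \<le> (1 + 40 * t) * ((1 - t) ^ 3 * (1 - 2 * t))" by linarith
    then show ?thesis by (simp add: t_def algebra_simps)
  qed
  have "(D - 2) * T s \<le> (D - 2) * (D * (D - 2))" using T D3 by (intro mult_left_mono) auto
  also have "\<dots> = w0 * ((D - 2) * (sqrt (D * (D - 2)) * (D - 2))) * 1"
    using w0_eq by (simp add: mult_ac)
  also have "\<dots> \<le> w0 * ((D - 2) * (sqrt (D * (D - 2)) * (D - 2))) * ((1 + 40 * (1 - s)) * (s ^ 3 * (2 * s - 1)))"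
    using poly w0_bounds D3 by (intro mult_left_mono) auto
  also have "\<dots> = w0 * (1 + 40 * (1 - s)) * (s * ((D - 2) * (2 * s - 1)) * (sqrt (D * (D - 2)) * ((D - 2) * s\<^sup>2)))"
    by (simp only: power2_eq_square power3_eq_cube mult_ac)
  also have "\<dots> \<le> w0 * (1 + 40 * (1 - s)) * (s * L s * sqrt (Q s * ((D - 2) * R s)))"
    using L sq s D3 w0_bounds assms by (intro mult_left_mono mult_mono) auto
  finally have "(D - 2) * T s \<le> w0 * (1 + 40 * (1 - s)) * (s * L s * sqrt (Q s * ((D - 2) * R s)))" .
  moreover have "0 < s * L s * sqrt (Q s * ((D - 2) * R s))"
    using s L D3 Q_pos[of s] R_pos[of s] by simp
  ultimately show ?thesis unfolding W_eq[OF L(2)] by (simp only: divide_le_eq if_True)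
qed

lemma W_le:
  assumes "3 / 4 \<le> s"
  shows "W s \<le> w0 * (1 + 40 * \<bar>s - 1\<bar>)"
proof (cases "s \<le> 1")
  case True
  then show ?thesis using W_le_small[OF assms] by simp
next
  case False
  then have "W s \<le> w0 * 1" using W_le_large[of s] by simp
  also have "\<dots> \<le> w0 * (1 + 40 * \<bar>s - 1\<bar>)" using w0_bounds by (intro mult_left_mono) auto
  finally show ?thesis .
qed

text \<open>The bounds on \<open>G\<close> are \<open>- \<kappa> * (s - 1)\<^sup>2 / 2\<close> times
  a correction \<open>h\<close> that is 1 at the peak, at least
  \<open>1 - 3 * \<bar>s - 1\<bar>\<close> by linear comparison, and at least \<open>1 / 6\<close>,
  its right-hand formula's value at \<open>s = 2\<close>.\<close>

lemma exp_G_middle: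
  fixes n :: nat
  assumes s: "3 / 4 \<le> s" "s \<le> 2"
  defines "a \<equiv> real n * \<kappa> / 2 * (s - 1)\<^sup>2"
  shows "exp (real n * G s) \<le> exp (- a) + 36 * \<bar>s - 1\<bar> * exp (- a / 12)"
proof -
  define t where "t = \<bar>s - 1\<bar>"
  have t: "0 \<le> t" "t \<le> 1" "(s - 1)\<^sup>2 = t\<^sup>2" using s by (auto simp: t_def)
  have a0: "0 \<le> a" using \<kappa>_bounds by (simp add: a_def)
  have r: "- \<kappa> * (t\<^sup>2 / 2 * h) = - (\<kappa> / 2 * t\<^sup>2) * h" for h by simp
  have "\<exists>h. G s \<le> - (\<kappa> / 2 * t\<^sup>2) * h \<and> 1 - 3 * t \<le> h \<and> 1 / 6 \<le> h"
  proof (cases "s \<le> 1")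
    case True
    then have ts: "t = 1 - s" "t \<le> 1 / 4" using s by (simp_all add: t_def)
    have e: "(1 - s)\<^sup>2 * (1 + 2 * s) / 6 = t\<^sup>2 / 2 * (1 - 2 * t / 3)"
      by (simp add: ts(1) power2_eq_square field_simps)
    have "G s \<le> - \<kappa> * (t\<^sup>2 / 2 * (1 - 2 * t / 3))" using G_le_small[of s] True s unfolding e by simp
    then have "G s \<le> - (\<kappa> / 2 * t\<^sup>2) * (1 - 2 * t / 3)" unfolding r .
    moreover have "1 - 3 * t \<le> 1 - 2 * t / 3" "1 / 6 \<le> 1 - 2 * t / 3" using t(1) ts(2) by linarith+
    ultimately show ?thesis by blast
  next
    case False
    then have ts: "s = 1 + t" by (simp add: t_def)
    have p: "0 < 3 * (1 + t) ^ 3" using t by simp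
    have e: "(s - 1)\<^sup>2 * (s + 2) / (6 * s ^ 3) = t\<^sup>2 / 2 * ((t + 3) / (3 * (1 + t) ^ 3))"
      by (simp add: ts)
    have 1: "G s \<le> - \<kappa> * (t\<^sup>2 / 2 * ((t + 3) / (3 * (1 + t) ^ 3)))"
      using G_le_large[of s] False unfolding e by simp
    have "(1 - 3 * t) * (3 * (1 + t) ^ 3) = 3 - t\<^sup>2 * (18 + 24 * t + 9 * t\<^sup>2)"
      by (simp add: power2_eq_square power3_eq_cube algebra_simps)
    moreover have "0 \<le> t\<^sup>2 * (18 + 24 * t + 9 * t\<^sup>2)" using t by simp
    ultimately have "(1 - 3 * t) * (3 * (1 + t) ^ 3) \<le> t + 3" using t by linarith
    then have 2: "1 - 3 * t \<le> (t + 3) / (3 * (1 + t) ^ 3)" using p by (simp only: le_divide_eq if_True)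
    have "1 / 6 * (3 * (1 + t) ^ 3) = t + 3 - (1 - t) * (5 / 2 + 2 * t + t\<^sup>2 / 2)"
      by (simp add: power2_eq_square power3_eq_cube field_simps)
    moreover have "0 \<le> (1 - t) * (5 / 2 + 2 * t + t\<^sup>2 / 2)" using t by simp
    ultimately have "1 / 6 * (3 * (1 + t) ^ 3) \<le> t + 3" by linarith
    then have "1 / 6 \<le> (t + 3) / (3 * (1 + t) ^ 3)" using p by (simp only: le_divide_eq if_True)
    with 1 2 show ?thesis unfolding r by blast
  qed
  then obtain h where h: "G s \<le> - (\<kappa> / 2 * t\<^sup>2) * h" "1 - 3 * t \<le> h" "1 / 6 \<le> h" by blast
  have "real n * G s \<le> real n * (- (\<kappa> / 2 * t\<^sup>2) * h)" using h(1) by (intro mult_left_mono) auto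
  also have "\<dots> = - (a * h)" by (simp add: a_def t(3))
  finally have "exp (real n * G s) \<le> exp (- (a * h))" by simp
  also have "\<dots> \<le> exp (- a) + 36 * t * exp (- a / 12)"
  proof (rule exp_perturb_le)
    show "a * (1 - 3 * t) \<le> a * h" using h a0 by (intro mult_left_mono) auto
    show "a / 6 \<le> a * h" using mult_left_mono[OF h(3) a0] by simp
  qed (use a0 t in auto)
  finally show ?thesis by (simp add: t_def)
qed

lemma integrand_middle:
  fixes n :: nat
  assumes s: "3 / 4 \<le> s" "s \<le> 2"
  defines "a \<equiv> real n * \<kappa> / 2 * (s - 1)\<^sup>2"
  shows "X' s * integrand n s \<le>
    A0 n * (1 + (3 / 4) ^ n) * w0 * (exp (- a) + 1516 * (\<bar>s - 1\<bar> * exp (- a / 12)))"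
proof -
  have "3 / 4 * 2 \<le> s * (D - 1)" using s D3 by (intro mult_mono) auto
  then have L: "0 < L s" by (simp add: L_def mult.commute)
  have s0: "0 < s" using s by simp
  have X: "0 < X s" using X_pos[OF L] .
  have X': "0 \<le> X' s" using T_pos[of s] L D3 by (simp add: X'_def)
  have R: "0 < R s" using s0 R_pos by simp
  have a0: "0 \<le> a" using \<kappa>_bounds by (simp add: a_def)
  have "\<bar>- L s / R s\<bar> ^ n \<le> (3 / 4 * ((D - 1) * s)) ^ n"
    using ratio_le_middle[OF s] L R by (intro power_mono) auto
  then have "(- L s / R s) ^ n \<le> (3 / 4) ^ n * ((D - 1) * s) ^ n"
    using abs_ge_self[of "(- L s / R s) ^ n"] unfolding power_abs power_mult_distrib[of "3 / 4"] by linarith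
  then have "((D - 1) * s) ^ n + (- L s / R s) ^ n - 1 \<le> (1 + (3 / 4) ^ n) * ((D - 1) * s) ^ n"
    by (simp add: algebra_simps)
  then have "integrand n s \<le> (1 + (3 / 4) ^ n) * ((D - 1) * s) ^ n *
      ((1 - X s) powr (real n * (D - 2) / 2 - 1 / 2) / X s)"
    unfolding integrand_def using X by (intro mult_right_mono) auto
  also have "\<dots> = (1 + (3 / 4) ^ n) * (A0 n * exp (real n * G s) * ((1 - X s) powr (- (1 / 2)) / X s))"
    by (simp only: mult.assoc integrand_factor[OF L, unfolded mult.assoc])
  finally have "X' s * integrand n s \<le>
      X' s * ((1 + (3 / 4) ^ n) * (A0 n * exp (real n * G s) * ((1 - X s) powr (- (1 / 2)) / X s)))"
    using X' by (intro mult_left_mono)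
  also have "\<dots> = A0 n * (1 + (3 / 4) ^ n) * (exp (real n * G s) * W s)"
    by (simp add: W_def mult_ac)
  also have "\<dots> \<le> A0 n * (1 + (3 / 4) ^ n) * (w0 * (exp (- a) + 1516 * (\<bar>s - 1\<bar> * exp (- a / 12))))"
  proof (intro mult_left_mono)
    define t where "t = \<bar>s - 1\<bar>"
    have t: "0 \<le> t" "t \<le> 1" using s by (auto simp: t_def)
    define e f where "e = exp (- a)" and "f = exp (- a / 12)"
    have ef: "0 < e" "0 < f" "e \<le> f" using a0 by (simp_all add: e_def f_def)
    have W0: "0 \<le> W s" using X X' by (simp add: W_def)
    have "exp (real n * G s) * W s \<le> (e + 36 * t * f) * (w0 * (1 + 40 * t))"
      using exp_G_middle[OF s, of n] W_le[OF s(1)] W0 t ef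
      by (intro mult_mono) (auto simp: a_def t_def e_def f_def)
    \<comment> \<open>The coefficients of the error terms add up to
      \<open>40 + 36 + 36 * 40 = 1516\<close>.\<close>
    also have "\<dots> = w0 * (e + 40 * (t * e) + 36 * (t * f) + 1440 * (t * (t * f)))" by (simp add: algebra_simps)
    also have "\<dots> \<le> w0 * (e + 1516 * (t * f))"
    proof (intro mult_left_mono)
      have "t * e \<le> t * f" using ef t by (intro mult_left_mono) auto
      moreover have "t * (t * f) \<le> 1 * (t * f)" using t ef by (intro mult_right_mono) auto
      ultimately show "e + 40 * (t * e) + 36 * (t * f) + 1440 * (t * (t * f)) \<le> e + 1516 * (t * f)" by linarith
    qed (use w0_bounds in auto)
    finally show "exp (real n * G s) * W s \<le> w0 * (exp (- a) + 1516 * (\<bar>s - 1\<bar> * exp (- a / 12)))"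
      by (simp add: t_def e_def f_def)
  qed (use A0_pos[of n] in \<open>auto intro: less_imp_le\<close>)
  finally show ?thesis by (simp only: mult.assoc)
qed

end

section \<open>Assembling the integral over the unit interval\<close>

lemma has_integral_inverse_sqrt:
  fixes u v :: real
  assumes "u \<le> v" "v \<le> 1"
  shows "((\<lambda>x. (1 - x) powr (- (1 / 2))) has_integral (2 * sqrt (1 - u) - 2 * sqrt (1 - v))) {u..v}"
proof -
  have "((\<lambda>x. (1 - x) powr (- (1 / 2))) has_integral (- 2 * sqrt (1 - v) - (- 2 * sqrt (1 - u)))) {u..v}"
  proof (rule fundamental_theorem_of_calculus_interior[OF assms(1)])
    show "continuous_on {u..v} (\<lambda>x. - 2 * sqrt (1 - x))" by (intro continuous_intros)
    fix x assume "x \<in> {u<..<v}"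
    then have x: "x < 1" using assms by simp
    then have "(1 - x) powr (- (1 / 2)) = inverse (sqrt (1 - x))"
      by (simp add: powr_minus powr_half_sqrt)
    then have "((\<lambda>x. - 2 * sqrt (1 - x)) has_real_derivative (1 - x) powr (- (1 / 2))) (at x)"
      using x by (auto intro!: derivative_eq_intros)
    then show "((\<lambda>x. - 2 * sqrt (1 - x)) has_vector_derivative (1 - x) powr (- (1 / 2))) (at x)"
      by (simp add: has_real_derivative_iff_has_vector_derivative)
  qed
  then show ?thesis by simp
qed

context laplace
begin

text \<open>The points with \<open>s\<close> outside \<open>[3/4, 2]\<close> are handled without a change of variables, by the integrable
  majorant \<open>(1 - x) powr (- 1/2)\<close>. The constant is \<open>218304 = 2 * 1516 * 72\<close>, from \<open>w0 \<le> 2\<close>,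
  \<open>integrand_middle\<close> and the integral of \<open>\<bar>s - 1\<bar> exp (- a / 12)\<close>.\<close>

lemma integral_bound:
  fixes n :: nat
  assumes n: "0 < n" and I: "(\<Phi> has_integral I) {0..1}" and cont: "continuous_on {0<..<1} \<Phi>"
    and ends: "\<Phi> 0 \<le> 0" "\<Phi> 1 \<le> 0"
    and le: "\<And>s. 0 < L s \<Longrightarrow> \<Phi> (X s) \<le> integrand n s"
  shows "I \<le> A0 n * ((1 + (3 / 4) ^ n) * (D / (D - 2) * sqrt (2 * pi / real n) + 218304 / real n)
    + 8 * (real n + 1) * D ^ 3 * exp (- real n / 288))"
proof -
  define B where "B = A0 n * (2 * (real n + 1) * D ^ 3 * exp (- real n / 288))"
  have B: "0 \<le> B" using A0_pos[of n] D3 by (simp add: B_def)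
  define u v where "u = X (3 / 4)" and "v = X 2"
  have L: "0 < L (3 / 4)" "0 < L 2" using D3 by (simp_all add: L_def)
  have uv: "0 < u" "u \<le> v" "v < 1"
    using X_pos[OF L(1)] X_mono[of "3 / 4" 2] X_less_1[of 2] L by (simp_all add: u_def v_def)
  have outer: "\<Phi> x \<le> B * (1 - x) powr (- (1 / 2))" if x: "0 \<le> x" "x \<le> u \<or> v \<le> x" "x \<le> 1" for x
  proof -
    consider "x = 0" | "x = 1" | "0 < x" "x < 1" using x by linarith
    then show ?thesis
    proof cases
      case 3
      have "\<exists>s. 0 < L s \<and> X s = x \<and> (s \<le> 3 / 4 \<or> 2 \<le> s)"
      proof (cases "x = u \<or> x = v")
        case True
        then show ?thesis using L by (auto simp: u_def v_def)
      next
        case False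
        obtain s where s: "0 < L s" "X s = x" using X_surj 3 by blast
        have "s \<le> 3 / 4 \<or> 2 \<le> s"
        proof (rule ccontr)
          assume "\<not> (s \<le> 3 / 4 \<or> 2 \<le> s)"
          then have "u \<le> x" "x \<le> v"
            using X_mono[of "3 / 4" s] X_mono[of s 2] L s by (auto simp: u_def v_def)
          then show False using x(2) False by linarith
        qed
        then show ?thesis using s by blast
      qed
      then obtain s where s: "0 < L s" "X s = x" "s \<le> 3 / 4 \<or> 2 \<le> s" by blast
      show ?thesis
        using order_trans[OF le[OF s(1)] integrand_outer[OF s(1) n s(3)]] unfolding s(2) B_def .
    qed (use ends B in auto)
  qed
  have int: "\<Phi> integrable_on {0..1}" using I by (rule has_integral_integrable)
  have sub: "\<Phi> integrable_on {a..b}" if "0 \<le> a" "b \<le> 1" for a b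
    using int by (rule integrable_subinterval_real) (use that in auto)
  have outer_int: "integral {a..b} \<Phi> \<le> 2 * B"
    if ab: "0 \<le> a" "a \<le> b" "b \<le> 1" and *: "b \<le> u \<or> v \<le> a" for a b
  proof -
    have hi: "((\<lambda>x. B * (1 - x) powr (- (1 / 2))) has_integral B * (2 * sqrt (1 - a) - 2 * sqrt (1 - b))) {a..b}"
      by (intro has_integral_mult_right has_integral_inverse_sqrt ab)
    have "integral {a..b} \<Phi> \<le> B * (2 * sqrt (1 - a) - 2 * sqrt (1 - b))"
      using integrable_integral[OF sub[of a b]] hi
    proof (rule has_integral_le)
      fix x assume "x \<in> {a..b}"
      then show "\<Phi> x \<le> B * (1 - x) powr (- (1 / 2))" using ab * by (intro outer) auto
    qed (use ab in auto)
    also have "\<dots> \<le> B * 2"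
    proof (intro mult_left_mono B)
      have "sqrt (1 - a) \<le> 1" "0 \<le> sqrt (1 - b)" using ab by (auto simp: real_sqrt_le_1_iff)
      then show "2 * sqrt (1 - a) - 2 * sqrt (1 - b) \<le> 2" by linarith
    qed
    finally show ?thesis by simp
  qed
  define c where "c = real n * \<kappa> / 2"
  have c: "0 < c" "0 < c / 12" using n \<kappa>_bounds by (simp_all add: c_def)
  let ?g = "\<lambda>s. exp (- c * (s - 1)\<^sup>2)" and ?h = "\<lambda>s. \<bar>s - 1\<bar> * exp (- (c / 12) * (s - 1)\<^sup>2)"
  let ?M = "A0 n * (1 + (3 / 4) ^ n) * w0"
  have gi: "(?g has_integral integral {3 / 4..2} ?g) {3 / 4..2}"
    by (intro integrable_integral gaussian_integral_le c)
  have hi: "(?h has_integral integral {3 / 4..2} ?h) {3 / 4..2}"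
    by (intro integrable_integral abs_gaussian_integral_le c) auto
  have "((\<lambda>s. X' s *\<^sub>R \<Phi> (X s)) has_integral integral {X (3 / 4)..X 2} \<Phi>) {3 / 4..2}"
  proof (rule has_integral_substitution[where c = u and d = v])
    show "X (3 / 4) \<le> X 2" using uv by (simp add: u_def v_def)
    show "X ` {3 / 4..2} \<subseteq> {u..v}"
    proof (rule image_subsetI)
      fix s :: real assume s: "s \<in> {3 / 4..2}"
      then have "0 \<le> L s" using L mult_left_mono[of "3 / 4" s "D - 1"] D3 by (simp add: L_def)
      then show "X s \<in> {u..v}" using X_mono[of "3 / 4" s] X_mono[of s 2] L s by (auto simp: u_def v_def)
    qed
    show "continuous_on {u..v} \<Phi>" using cont by (rule continuous_on_subset) (use uv in auto)
    fix s :: real assume "s \<in> {3 / 4..2}"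
    then show "(X has_real_derivative X' s) (at s within {3 / 4..2})"
      by (intro DERIV_subset[OF X_deriv]) auto
  qed simp
  then have "integral {u..v} \<Phi> \<le> ?M * (integral {3 / 4..2} ?g + 1516 * integral {3 / 4..2} ?h)"
    unfolding u_def[symmetric] v_def[symmetric]
  proof (rule has_integral_le)
    show "((\<lambda>s. ?M * (?g s + 1516 * ?h s)) has_integral
        ?M * (integral {3 / 4..2} ?g + 1516 * integral {3 / 4..2} ?h)) {3 / 4..2}"
      by (intro has_integral_mult_right has_integral_add gi hi)
    fix s :: real assume s: "s \<in> {3 / 4..2}"
    have Ls: "0 < L s" using s L mult_left_mono[of "3 / 4" s "D - 1"] D3 by (simp add: L_def)
    have "0 \<le> X' s" using T_pos[of s] Ls D3 by (simp add: X'_def)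
    then have "X' s *\<^sub>R \<Phi> (X s) \<le> X' s * integrand n s"
      using le[OF Ls] by (simp add: mult_left_mono)
    also have "\<dots> \<le> ?M * (?g s + 1516 * ?h s)" using integrand_middle[of s n] s by (simp add: c_def)
    finally show "X' s *\<^sub>R \<Phi> (X s) \<le> ?M * (?g s + 1516 * ?h s)" .
  qed
  also have "\<dots> \<le> A0 n * (1 + (3 / 4) ^ n) * (w0 * (sqrt (pi / c) + 1516 * (1 / (c / 12))))"
  proof -
    have "integral {3 / 4..2} ?g \<le> sqrt (pi / c)" by (rule gaussian_integral_le(2)[OF c(1)])
    moreover have "integral {3 / 4..2} ?h \<le> 1 / (c / 12)" by (rule abs_gaussian_integral_le(2)[OF c(2)]) auto
    ultimately have "?M * (integral {3 / 4..2} ?g + 1516 * integral {3 / 4..2} ?h) \<le>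
        ?M * (sqrt (pi / c) + 1516 * (1 / (c / 12)))"
      using A0_pos[of n] w0_bounds by (intro mult_left_mono add_mono mult_nonneg_nonneg) auto
    then show ?thesis by (simp only: mult.assoc)
  qed
  also have "\<dots> \<le> A0 n * (1 + (3 / 4) ^ n) * (D / (D - 2) * sqrt (2 * pi / real n) + 218304 / real n)"
  proof (intro mult_left_mono)
    have "pi / c = 2 * pi / real n * (D / (D - 2))" using n D3 by (simp add: c_def \<kappa>_def)
    then have "sqrt (pi / c) = sqrt (2 * pi / real n) * w0" by (simp only: real_sqrt_mult w0_def)
    \<comment> \<open>One factor \<open>w0\<close> is the prefactor at the peak, the other comes
      from the width of the Gaussian; their product is \<open>D / (D - 2)\<close>.\<close>
    then have "w0 * sqrt (pi / c) = (w0 * w0) * sqrt (2 * pi / real n)" by simp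
    also have "w0 * w0 = D / (D - 2)" using D3 by (simp add: w0_def)
    finally have 1: "w0 * sqrt (pi / c) = D / (D - 2) * sqrt (2 * pi / real n)" .
    \<comment> \<open>By \<open>1 / 3 \<le> \<kappa>\<close> one has
      \<open>c \<ge> n / 6\<close>.\<close>
    have "real n / 72 \<le> c / 12" using \<kappa>_bounds n by (simp add: c_def)
    then have "1 / (c / 12) \<le> 72 / real n" using n c by (simp add: divide_simps mult_ac)
    then have "w0 * (1516 * (1 / (c / 12))) \<le> 2 * (1516 * (72 / real n))"
      using w0_bounds c by (intro mult_mono) auto
    with 1 show "w0 * (sqrt (pi / c) + 1516 * (1 / (c / 12))) \<le> D / (D - 2) * sqrt (2 * pi / real n) + 218304 / real n"
      by (simp add: distrib_left)
  qed (use A0_pos[of n] in \<open>auto intro: less_imp_le\<close>)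
  finally have mid: "integral {u..v} \<Phi> \<le>
    A0 n * (1 + (3 / 4) ^ n) * (D / (D - 2) * sqrt (2 * pi / real n) + 218304 / real n)" .
  have "I = integral {0..1} \<Phi>" using I by (simp add: integral_unique)
  also have "\<dots> = integral {0..u} \<Phi> + integral {u..1} \<Phi>"
    using uv by (intro Henstock_Kurzweil_Integration.integral_combine[symmetric] int) auto
  also have "integral {u..1} \<Phi> = integral {u..v} \<Phi> + integral {v..1} \<Phi>"
    using uv by (intro Henstock_Kurzweil_Integration.integral_combine[symmetric] sub) auto
  also have "integral {0..u} \<Phi> + (integral {u..v} \<Phi> + integral {v..1} \<Phi>) \<le> 2 * B +
      (A0 n * (1 + (3 / 4) ^ n) * (D / (D - 2) * sqrt (2 * pi / real n) + 218304 / real n) + 2 * B)"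
    using uv by (intro add_mono mid outer_int) auto
  finally have le: "I \<le> 2 * B +
      (A0 n * (1 + (3 / 4) ^ n) * (D / (D - 2) * sqrt (2 * pi / real n) + 218304 / real n) + 2 * B)" .
  have ring: "2 * (a * (2 * p * q * r)) + (a * m * k + 2 * (a * (2 * p * q * r))) = a * (m * k + 8 * p * q * r)"
    for a p q r m k :: real by (simp add: algebra_simps)
  show ?thesis using le unfolding B_def ring .
qed

end

section \<open>The bound on the second moment\<close>

lemma second_moment_le:
  fixes n d :: nat
  assumes n: "2 \<le> n" and d: "2 \<le> d" and ev: "even (n * d)"
  defines "K \<equiv> n * d div 2 - n" and "D \<equiv> real d"
  shows "measure_pmf.expectation (config_model n d) (\<lambda>P. (normalized_ham_count n d P)\<^sup>2) \<le>
    (\<Sum>l | l \<in> valid_labellings n d \<and> card (new_vertices n l) \<le> K.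
       fact (card (new_vertices n l) - 1) * real (odd_fact (K - card (new_vertices n l))) / real (odd_fact K)) /
    (fact (n - 1) * (D * (D - 1)) ^ n * real (odd_fact K) / real (odd_fact (n * d div 2)))"
proof -
  let ?V = "{l. l \<in> valid_labellings n d \<and> card (new_vertices n l) \<le> K}"
  let ?g = "\<lambda>l. fact (card (new_vertices n l) - 1) * real (odd_fact (K - card (new_vertices n l)))"
  define S where "S = real (\<Sum>\<tau>\<in>rooted_cycles n d. extensions n d (cycle_pairs n (base_cycle n) \<union> cycle_pairs n \<tau>))"
  define Y where "Y = (\<Sum>l\<in>?V. ?g l)"
  define p where "p = (D * (D - 1)) ^ n"
  define o1 o2 where "o1 = real (odd_fact K)" and "o2 = real (odd_fact (n * d div 2))"
  have pos: "0 < p" "0 < o1" "0 < o2" using d by (simp_all add: p_def D_def o1_def o2_def)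
  have "S \<le> real (\<Sum>l\<in>?V. n * fact (card (new_vertices n l) - 1) * odd_fact (K - card (new_vertices n l)))"
    unfolding S_def K_def using sum_extensions_le[OF n d ev] by (intro of_nat_mono)
  also have "\<dots> = real n * Y" by (simp add: Y_def sum_distrib_left mult.assoc)
  finally have S: "S \<le> real n * Y" .
  have f: "fact n = real n * fact (n - 1)" using n by (simp add: fact_reduce)
  have "measure_pmf.expectation (config_model n d) (\<lambda>P. (normalized_ham_count n d P)\<^sup>2) =
      S * o2 / (fact n * p * o1\<^sup>2)"
    unfolding second_moment_eq[OF n d ev] S_def o1_def o2_def p_def K_def D_def ..
  also have "\<dots> \<le> real n * Y * o2 / (fact n * p * o1\<^sup>2)"
    using S pos by (intro divide_right_mono mult_right_mono) auto
  also have "\<dots> = Y / o1 / (fact (n - 1) * p * o1 / o2)"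
    unfolding f using n pos by (simp add: power2_eq_square)
  also have "Y / o1 = (\<Sum>l\<in>?V. ?g l / o1)" by (simp add: Y_def sum_divide_distrib)
  finally show ?thesis by (simp only: p_def o1_def o2_def)
qed

lemma finite_valid_labellings: "finite (valid_labellings n d)"
proof (rule finite_subset)
  show "valid_labellings n d \<subseteq> {..<n} \<rightarrow>\<^sub>E labels d" by (auto simp: valid_labellings_def)
  show "finite ({..<n} \<rightarrow>\<^sub>E labels d)" by (simp add: finite_PiE finite_labels)
qed

text \<open>At \<open>z = 0\<close> the generating function counts these labellings, by
  \<open>0 ^ 0 = 1\<close>, and the roots are 1 and 0. The two labellings describe the base cycle in
  its two directions.\<close>

lemma card_valid_labellings_old:
  assumes "0 < n" "2 \<le> d"
  shows "card {l \<in> valid_labellings n d. card (new_vertices n l) = 0} = 2"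
proof -
  have "(\<Sum>l\<in>valid_labellings n d. (0::real) ^ card (new_vertices n l)) = 1 ^ n + 0 ^ n + 1"
    using assms by (intro sum_valid_labellings) auto
  also have "(\<Sum>l\<in>valid_labellings n d. (0::real) ^ card (new_vertices n l)) =
      (\<Sum>l\<in>valid_labellings n d. of_bool (card (new_vertices n l) = 0))"
    by (intro sum.cong refl) (auto simp: power_0_left)
  also have "\<dots> = real (card {l \<in> valid_labellings n d. card (new_vertices n l) = 0})"
    using finite_valid_labellings by (simp add: sum_of_bool_eq Int_def)
  finally show ?thesis using assms by (simp add: power_0_left)
qed

text \<open>The Beta integral needs at least one new vertex. The two remaining labellings contribute
  1 each, as \<open>fact (0 - 1) = 1\<close>.\<close>

lemma valid_labellings_sum_le:
  fixes n d :: nat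
  assumes n: "2 \<le> n" and d: "3 \<le> d" and ev: "even (n * d)"
  defines "K \<equiv> n * d div 2 - n" and "D \<equiv> real d"
  shows "(\<Sum>l | l \<in> valid_labellings n d \<and> card (new_vertices n l) \<le> K.
       fact (card (new_vertices n l) - 1) * real (odd_fact (K - card (new_vertices n l))) / real (odd_fact K)) \<le>
    2 + laplace.A0 D n * ((1 + (3 / 4) ^ n) * (D / (D - 2) * sqrt (2 * pi / real n) + 218304 / real n)
    + 8 * (real n + 1) * D ^ 3 * exp (- real n / 288))"
proof -
  interpret laplace D by unfold_locales (use d in \<open>auto simp: D_def\<close>)
  let ?m = "\<lambda>l. card (new_vertices n l)"
  let ?g = "\<lambda>l. fact (?m l - 1) * real (odd_fact (K - ?m l)) / real (odd_fact K)"
  define A where "A = {l \<in> valid_labellings n d. ?m l = 0}"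
  define B where "B = {l \<in> valid_labellings n d. 0 < ?m l \<and> ?m l \<le> K}"
  have fin: "finite A" "finite B" using finite_valid_labellings by (auto simp: A_def B_def)
  have "{l. l \<in> valid_labellings n d \<and> ?m l \<le> K} = A \<union> B" "A \<inter> B = {}" by (auto simp: A_def B_def)
  then have "(\<Sum>l | l \<in> valid_labellings n d \<and> ?m l \<le> K. ?g l) = sum ?g A + sum ?g B"
    using fin by (simp add: sum.union_disjoint)
  also have "sum ?g A = (\<Sum>l\<in>A. 1)" by (intro sum.cong) (auto simp: A_def)
  also have "\<dots> = 2" using card_valid_labellings_old[of n d] n d by (simp add: A_def)
  also have "sum ?g B \<le> A0 n * ((1 + (3 / 4) ^ n) * (D / (D - 2) * sqrt (2 * pi / real n) + 218304 / real n)
    + 8 * (real n + 1) * D ^ 3 * exp (- real n / 288))"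
  proof (rule integral_bound)
    let ?\<Phi> = "\<lambda>x. \<Sum>l\<in>B. (x / (2 * (1 - x))) ^ ?m l * ((1 - x) powr (real K - 1 / 2) / x)"
    show "0 < n" using n by simp
    show "(?\<Phi> has_integral sum ?g B) {0..1}"
      using fin by (intro has_integral_sum has_integral_fact_odd_fact) (auto simp: B_def)
    show "continuous_on {0<..<1} ?\<Phi>"
      by (intro continuous_intros) auto
    \<comment> \<open>The endpoint values are 0 by the conventions for division by zero and for
      \<open>0 powr\<close>.\<close>
    show "?\<Phi> 0 \<le> 0" "?\<Phi> 1 \<le> 0" by simp_all
    fix s assume L: "0 < L s"
    have s: "0 < s" using L_pos_imp[OF L] .
    have pos: "0 < Q s" "0 < R s" "0 < D - 2" using s Q_pos R_pos D3 by auto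
    define z where "z = X s / (2 * (1 - X s))"
    have "z = X s / (2 * ((D - 2) * R s / Q s))" by (simp only: z_def one_minus_X[OF less_imp_le[OF s]])
    \<comment> \<open>This is the quadratic equation of the eigenvalues solved for \<open>z\<close>
      at the root \<open>(D - 1) * s\<close>, and it explains the choice of
      \<open>X\<close>.\<close>
    then have z: "z = s * L s / ((D - 2) * R s)" unfolding X_def using pos by simp
    have z0: "0 \<le> z" unfolding z using s L pos by simp
    have c: "real d - 2 = D - 2" "real d - 2 - 1 = D - 3" "real d - 2 + 1 = D - 1" by (simp_all add: D_def)
    have "(\<Sum>l\<in>valid_labellings n d. z ^ ?m l) = ((D - 1) * s) ^ n + (- L s / R s) ^ n + 1"
    proof (rule sum_valid_labellings)
      have "(D - 1) * s + - L s / R s = 1 + (L s * R s - L s) / R s" using pos by (simp add: L_def field_simps)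
      also have "L s * R s - L s = (D - 3) * s * L s" by (simp add: R_def algebra_simps)
      finally show "(D - 1) * s + - L s / R s = 1 + (real d - 2) * (real d - 2 - 1) * z"
        unfolding c z using pos by (simp add: mult_ac)
      show "(D - 1) * s * (- L s / R s) = - ((real d - 2 + 1) * (real d - 2) * z)"
        unfolding c z using pos by simp
    qed (use n d in auto)
    moreover have "(\<Sum>l\<in>valid_labellings n d. z ^ ?m l) =
        (\<Sum>l\<in>A. z ^ ?m l) + (\<Sum>l\<in>valid_labellings n d - A. z ^ ?m l)"
      by (subst add.commute, rule sum.subset_diff) (auto simp: A_def finite_valid_labellings)
    moreover have "(\<Sum>l\<in>A. z ^ ?m l) = 2"
      using card_valid_labellings_old[of n d] n d by (simp add: A_def)
    \<comment> \<open>Labellings with more than \<open>K\<close> new vertices are added so that the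
      complete generating function can be used; their terms are nonnegative.\<close>
    moreover have "(\<Sum>l\<in>B. z ^ ?m l) \<le> (\<Sum>l\<in>valid_labellings n d - A. z ^ ?m l)"
      using z0 finite_valid_labellings by (intro sum_mono2) (auto simp: A_def B_def)
    ultimately have *: "(\<Sum>l\<in>B. z ^ ?m l) \<le> ((D - 1) * s) ^ n + (- L s / R s) ^ n - 1" by linarith
    have K: "real K = real n * (D - 2) / 2"
    proof -
      obtain h where h: "n * d = 2 * h" using ev by blast
      have "n * 3 \<le> 2 * h" using h d by (metis mult_le_mono2)
      then have "real K = real h - real n" by (simp add: K_def h of_nat_diff)
      moreover have "real n * D = 2 * real h" using h unfolding D_def by (metis of_nat_mult of_nat_numeral)
      ultimately show ?thesis by (simp add: algebra_simps)
    qed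
    have "?\<Phi> (X s) = (\<Sum>l\<in>B. z ^ ?m l) * ((1 - X s) powr (real K - 1 / 2) / X s)"
      by (simp only: sum_distrib_right z_def)
    also have "\<dots> \<le> integrand n s"
      unfolding integrand_def K using * X_pos[OF L] by (intro mult_right_mono) auto
    finally show "?\<Phi> (X s) \<le> integrand n s" .
  qed
  finally show ?thesis by simp
qed

text \<open>Exponential growth of the peak, uniformly in \<open>D\<close>, makes the contribution 2
  of the base cycle itself negligible.\<close>

lemma (in laplace) A0_ge: "exp (real n / 12) \<le> A0 n"
proof -
  have "1 / 12 \<le> ln (D - 1) + (D - 2) / 2 * ln ((D - 2) / D)"
  proof (cases "D = 3")
    case True
    have "2 * (1 / 3) / (2 + 1 / 3) \<le> ln (1 + 1 / 3 :: real)" by (rule ln_one_plus_ge) simp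
    moreover have "ln (4 / 3 :: real) = ln 4 - ln 3" by (simp add: ln_div)
    then have "ln (1 + 1 / 3 :: real) = 2 * ln 2 - ln 3" using ln_realpow[of 2 2] by simp
    moreover have "ln (1 / 3 :: real) = - ln 3" by (simp add: ln_div)
    ultimately show ?thesis by (simp add: True)
  next
    case False
    then have D4: "4 \<le> D" using D by blast
    \<comment> \<open>For \<open>4 \<le> D\<close> the second summand is at least
      \<open>- 1\<close>, so \<open>ln 3\<close> must exceed 1 by \<open>1 / 12\<close>.\<close>
    have "exp (1 + 1 / 12 :: real) = exp 1 * exp (1 / 12)" by (rule exp_add)
    also have "\<dots> \<le> (272 / 100) * (1 + 1 / 12 + (1 / 12)\<^sup>2)"
      using e_less_272 exp_bound[of "1 / 12"] by (intro mult_mono) auto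
    also have "\<dots> \<le> 3" by (simp add: power2_eq_square)
    finally have "1 + 1 / 12 \<le> ln (3::real)" by (subst ln_ge_iff) simp_all
    also have "\<dots> \<le> ln (D - 1)" using D4 by simp
    finally have "1 + 1 / 12 \<le> ln (D - 1)" .
    moreover have "- 1 \<le> (D - 2) / 2 * ln ((D - 2) / D)"
    proof -
      have "ln (D / (D - 2)) \<le> D / (D - 2) - 1" using D4 by (intro ln_le_minus_one) simp
      also have "\<dots> = 2 / (D - 2)" using D4 by (simp add: field_simps)
      finally have "(D - 2) / 2 * ln (D / (D - 2)) \<le> (D - 2) / 2 * (2 / (D - 2))"
        using D4 by (intro mult_left_mono) auto
      also have "\<dots> = 1" using D4 by simp
      finally have "(D - 2) / 2 * ln (D / (D - 2)) \<le> 1" .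
      moreover have "ln ((D - 2) / D) = - ln (D / (D - 2))" using D4 by (simp add: ln_div)
      ultimately show ?thesis using D4 by simp
    qed
    ultimately show ?thesis by linarith
  qed
  then have "real n * (1 / 12) \<le> real n * (ln (D - 1) + (D - 2) / 2 * ln ((D - 2) / D))"
    by (intro mult_left_mono) auto
  also have "exp \<dots> = A0 n"
    using D3 by (simp add: A0_def powr_def distrib_left exp_add exp_of_nat_mult)
  finally show ?thesis by simp
qed

text \<open>Everything beyond \<open>D / (D - 2)\<close> after dividing by the first moment, made
  free of \<open>d\<close>: the 3 bounds \<open>D / (D - 2)\<close>, and \<open>D ^ 3\<close> is
  replaced by \<open>n ^ 3\<close>. All summands are exponentially small or at most of order
  \<open>1 / sqrt n\<close>.\<close>

definition error_term :: "nat \<Rightarrow> real" where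
  "error_term n = 3 * (exp (1 / (4 * real n)) * (1 + (3 / 4) ^ n) - 1) +
     exp (1 / (4 * real n)) * (sqrt (real n / (2 * pi)) *
       (2 * exp (- real n / 12) + (1 + (3 / 4) ^ n) * (218304 / real n)
        + 8 * (real n + 1) * real n ^ 3 * exp (- real n / 288)))"

lemma error_term_bound: "\<exists>C\<ge>0. \<forall>n>0. error_term n \<le> C / sqrt (real n)"
proof -
  have "(\<lambda>n. sqrt (real n) * error_term n) \<in> O(\<lambda>_. 1)"
    unfolding error_term_def by real_asymp
  then obtain c where "\<forall>\<^sub>F n in sequentially. norm (sqrt (real n) * error_term n) \<le> c"
    by (auto elim!: landau_o.bigE)
  \<comment> \<open>An eventually bounded sequence is bounded, so the constant also serves the
    finitely many small \<open>n\<close>.\<close>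
  then have "Bseq (\<lambda>n. sqrt (real n) * error_term n)" by (rule BfunI)
  then obtain C where C: "0 < C" "\<And>n. norm (sqrt (real n) * error_term n) \<le> C" by (rule BseqE) blast
  have "error_term n \<le> C / sqrt (real n)" if "0 < n" for n
    using C(2)[of n] that by (simp add: le_divide_eq mult.commute)
  then show ?thesis using C(1) by (intro exI[of _ C]) simp
qed

text \<open>Dividing by the first moment multiplies the integral bound by
  \<open>w * x / A0 n\<close>. The factor \<open>w\<close> cancels the Gaussian constant and leaves
  \<open>D / (D - 2)\<close> as main term.\<close>

lemma second_moment_error:
  fixes n d :: nat
  assumes n: "2 \<le> n" and d: "3 \<le> d" "d \<le> n" and ev: "even (n * d)"
  shows "measure_pmf.expectation (config_model n d) (\<lambda>P. (normalized_ham_count n d P)\<^sup>2)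
    \<le> real d / (real d - 2) + error_term n"
proof -
  define D where "D = real d"
  define K where "K = n * d div 2 - n"
  interpret laplace D by unfold_locales (use d in \<open>auto simp: D_def\<close>)
  define r where "r = D / (D - 2)"
  have r: "0 \<le> r" "r \<le> 3" using D3 by (simp_all add: r_def divide_le_eq)
  define A where "A = fact (n - 1) * (D * (D - 1)) ^ n * real (odd_fact K) / real (odd_fact (n * d div 2))"
  define w where "w = sqrt (real n / (2 * pi))"
  define x where "x = exp (1 / (4 * real n))"
  define y where "y = 1 + (3 / 4 :: real) ^ n"
  define p q where "p = 218304 / real n" and "q = 8 * (real n + 1) * real n ^ 3 * exp (- real n / 288)"
  define U where "U = y * (r * sqrt (2 * pi / real n) + p) + 8 * (real n + 1) * D ^ 3 * exp (- real n / 288)"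
  have w: "0 < w" "sqrt (2 * pi / real n) = 1 / w" using n by (simp_all add: w_def real_sqrt_divide)
  have x: "0 < x" "1 \<le> x" "exp (- 1 / (4 * real n)) = 1 / x" by (simp_all add: x_def exp_minus inverse_eq_divide)
  have y: "1 \<le> y" by (simp add: y_def)
  have "sqrt (2 * pi / real n) * A0 n * exp (- 1 / (4 * real n)) \<le> A"
    unfolding A0_def A_def K_def unfolding D_def using n d ev by (intro first_moment_lower) auto
  then have A: "A0 n / (w * x) \<le> A" unfolding w(2) x(3) by simp
  have A_pos: "0 < A0 n / (w * x)" using A0_pos[of n] w x by simp
  have U: "8 * (real n + 1) * D ^ 3 * exp (- real n / 288) \<le> q"
    unfolding q_def using d D3 by (intro mult_right_mono mult_left_mono power_mono) (auto simp: D_def)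
  have U0: "0 \<le> U" using r w y D3 by (simp add: U_def p_def)
  have "measure_pmf.expectation (config_model n d) (\<lambda>P. (normalized_ham_count n d P)\<^sup>2) \<le> (2 + A0 n * U) / A"
  proof -
    have "measure_pmf.expectation (config_model n d) (\<lambda>P. (normalized_ham_count n d P)\<^sup>2) \<le>
      (\<Sum>l | l \<in> valid_labellings n d \<and> card (new_vertices n l) \<le> K.
         fact (card (new_vertices n l) - 1) * real (odd_fact (K - card (new_vertices n l))) / real (odd_fact K)) / A"
      using second_moment_le[OF n _ ev] d unfolding A_def K_def D_def by simp
    also have "\<dots> \<le> (2 + A0 n * U) / A"
      using valid_labellings_sum_le[OF n d(1) ev] A A_pos
      unfolding U_def y_def r_def p_def K_def D_def by (intro divide_right_mono) auto
    finally show ?thesis .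
  qed
  also have "\<dots> \<le> (2 + A0 n * U) / (A0 n / (w * x))"
    using A A_pos U0 A0_pos[of n] by (intro divide_left_mono mult_pos_pos) auto
  also have "\<dots> = x * (w * (2 / A0 n + U))" using A0_pos[of n] w(1) x(1) by (simp add: field_simps)
  also have "\<dots> \<le> x * (w * (2 * exp (- real n / 12) + (y * (r * (1 / w) + p) + q)))"
  proof (intro mult_left_mono add_mono)
    have "1 / A0 n \<le> 1 / exp (real n / 12)" using A0_ge[of n] A0_pos[of n] by (intro divide_left_mono) auto
    then show "2 / A0 n \<le> 2 * exp (- real n / 12)" by (simp add: exp_minus inverse_eq_divide)
    show "U \<le> y * (r * (1 / w) + p) + q" unfolding U_def w(2) using U by simp
  qed (use w x in auto)
  also have "\<dots> = r + (r * (x * y - 1) + x * (w * (2 * exp (- real n / 12) + y * p + q)))"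
    using w(1) by (simp add: field_simps)
  also have "\<dots> \<le> r + (3 * (x * y - 1) + x * (w * (2 * exp (- real n / 12) + y * p + q)))"
    using r x y mult_mono[of 1 x 1 y] by (intro add_left_mono add_right_mono mult_right_mono) auto
  also have "\<dots> = real d / (real d - 2) + error_term n"
    by (simp add: error_term_def r_def D_def x_def y_def w_def p_def q_def)
  finally show ?thesis .
qed

theorem proposition1p9:
  fixes \<alpha> :: real
  assumes "1 \<le> \<alpha>" and "\<alpha> < 8 / sqrt 2"
  shows "\<exists>M::real. \<forall>n d :: nat.
           3 \<le> n \<longrightarrow> 3 \<le> d \<longrightarrow> even (n * d) \<longrightarrow> real d \<le> sqrt (real n) / ln (real n) \<longrightarrow>
           measure_pmf.expectation (config_model n d) (\<lambda>P. (normalized_ham_count n d P)\<^sup>2)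
             \<le> real d / (real d - 2) + M * (real d powr (3 / 2 * (1 + 1 / \<alpha>)) / sqrt (real n))"
proof -
  obtain C where C: "0 \<le> C" "\<And>n. 0 < n \<Longrightarrow> error_term n \<le> C / sqrt (real n)" using error_term_bound by blast
  show ?thesis
  proof (intro exI allI impI)
    fix n d :: nat
    assume n: "3 \<le> n" and d: "3 \<le> d" and ev: "even (n * d)" and dn: "real d \<le> sqrt (real n) / ln (real n)"
    \<comment> \<open>From \<open>3 \<le> n\<close> it follows that \<open>ln n \<ge> 1\<close>, so
      the growth condition yields \<open>d \<le> n\<close>.\<close>
    have "exp 1 \<le> real n" using e_less_272 n by linarith
    then have ln: "1 \<le> ln (real n)" using n by (subst ln_ge_iff) auto
    note dn
    also have "sqrt (real n) / ln (real n) \<le> sqrt (real n) / 1"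
      using ln by (intro divide_left_mono) auto
    also have "\<dots> \<le> real n" using n by (simp add: real_le_lsqrt power2_eq_square)
    finally have "d \<le> n" by simp
    \<comment> \<open>The power of \<open>d\<close> is at least 1, so the constant \<open>C\<close>,
      fixed before \<open>n\<close> and \<open>d\<close>, serves as \<open>M\<close>.\<close>
    have "1 \<le> real d powr (3 / 2 * (1 + 1 / \<alpha>))" using d assms by (intro ge_one_powr_ge_zero) auto
    then have "C * (1 / sqrt (real n)) \<le> C * (real d powr (3 / 2 * (1 + 1 / \<alpha>)) / sqrt (real n))"
      using C(1) by (intro mult_left_mono divide_right_mono) auto
    moreover have "error_term n \<le> C * (1 / sqrt (real n))" using C(2)[of n] n by simp
    ultimately show "measure_pmf.expectation (config_model n d) (\<lambda>P. (normalized_ham_count n d P)\<^sup>2)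
        \<le> real d / (real d - 2) + C * (real d powr (3 / 2 * (1 + 1 / \<alpha>)) / sqrt (real n))"
      using second_moment_error[OF _ d \<open>d \<le> n\<close> ev] n by simp
  qed
qed

end
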